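(* For every $\varepsilon>0$ there is $n_0\in\mathbb{N}$ such that for all $n\ge n_0$ every $n$-vertex graph $G$ satisfies $$\max\{\hom(G),f(G)\}\ \ge\ n^{1/2-\varepsilon}.$$ (That is, every $n$-vertex graph $G$ satisfies $\max\{\hom(G),f(G)\}\ge n^{1/2-o(1)}$, where the $o(1)$ term depends only on $n$.)
   Context: Graphs are finite and simple. For a graph $G$, $\hom(G)$ is the maximum of $|U|$ over $U\subset V(G)$ such that the induced subgraph $G[U]$ is complete or empty (edgeless). $f(G)$ is the maximum $k\in\mathbb{N}$ such that some induced subgraph $G[S]$, $S\subset V(G)$, has $k$ distinct vertex degrees. *)

theory Defs
  imports "HOL-Analysis.Analysis" "Graph_Theory.Graph_Theory"
begin

text \<open>
  A finite simple graph is a \<^locale>\<open>pair_graph\<close>: a finite vertex set together with a symmetric,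
  irreflexive set of arcs, so that an edge uv is the pair of arcs (u,v) and (v,u).
  Hence the degree of a vertex is its \<^const>\<open>out_degree\<close> (equivalently, its in-degree).
  The sets whose maxima are taken below are finite and nonempty for every finite graph:
  they consist of numbers at most \<open>card (verts G)\<close>, and the empty vertex set contributes 0.
\<close>

definition is_complete :: "('a, 'b) pre_digraph \<Rightarrow> bool" where
  "is_complete G \<longleftrightarrow> K\<^bsub>card (verts G)\<^esub> G"

definition edgeless :: "('a, 'b) pre_digraph \<Rightarrow> bool" where
  "edgeless G \<longleftrightarrow> arcs G = {}"

definition hom_num :: "('a, 'b) pre_digraph \<Rightarrow> nat" where
  "hom_num G = Max {card U | U. U \<subseteq> verts G \<and> (is_complete (G \<restriction> U) \<or> edgeless (G \<restriction> U))}"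

definition num_distinct_degrees :: "('a, 'b) pre_digraph \<Rightarrow> nat" where
  "num_distinct_degrees G = card (out_degree G ` verts G)"

definition max_distinct_degrees :: "('a, 'b) pre_digraph \<Rightarrow> nat" where
  "max_distinct_degrees G = Max {num_distinct_degrees (G \<restriction> S) | S. S \<subseteq> verts G}"

end

theory Submission
  imports Defs "HOL-Probability.Probability" "HOL-Real_Asymp.Real_Asymp"
begin

text \<open>
  Suppose that \<open>G\<close> has no homogeneous set of size \<open>k = \<surd>n\<close>, and let the distance of two vertices, measured
  in a set \<open>X\<close>, be the number of elements of \<open>X\<close> adjacent to exactly one of them. Turan's argument shows
  that a set which has radius \<open>S\<close> in its own distance has fewer than \<open>4kS\<close> elements. It is enough to find
  a set \<open>U\<close> of nearly \<open>k\<close> vertices and a random set \<open>W\<close> disjoint from \<open>U\<close> such that the collisions of the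
  degrees into \<open>W\<close> number \<open>n\<^sup>o\<^sup>(\<^sup>1\<^sup>) |U|\<close> on average.

  These are built recursively. Among the subsets of a set and the radii \<open>S\<close> bounding them, choose the pair
  \<open>(B, S)\<close> maximizing \<open>|B|\<^bsup>1-\<zeta>\<^esup> S\<^bsup>-y\<^esup>\<close>; then balls in \<open>B\<close> whose radius is a little smaller than \<open>S\<close>
  are much smaller than \<open>B\<close>. Split \<open>B\<close> into a part \<open>X\<close> that is partly covered by clusters of a common size
  and radius \<open>r\<close>, far from each other, and a part \<open>Z\<close> in which the distances are measured. Inside the clusters
  use recursion. To separate clusters, pick a representative \<open>z\<close> in each and let \<open>x\<^sub>z\<close> be the symmetric
  difference of its neighbourhood and that of the centre of \<open>B\<close>. Since the difference of two
  neighbourhoods correlates with one of the two sets \<open>x\<^sub>z\<close>, it suffices to give each \<open>x\<^sub>z\<close> its own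
  share \<open>T\<^sub>z\<close> of \<open>Z\<close> and to include the elements of \<open>T\<^sub>z\<close> in \<open>W\<close> with one common random density:
  this spreads the difference of two degrees over an interval of length proportional to the imbalance
  of the two neighbourhoods on \<open>T\<^sub>z\<close>, whereas independent sampling would only give its square root.
\<close>

section \<open>Sampling with a random density\<close>

text \<open>The mean of \<open>f (c - D)\<close>, where \<open>D\<close> is the difference of independent binomial variables with \<open>a\<close> and \<open>b\<close>
  trials and success probability \<open>x\<close>.\<close>

fun walk_mean :: "(int \<Rightarrow> real) \<Rightarrow> nat \<Rightarrow> nat \<Rightarrow> int \<Rightarrow> real \<Rightarrow> real" where
  "walk_mean f 0 0 c x = f c"
| "walk_mean f 0 (Suc b) c x = (1 - x) * walk_mean f 0 b c x + x * walk_mean f 0 b (c + 1) x"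
| "walk_mean f (Suc a) b c x = (1 - x) * walk_mean f a b c x + x * walk_mean f a b (c - 1) x"

lemma walk_mean_0: "walk_mean f 0 0 c = (\<lambda>x. f c)"
  by (rule ext) simp

lemma walk_mean_Suc_right:
  "walk_mean f a (Suc b) c x = (1 - x) * walk_mean f a b c x + x * walk_mean f a b (c + 1) x"
proof (induction a arbitrary: c)
  case (Suc a)
  show ?case by (simp only: walk_mean.simps Suc) (simp add: algebra_simps)
qed simp

lemma walk_mean_diff:
  "walk_mean (\<lambda>c. f c - g c) a b c x = walk_mean f a b c x - walk_mean g a b c x"
proof (induction a arbitrary: c)
  case 0
  show ?case
  proof (induction b arbitrary: c)
    case (Suc b)
    show ?case by (simp only: walk_mean.simps Suc) (simp add: algebra_simps)
  qed simp
next
  case (Suc a)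
  show ?case by (simp only: walk_mean.simps Suc) (simp add: algebra_simps)
qed

lemma walk_mean_shift: "walk_mean (\<lambda>c. f (c + d)) a b c x = walk_mean f a b (c + d) x"
proof (induction a arbitrary: c)
  case 0
  show ?case by (induction b arbitrary: c) (simp_all add: algebra_simps)
qed (simp add: algebra_simps)

lemma walk_mean_endpoints: "walk_mean f a b c 0 = f c" "walk_mean f a b c 1 = f (c - int a + int b)"
proof -
  show "walk_mean f a b c 0 = f c"
  proof (induction a arbitrary: c)
    case 0
    show ?case by (induction b arbitrary: c) simp_all
  qed simp
  show "walk_mean f a b c 1 = f (c - int a + int b)"
  proof (induction a arbitrary: c)
    case 0
    show ?case by (induction b arbitrary: c) (simp_all add: algebra_simps)
  qed (simp add: algebra_simps)
qed

lemma continuous_walk_mean: "continuous_on S (walk_mean f a b c)"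
proof (induction a arbitrary: c)
  case 0
  show ?case
  proof (induction b arbitrary: c)
    case (Suc b)
    then show ?case by (auto intro!: continuous_intros)
  qed (simp add: continuous_on_const)
qed (auto intro!: continuous_intros)

text \<open>All trials share one success probability, so the derivative sums over the trials the
  effect of turning a failure into a success; trials of one kind contribute equally. For
  \<open>a = 0\<close> or \<open>b = 0\<close> the truncated predecessor is harmless, since its term
  has the factor 0.\<close>

lemma walk_mean_deriv:
  "(walk_mean f a b c has_real_derivative
     real a * (walk_mean f (a - 1) b (c - 1) x - walk_mean f (a - 1) b c x) +
     real b * (walk_mean f a (b - 1) (c + 1) x - walk_mean f a (b - 1) c x)) (at x)"
proof (induction a arbitrary: c)
  case 0
  show ?case
  proof (induction b arbitrary: c)
    case (Suc b)
    have 1: "walk_mean f 0 (Suc b) c = (\<lambda>x. (1 - x) * walk_mean f 0 b c x + x * walk_mean f 0 b (c + 1) x)"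
      by auto
    have 2: "real b * walk_mean f 0 b d x = real b * ((1 - x) * walk_mean f 0 (b-1) d x + x * walk_mean f 0 (b-1) (d + 1) x)" for d
      by (cases b) auto
    show ?case
      unfolding 1
      by (rule derivative_eq_intros Suc.IH refl)+ (use 2 [of c] 2[of "c+1"] in \<open>simp add: algebra_simps\<close>)
  qed (simp add: fun_eq_iff[symmetric] walk_mean_0)
next
  case (Suc a)
  have 1: "walk_mean f (Suc a) b c = (\<lambda>x. (1 - x) * walk_mean f a b c x + x * walk_mean f a b (c - 1) x)"
    by auto
  have 2: "real a * walk_mean f a b d x = real a * ((1 - x) * walk_mean f (a-1) b d x + x * walk_mean f (a-1) b (d - 1) x)" for d
    by (cases a) auto
  show ?case
    unfolding 1
    by (rule derivative_eq_intros Suc.IH refl)+ (use 2 [of c] 2[of "c-1"] in \<open>simp add: algebra_simps\<close>)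
qed

text \<open>The probability of \<open>D = c\<close> when the success probability is itself uniform
  in the unit interval.\<close>

definition walk_hit :: "nat \<Rightarrow> nat \<Rightarrow> int \<Rightarrow> real" where
  "walk_hit a b c = integral {0..1} (walk_mean (\<lambda>c. of_bool (c = 0)) a b c)"

lemma walk_mean_integrable: "walk_mean f a b c integrable_on {0..1}"
  by (rule integrable_continuous_real continuous_walk_mean)+

text \<open>Integrate the derivative in \<open>x\<close> of the probability that \<open>D > c\<close>; it telescopes to point probabilities.\<close>

lemma walk_hit_rec: "real (Suc a) * walk_hit a b c \<le> 1 + real b * walk_hit (Suc a) (b - 1) (c + 1)"
proof -
  let ?t = "\<lambda>c::int. of_bool (c \<le> 0) :: real" and ?p = "\<lambda>c::int. of_bool (c = 0) :: real"
  \<comment> \<open>Adjacent thresholds differ by a point indicator, which turns the derivative of a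
    tail into point probabilities.\<close>
  have d1: "walk_mean ?t a b (c - 1) x - walk_mean ?t a b c x = walk_mean ?p a b (c - 1) x" for a b c x
  proof -
    have "walk_mean ?p a b (c - 1) x = walk_mean (\<lambda>c. ?p (c + (-1))) a b c x"
      by (subst walk_mean_shift) simp
    also have "(\<lambda>c. ?p (c + (-1))) = (\<lambda>c. ?t (c + (-1)) - ?t c)" by (auto simp: of_bool_def)
    also have "walk_mean \<dots> a b c x = walk_mean ?t a b (c - 1) x - walk_mean ?t a b c x"
      by (subst walk_mean_diff, subst walk_mean_shift) simp
    finally show ?thesis by simp
  qed
  let ?A = "walk_mean ?p a b c" and ?B = "walk_mean ?p (Suc a) (b - 1) (c + 1)"
  \<comment> \<open>\<open>walk_mean ?t (Suc a) b (c + 1)\<close> is the probability of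
    \<open>D > c\<close>. Trials of the first kind raise \<open>D\<close> and those of the second
    kind lower it, whence the signs. The right side is at most 1 because both endpoint values are 0
    or 1.\<close>
  have "((\<lambda>x. real (Suc a) * ?A x - real b * ?B x) has_integral
        walk_mean ?t (Suc a) b (c + 1) 1 - walk_mean ?t (Suc a) b (c + 1) 0) {0..1}"
  proof (rule fundamental_theorem_of_calculus)
    fix x :: real
    have "(walk_mean ?t (Suc a) b (c + 1) has_real_derivative
       real (Suc a) * ?A x - real b * ?B x) (at x)"
    proof -
      have *: "walk_mean ?t a b (c + 1 - 1) x - walk_mean ?t a b (c + 1) x = ?A x"
        "walk_mean ?t (Suc a) (b - 1) (c + 1 + 1) x - walk_mean ?t (Suc a) (b - 1) (c + 1) x = - ?B x"
        using d1[of a b "c + 1" x] d1[of "Suc a" "b - 1" "c + 2" x]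
        by (simp_all add: add.commute[of _ c] add.assoc del: walk_mean.simps)
      show ?thesis
        using walk_mean_deriv[of ?t "Suc a" b "c + 1" x]
        unfolding diff_Suc_1 * by (simp del: walk_mean.simps)
    qed
    then show "(walk_mean ?t (Suc a) b (c + 1) has_vector_derivative
       real (Suc a) * ?A x - real b * ?B x) (at x within {0..1})"
      by (simp add: has_real_derivative_iff_has_vector_derivative has_vector_derivative_at_within)
  qed simp
  moreover have "((\<lambda>x. real (Suc a) * ?A x - real b * ?B x) has_integral
        real (Suc a) * walk_hit a b c - real b * walk_hit (Suc a) (b - 1) (c + 1)) {0..1}"
    unfolding walk_hit_def
    by (intro has_integral_diff has_integral_mult_right integrable_integral walk_mean_integrable)
  ultimately have "real (Suc a) * walk_hit a b c - real b * walk_hit (Suc a) (b - 1) (c + 1)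
      = walk_mean ?t (Suc a) b (c + 1) 1 - walk_mean ?t (Suc a) b (c + 1) 0"
    by (rule has_integral_unique[symmetric])
  also have "\<dots> \<le> 1"
    by (simp add: walk_mean_endpoints del: walk_mean.simps)
  finally show ?thesis by linarith
qed

text \<open>Each use of \<open>walk_hit_rec\<close> moves one trial from the second kind to the
  first, so the imbalance grows by 2 while \<open>b\<close> drops to 0, where the recursion alone
  gives the bound.\<close>

lemma walk_hit_le: "b \<le> a \<Longrightarrow> walk_hit a b c \<le> 1 / (real a - real b + 1)"
proof (induction b arbitrary: a c)
  case 0
  then show ?case using walk_hit_rec[of a 0 c] by (simp add: field_simps)
next
  case (Suc b)
  have "real (Suc a) * walk_hit a (Suc b) c \<le> 1 + real (Suc b) * walk_hit (Suc a) b (c + 1)"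
    using walk_hit_rec[of a "Suc b" c] by simp
  also have "\<dots> \<le> 1 + real (Suc b) * (1 / (real (Suc a) - real b + 1))"
    using Suc.prems by (intro add_left_mono mult_left_mono Suc.IH) auto
  finally have 1: "real (Suc a) * walk_hit a (Suc b) c \<le> 1 + real (Suc b) * (1 / (real (Suc a) - real b + 1))" .
  define d where "d = real a - real b"
  have d: "d \<ge> 1" "real a = real b + d" using Suc.prems by (auto simp: d_def)
  have "1 + real (Suc b) * (1 / (real (Suc a) - real b + 1)) \<le> real (Suc a) * (1 / d)"
    using d by (simp add: divide_simps) (simp add: algebra_simps)
  with 1 have "real (Suc a) * walk_hit a (Suc b) c \<le> real (Suc a) * (1 / d)" by linarith
  then have "walk_hit a (Suc b) c \<le> 1 / d" by (rule mult_left_le_imp_le) simp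
  then show ?case by (simp add: d_def)
qed

text \<open>A bound, uniform in \<open>c\<close>, on the probability that the degrees of two vertices with neighbourhoods \<open>A\<close> and \<open>B\<close>
  into the random set differ by exactly \<open>c\<close>. Uniformity makes it stable under adding independent pieces.\<close>

definition conc :: "'a set pmf \<Rightarrow> 'a set \<Rightarrow> 'a set \<Rightarrow> real \<Rightarrow> bool" where
  "conc \<mu> A B q \<longleftrightarrow> (\<forall>c::int. measure_pmf.prob \<mu> {W. int (card (A \<inter> W)) - int (card (B \<inter> W)) = c} \<le> q)"

lemma conc_sym: "conc \<mu> A B q \<Longrightarrow> conc \<mu> B A q"
  unfolding conc_def
proof
  fix c :: int assume *: "\<forall>c. measure_pmf.prob \<mu> {W. int (card (A \<inter> W)) - int (card (B \<inter> W)) = c} \<le> q"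
  have "{W. int (card (B \<inter> W)) - int (card (A \<inter> W)) = c} = {W. int (card (A \<inter> W)) - int (card (B \<inter> W)) = - c}"
    by auto
  with * show "measure_pmf.prob \<mu> {W. int (card (B \<inter> W)) - int (card (A \<inter> W)) = c} \<le> q" by simp
qed

section \<open>Random subsets of a given density\<close>

lemma sum_Pow_insert:
  assumes "finite T" "x \<notin> T"
  shows "(\<Sum>W\<in>Pow (insert x T). g W) = (\<Sum>W\<in>Pow T. g W) + (\<Sum>W\<in>Pow T. g (insert x W))"
proof -
  have "inj_on (insert x) (Pow T)"
    using assms by (auto simp: inj_on_def)
  then show ?thesis using assms
    by (subst Pow_insert, subst sum.union_disjoint) (auto simp: sum.reindex)
qed

text \<open>The weights are those of a random subset of \<open>T\<close> of density
  \<open>x\<close>. Points are exposed one by one: a point of \<open>A\<close> is a trial of the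
  first kind and a point of \<open>B\<close> one of the second.\<close>

lemma walk_mean_sets:
  fixes A B T :: "'a set" and x :: real
  assumes "finite T" "A \<inter> B = {}"
  shows "(\<Sum>W\<in>Pow T. f (c - int (card (A \<inter> W)) + int (card (B \<inter> W))) * (x ^ card W * (1 - x) ^ card (T - W)))
    = walk_mean f (card (A \<inter> T)) (card (B \<inter> T)) c x"
  using assms(1)
proof (induction T arbitrary: c rule: finite_induct)
  case empty
  then show ?case by simp
next
  case (insert y T)
  have fin: "finite W" if "W \<in> Pow T" for W using that insert finite_subset by auto
  have 1: "(\<Sum>W\<in>Pow T. f (c - int (card (A \<inter> W)) + int (card (B \<inter> W))) * (x ^ card W * (1 - x) ^ card (insert y T - W)))
     = (1 - x) * (\<Sum>W\<in>Pow T. f (c - int (card (A \<inter> W)) + int (card (B \<inter> W))) * (x ^ card W * (1 - x) ^ card (T - W)))"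
    unfolding sum_distrib_left
  proof (rule sum.cong)
    fix W assume "W \<in> Pow T"
    then have "card (insert y T - W) = Suc (card (T - W))"
      using insert.hyps by (subst insert_Diff_if) (auto)
    then show "f (c - int (card (A \<inter> W)) + int (card (B \<inter> W))) * (x ^ card W * (1 - x) ^ card (insert y T - W)) =
       (1 - x) * (f (c - int (card (A \<inter> W)) + int (card (B \<inter> W))) * (x ^ card W * (1 - x) ^ card (T - W)))"
      by simp
  qed simp
  \<comment> \<open>The offset after \<open>y\<close> has been included. A point outside both sets
    leaves it unchanged, and its weights \<open>x\<close> and \<open>1 - x\<close> add up to
    1.\<close>
  define c' where "c' = (if y \<in> A then c - 1 else if y \<in> B then c + 1 else c)"
  have 2: "(\<Sum>W\<in>Pow T. f (c - int (card (A \<inter> insert y W)) + int (card (B \<inter> insert y W))) * (x ^ card (insert y W) * (1 - x) ^ card (insert y T - insert y W)))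
     = x * (\<Sum>W\<in>Pow T. f (c' - int (card (A \<inter> W)) + int (card (B \<inter> W))) * (x ^ card W * (1 - x) ^ card (T - W)))"
    unfolding sum_distrib_left
  proof (rule sum.cong)
    fix W assume W: "W \<in> Pow T"
    then have y: "y \<notin> W" using insert.hyps by auto
    have "insert y T - insert y W = T - W" using insert.hyps by auto
    moreover have "c - int (card (A \<inter> insert y W)) + int (card (B \<inter> insert y W)) = c' - int (card (A \<inter> W)) + int (card (B \<inter> W))"
      using y fin[OF W] assms(2) by (auto simp: c'_def)
    ultimately show "f (c - int (card (A \<inter> insert y W)) + int (card (B \<inter> insert y W))) * (x ^ card (insert y W) * (1 - x) ^ card (insert y T - insert y W)) =
       x * (f (c' - int (card (A \<inter> W)) + int (card (B \<inter> W))) * (x ^ card W * (1 - x) ^ card (T - W)))"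
      using y fin[OF W] by simp
  qed simp
  have "walk_mean f (card (A \<inter> insert y T)) (card (B \<inter> insert y T)) c x =
     (1 - x) * walk_mean f (card (A \<inter> T)) (card (B \<inter> T)) c x + x * walk_mean f (card (A \<inter> T)) (card (B \<inter> T)) c' x"
    using insert.hyps assms(2) by (auto simp: c'_def walk_mean_Suc_right algebra_simps)
  then show ?case
    using insert.hyps by (simp only: sum_Pow_insert[OF insert.hyps] 1 2 insert.IH)
qed

text \<open>Take every element of \<open>T\<close> with the same probability \<open>x\<close>, where \<open>x\<close> is uniform in \<open>[0,1]\<close>.\<close>

lemma uniform_density_block:
  fixes T :: "'a set"
  assumes "finite T"
  shows "\<exists>\<mu>. set_pmf \<mu> \<subseteq> Pow T \<and>
    (\<forall>A B. conc \<mu> A B (1 / (1 + \<bar>real (card (A \<inter> T)) - real (card (B \<inter> T))\<bar>)))"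
proof -
  \<comment> \<open>The mass of \<open>W\<close> after averaging over the density; it is a beta
    integral, but only its linearity is used.\<close>
  define w where "w W = integral {0..1} (\<lambda>x::real. x ^ card W * (1 - x) ^ card (T - W))" for W
  have int: "(\<lambda>x::real. x ^ i * (1 - x) ^ j) integrable_on {0..1}" for i j
    by (intro integrable_continuous_real continuous_intros)
  have w0: "w W \<ge> 0" for W
    unfolding w_def by (intro integral_nonneg int) auto
  have wsum: "(\<Sum>W\<in>Pow T. f (c - int (card (A \<inter> W)) + int (card (B \<inter> W))) * w W) =
     integral {0..1} (walk_mean f (card (A \<inter> T)) (card (B \<inter> T)) c)" if "A \<inter> B = {}" for f c A B
  proof -
    have "(\<Sum>W\<in>Pow T. f (c - int (card (A \<inter> W)) + int (card (B \<inter> W))) * w W) =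
      integral {0..1} (\<lambda>x. \<Sum>W\<in>Pow T. f (c - int (card (A \<inter> W)) + int (card (B \<inter> W))) * (x ^ card W * (1 - x) ^ card (T - W)))"
      unfolding w_def
      by (subst integral_sum) (auto intro!: integrable_on_mult_right int simp: assms)
    also have "\<dots> = integral {0..1} (walk_mean f (card (A \<inter> T)) (card (B \<inter> T)) c)"
      by (intro integral_cong walk_mean_sets assms that)
    finally show ?thesis .
  qed
  define \<mu> where "\<mu> = embed_pmf (\<lambda>W. if W \<in> Pow T then w W else 0)"
  \<comment> \<open>The total mass is the case of two empty sets and the constant function
    1.\<close>
  have "(\<Sum>W\<in>Pow T. w W) = 1"
    using wsum[of "{}" "{}" "\<lambda>_. 1" 0] by (simp add: walk_mean_0)
  then have "(\<integral>\<^sup>+ W. ennreal (if W \<in> Pow T then w W else 0) \<partial>count_space UNIV) = 1"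
    using assms w0
    by (subst nn_integral_count_space'[where A = "Pow T"]) (auto simp: sum_ennreal)
  then have pmf: "pmf \<mu> W = (if W \<in> Pow T then w W else 0)" for W
    unfolding \<mu>_def by (subst pmf_embed_pmf) (auto simp: w0)
  have sub: "set_pmf \<mu> \<subseteq> Pow T"
    by (auto simp: set_pmf_iff pmf split: if_splits)
  have prob: "measure_pmf.prob \<mu> E = (\<Sum>W\<in>Pow T. of_bool (W \<in> E) * w W)" for E
  proof -
    have "measure_pmf.prob \<mu> E = measure_pmf.prob \<mu> (E \<inter> Pow T)"
      using sub by (intro measure_prob_cong_0) (auto simp: pmf)
    also have "\<dots> = (\<Sum>W\<in>E \<inter> Pow T. pmf \<mu> W)"
      using assms by (intro measure_measure_pmf_finite) auto
    also have "\<dots> = (\<Sum>W\<in>E \<inter> Pow T. w W)" by (intro sum.cong) (auto simp: pmf)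
    also have "\<dots> = (\<Sum>W\<in>Pow T. of_bool (W \<in> E) * w W)"
      using assms by (intro sum.mono_neutral_cong_left) auto
    finally show ?thesis .
  qed
  have main: "conc \<mu> A B (1 / (1 + \<bar>real (card (A \<inter> T)) - real (card (B \<inter> T))\<bar>))"
    if AB: "card (B \<inter> T) \<le> card (A \<inter> T)" for A B
    unfolding conc_def
  proof
    fix c :: int
    \<comment> \<open>Common points of \<open>A\<close> and \<open>B\<close> cancel, so the walk
      runs on the disjoint sets \<open>A - B\<close> and \<open>B - A\<close>, which have the same
      imbalance.\<close>
    have split: "int (card (A \<inter> S)) - int (card (B \<inter> S)) = int (card ((A - B) \<inter> S)) - int (card ((B - A) \<inter> S))"
      if "S \<in> Pow T" for S
    proof -
      have f: "finite S" using that assms finite_subset by auto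
      have "card (A \<inter> S) = card ((A - B) \<inter> S) + card (A \<inter> B \<inter> S)"
        using f by (subst card_Un_disjoint[symmetric]) (auto intro!: arg_cong[where f = card])
      moreover have "card (B \<inter> S) = card ((B - A) \<inter> S) + card (A \<inter> B \<inter> S)"
        using f by (subst card_Un_disjoint[symmetric]) (auto intro!: arg_cong[where f = card])
      ultimately show ?thesis by simp
    qed
    have "measure_pmf.prob \<mu> {W. int (card (A \<inter> W)) - int (card (B \<inter> W)) = c} =
       (\<Sum>W\<in>Pow T. of_bool (c - int (card ((A-B) \<inter> W)) + int (card ((B-A) \<inter> W)) = 0) * w W)"
      unfolding prob
    proof (intro sum.cong refl)
      fix W assume "W \<in> Pow T"
      from split[OF this] show "of_bool (W \<in> {W. int (card (A \<inter> W)) - int (card (B \<inter> W)) = c}) * w W =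
         of_bool (c - int (card ((A-B) \<inter> W)) + int (card ((B-A) \<inter> W)) = 0) * w W"
        by (auto simp: of_bool_def)
    qed
    also have "\<dots> = walk_hit (card ((A - B) \<inter> T)) (card ((B - A) \<inter> T)) c"
      unfolding walk_hit_def by (subst wsum) auto
    also have "\<dots> \<le> 1 / (real (card ((A - B) \<inter> T)) - real (card ((B - A) \<inter> T)) + 1)"
      using AB split[of T] by (intro walk_hit_le) auto
    also have "\<dots> = 1 / (1 + \<bar>real (card (A \<inter> T)) - real (card (B \<inter> T))\<bar>)"
      using AB split[of T] by simp
    finally show "measure_pmf.prob \<mu> {W. int (card (A \<inter> W)) - int (card (B \<inter> W)) = c}
      \<le> 1 / (1 + \<bar>real (card (A \<inter> T)) - real (card (B \<inter> T))\<bar>)" .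
  qed
  have "conc \<mu> A B (1 / (1 + \<bar>real (card (A \<inter> T)) - real (card (B \<inter> T))\<bar>))" for A B
    using main[of B A] main[of A B]
    by (cases "card (B \<inter> T) \<le> card (A \<inter> T)") (auto intro: conc_sym simp: abs_minus_commute)
  with sub show ?thesis by blast
qed

section \<open>Mixtures and independent unions\<close>

lemma conc_bind_pmf:
  assumes "\<And>W. W \<in> set_pmf \<nu> \<Longrightarrow> conc (f W) A B q"
  shows "conc (bind_pmf \<nu> f) A B q"
  unfolding conc_def
proof
  fix c :: int
  let ?E = "{W. int (card (A \<inter> W)) - int (card (B \<inter> W)) = c}"
  obtain W where "W \<in> set_pmf \<nu>" using set_pmf_not_empty by fast
  from assms[OF this] have "measure_pmf.prob (f W) ?E \<le> q" by (simp add: conc_def)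
  then have q: "q \<ge> 0" by (rule order_trans[OF measure_nonneg])
  have "emeasure (measure_pmf (bind_pmf \<nu> f)) ?E = (\<integral>\<^sup>+ W. emeasure (measure_pmf (f W)) ?E \<partial>\<nu>)"
    by simp
  also have "\<dots> \<le> (\<integral>\<^sup>+ W. ennreal q \<partial>\<nu>)"
    using assms by (intro nn_integral_mono_AE)
      (auto simp: AE_measure_pmf_iff measure_pmf.emeasure_eq_measure conc_def q)
  also have "\<dots> = ennreal q" by simp
  finally show "measure_pmf.prob (bind_pmf \<nu> f) ?E \<le> q"
    using q by (simp add: measure_pmf.emeasure_eq_measure)
qed

text \<open>A fixed set disjoint from the random one shifts the difference by a constant, and
  \<open>conc\<close> is uniform in the target value.\<close>

lemma conc_map_union:
  assumes "set_pmf \<mu> \<subseteq> Pow S" "finite S" "finite W'" "S \<inter> W' = {}" "conc \<mu> A B q"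
  shows "conc (map_pmf (\<lambda>W. W \<union> W') \<mu>) A B q"
  unfolding conc_def
proof
  fix c :: int
  let ?d = "\<lambda>W. int (card (A \<inter> W)) - int (card (B \<inter> W))"
  have 1: "?d (W \<union> W') = ?d W + ?d W'" if "W \<in> set_pmf \<mu>" for W
  proof -
    have *: "finite W" "W \<inter> W' = {}" using that assms finite_subset by blast+
    have "card (X \<inter> (W \<union> W')) = card (X \<inter> W) + card (X \<inter> W')" for X
      using * assms by (subst card_Un_disjoint[symmetric]) (auto intro!: arg_cong[where f = card])
    then show ?thesis by simp
  qed
  have "measure_pmf.prob (map_pmf (\<lambda>W. W \<union> W') \<mu>) {W. ?d W = c} = measure_pmf.prob \<mu> {W. ?d (W \<union> W') = c}"
    by (simp add: vimage_def)
  also have "\<dots> = measure_pmf.prob \<mu> {W. ?d W = c - ?d W'}"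
  proof (intro measure_prob_cong_0)
    show "pmf \<mu> W = 0" if "W \<in> {W. ?d (W \<union> W') = c} - {W. ?d W = c - ?d W'}" for W
      using 1[of W] that by (cases "W \<in> set_pmf \<mu>") (auto simp: set_pmf_iff)
    show "pmf \<mu> W = 0" if "W \<in> {W. ?d W = c - ?d W'} - {W. ?d (W \<union> W') = c}" for W
      using 1[of W] that by (cases "W \<in> set_pmf \<mu>") (auto simp: set_pmf_iff)
  qed
  also have "\<dots> \<le> q" using assms(5) by (simp add: conc_def)
  finally show "measure_pmf.prob (map_pmf (\<lambda>W. W \<union> W') \<mu>) {W. ?d W = c} \<le> q" .
qed

text \<open>Given the other pieces, the union is one piece plus a fixed set, so every bound known
  for a single piece survives.\<close>

lemma conc_independent_union:
  assumes "finite I" "\<And>i. i \<in> I \<Longrightarrow> finite (S i)" "disjoint_family_on S I"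
    and "\<And>i. i \<in> I \<Longrightarrow> set_pmf (\<mu> i) \<subseteq> Pow (S i)"
  shows "\<exists>\<nu>. set_pmf \<nu> \<subseteq> Pow (\<Union>i\<in>I. S i) \<and>
     (\<forall>i\<in>I. \<forall>A B q. conc (\<mu> i) A B q \<longrightarrow> conc \<nu> A B q)"
  using assms
proof (induction I rule: finite_induct)
  case empty
  show ?case by (intro exI[of _ "return_pmf {}"]) auto
next
  case (insert j I)
  let ?R = "\<Union>i\<in>I. S i"
  obtain \<nu> where \<nu>: "set_pmf \<nu> \<subseteq> Pow ?R" "\<And>i A B q. i \<in> I \<Longrightarrow> conc (\<mu> i) A B q \<Longrightarrow> conc \<nu> A B q"
    using insert.IH insert.prems by (auto simp: disjoint_family_on_def)
  have fin: "finite ?R" "finite (S j)" using insert by auto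
  have disj: "S j \<inter> ?R = {}" using insert.prems(2) insert.hyps by (auto simp: disjoint_family_on_def)
  have sj: "set_pmf (\<mu> j) \<subseteq> Pow (S j)" using insert.prems by auto
  \<comment> \<open>Written in this order, conditioning on the old part keeps the bounds of
    \<open>\<mu> j\<close>; the commuted form below conditions on the new part and keeps those of
    \<open>\<nu>\<close>.\<close>
  define \<rho> where "\<rho> = bind_pmf \<nu> (\<lambda>W'. map_pmf (\<lambda>W. W \<union> W') (\<mu> j))"
  have \<rho>: "\<rho> = bind_pmf (\<mu> j) (\<lambda>W'. map_pmf (\<lambda>W. W \<union> W') \<nu>)"
    unfolding \<rho>_def map_pmf_def by (subst bind_commute_pmf) (simp add: Un_commute)
  have "set_pmf \<rho> \<subseteq> Pow (\<Union>i\<in>insert j I. S i)"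
    using \<nu>(1) sj by (auto simp: \<rho>_def; blast)
  moreover have "conc \<rho> A B q" if "conc (\<mu> j) A B q" for A B q
    unfolding \<rho>_def
  proof (intro conc_bind_pmf conc_map_union[OF sj fin(2) _ _ that])
    fix W' assume "W' \<in> set_pmf \<nu>"
    then have "W' \<subseteq> ?R" using \<nu>(1) by auto
    then show "finite W'" "S j \<inter> W' = {}" using fin disj finite_subset by blast+
  qed
  moreover have "conc \<rho> A B q" if "conc \<nu> A B q" for A B q
    unfolding \<rho>
  proof (intro conc_bind_pmf conc_map_union[OF \<nu>(1) fin(1) _ _ that])
    fix W' assume "W' \<in> set_pmf (\<mu> j)"
    then have "W' \<subseteq> S j" using sj by auto
    then show "finite W'" "?R \<inter> W' = {}" using fin disj finite_subset by blast+
  qed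
  ultimately show ?case using \<nu>(2) by (intro exI[of _ \<rho>]) auto
qed

section \<open>Combinatorial selection lemmas\<close>

text \<open>Picking a vertex and deleting it together with its neighbours discards at most
  \<open>D\<close> vertices per pick.\<close>

lemma greedy_independent_set:
  assumes "finite Z" "\<And>u v. v \<in> R u \<longleftrightarrow> u \<in> R v"
    and "\<And>u. u \<in> Z \<Longrightarrow> card (insert u (R u) \<inter> Z) \<le> D"
  shows "\<exists>I\<subseteq>Z. (\<forall>u\<in>I. \<forall>v\<in>I. u \<noteq> v \<longrightarrow> v \<notin> R u) \<and> card Z \<le> card I * D"
  using assms
proof (induction "card Z" arbitrary: Z rule: less_induct)
  case less
  show ?case
  proof (cases "Z = {}")
    case False
    then obtain u where u: "u \<in> Z" by auto
    define Z' where "Z' = Z - insert u (R u)"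
    have lt: "card Z' < card Z"
      using u less.prems(1) unfolding Z'_def by (intro psubset_card_mono) auto
    have sub: "card (insert v (R v) \<inter> Z') \<le> D" if "v \<in> Z'" for v
    proof -
      have "card (insert v (R v) \<inter> Z') \<le> card (insert v (R v) \<inter> Z)"
        using less.prems(1) by (intro card_mono) (auto simp: Z'_def)
      also have "\<dots> \<le> D" using that less.prems(3) by (auto simp: Z'_def)
      finally show ?thesis .
    qed
    have "finite Z'" using less.prems(1) by (simp add: Z'_def)
    from less.hyps[OF lt this less.prems(2) sub] obtain I where
      I: "I \<subseteq> Z'" "\<And>u v. u \<in> I \<Longrightarrow> v \<in> I \<Longrightarrow> u \<noteq> v \<Longrightarrow> v \<notin> R u" "card Z' \<le> card I * D" by blast
    have fI: "finite I" using I(1) \<open>finite Z'\<close> finite_subset by blast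
    have "card Z = card Z' + card (insert u (R u) \<inter> Z)"
      using less.prems(1) unfolding Z'_def
      by (subst card_Un_disjoint[symmetric]) (auto intro!: arg_cong[where f = card])
    also have "\<dots> \<le> card I * D + D" using I(3) less.prems(3)[OF u] by (rule add_mono)
    also have "\<dots> = card (insert u I) * D"
    proof -
      have "u \<notin> I" using I(1) by (auto simp: Z'_def)
      then show ?thesis using fI by simp
    qed
    finally have "card Z \<le> card (insert u I) * D" .
    moreover have "insert u I \<subseteq> Z" using I(1) u by (auto simp: Z'_def)
    moreover have "v \<notin> R u'" if "u' \<in> insert u I" "v \<in> insert u I" "u' \<noteq> v" for u' v
      using that I(1) I(2)[of u' v] less.prems(2)[of u u'] by (auto simp: Z'_def)
    ultimately show ?thesis by blast
  qed auto
qed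

text \<open>A Chernoff bound for a uniformly random subset of \<open>Y\<close>, written as a count:
  a bad set is charged an exponential weight, whose sum over all subsets factors over the points of
  \<open>Y\<close>.\<close>

lemma card_few_hits_le:
  fixes Y :: "'a set"
  assumes "finite Y" "F \<subseteq> Y"
  shows "real (card {Z \<in> Pow Y. 4 * card (F \<inter> Z) < card F}) \<le> 2 ^ card Y * (88/100) ^ card F"
proof -
  \<comment> \<open>\<open>?x\<close> is the fourth power of \<open>1 / ?c\<close>, matching the
    threshold of one quarter. Each point of \<open>F\<close> then costs
    \<open>?c * (1 + ?x) / 2\<close>, about 0.878, rounded up to 88/100.\<close>
  let ?c = "13/10 :: real" and ?x = "(10/13) ^ 4 :: real"
  let ?bad = "{Z \<in> Pow Y. 4 * card (F \<inter> Z) < card F}"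
  have fF: "finite F" using assms finite_subset by auto
  have "real (card ?bad) * (1 / ?c ^ card F) = (\<Sum>Z\<in>?bad. 1 / ?c ^ card F)" by simp
  also have "\<dots> \<le> (\<Sum>Z\<in>?bad. ?x ^ card (F \<inter> Z))"
  proof (rule sum_mono)
    fix Z assume "Z \<in> ?bad"
    then have "4 * card (F \<inter> Z) \<le> card F" by auto
    then have "(10/13 :: real) ^ card F \<le> (10/13) ^ (4 * card (F \<inter> Z))"
      by (intro power_decreasing) auto
    then show "1 / ?c ^ card F \<le> ?x ^ card (F \<inter> Z)"
      by (simp add: power_mult power_divide)
  qed
  also have "\<dots> \<le> (\<Sum>Z\<in>Pow Y. ?x ^ card (F \<inter> Z))"
    using assms by (intro sum_mono2) auto
  also have "\<dots> = (\<Sum>Z\<in>Pow Y. (\<Prod>y\<in>Z. if y \<in> F then ?x else 1) * (\<Prod>y\<in>Y-Z. 1))"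
  proof (intro sum.cong refl)
    fix Z assume "Z \<in> Pow Y"
    then have "finite Z" using assms finite_subset by auto
    then have "(\<Prod>y\<in>Z. if y \<in> F then ?x else 1) = ?x ^ card (F \<inter> Z)"
      by (simp add: prod.If_cases Int_commute)
    then show "?x ^ card (F \<inter> Z) = (\<Prod>y\<in>Z. if y \<in> F then ?x else 1) * (\<Prod>y\<in>Y-Z. 1)" by simp
  qed
  also have "\<dots> = (\<Prod>y\<in>Y. (if y \<in> F then ?x else 1) + 1)"
    using assms by (subst prod_add) auto
  also have "\<dots> = (\<Prod>y\<in>Y. if y \<in> F then ?x + 1 else 2)"
    by (intro prod.cong) auto
  also have "\<dots> = (?x + 1) ^ card F * 2 ^ card (Y - F)"
    using assms by (simp add: prod.If_cases Int_absorb1 Diff_eq)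
  also have "\<dots> = ((?x + 1) / 2) ^ card F * 2 ^ card Y"
  proof -
    have "card Y = card F + card (Y - F)"
      using assms fF by (subst card_Diff_subset) (auto simp: card_mono)
    then have "(2::real) ^ card Y = 2 ^ card F * 2 ^ card (Y - F)" by (simp only: power_add)
    then show ?thesis unfolding power_divide by simp
  qed
  finally have "real (card ?bad) \<le> ((?x + 1) / 2) ^ card F * 2 ^ card Y * ?c ^ card F"
    by (simp add: field_simps)
  also have "\<dots> = 2 ^ card Y * ((?x + 1) / 2 * ?c) ^ card F"
    unfolding power_mult_distrib[of "(?x + 1) / 2"] by (simp only: mult.commute mult.left_commute)
  also have "\<dots> \<le> 2 ^ card Y * (88/100) ^ card F"
    by (intro mult_left_mono power_mono) (auto simp: power4_eq_xxxx)
  finally show ?thesis .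
qed

text \<open>A uniformly random \<open>Z\<close> and its complement have the same law, so each member
  of the family fails with probability at most twice the Chernoff bound; the last assumption is the
  union bound.\<close>

lemma balanced_split:
  fixes Y :: "'a set"
  assumes "finite Y" "finite \<F>" "\<And>F. F \<in> \<F> \<Longrightarrow> F \<subseteq> Y" "\<And>F. F \<in> \<F> \<Longrightarrow> f0 \<le> card F"
    and "2 * real (card \<F>) * (88/100) ^ f0 < 1"
  shows "\<exists>Z\<subseteq>Y. \<forall>F\<in>\<F>. card F \<le> 4 * card (F \<inter> Z) \<and> card F \<le> 4 * card (F - Z)"
proof (rule ccontr)
  let ?b = "\<lambda>F. {Z \<in> Pow Y. 4 * card (F \<inter> Z) < card F}"
  assume neg: "\<not> ?thesis"
  have "Pow Y \<subseteq> (\<Union>F\<in>\<F>. ?b F \<union> (\<lambda>Z. Y - Z) ` ?b F)"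
  proof
    fix Z assume Z: "Z \<in> Pow Y"
    then obtain F where F: "F \<in> \<F>" "4 * card (F \<inter> Z) < card F \<or> 4 * card (F - Z) < card F"
      using neg by (auto simp: not_le)
    have "F - Z = F \<inter> (Y - Z)" using assms(3)[OF F(1)] by auto
    then have "Z \<in> ?b F \<or> Y - Z \<in> ?b F" using F(2) Z by auto
    moreover have "Z = Y - (Y - Z)" using Z by auto
    ultimately show "Z \<in> (\<Union>F\<in>\<F>. ?b F \<union> (\<lambda>Z. Y - Z) ` ?b F)" using F(1) by blast
  qed
  then have "card (Pow Y) \<le> card (\<Union>F\<in>\<F>. ?b F \<union> (\<lambda>Z. Y - Z) ` ?b F)"
    using assms by (intro card_mono) auto
  also have "\<dots> \<le> (\<Sum>F\<in>\<F>. card (?b F \<union> (\<lambda>Z. Y - Z) ` ?b F))"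
    using assms by (intro card_UN_le) auto
  also have "\<dots> \<le> (\<Sum>F\<in>\<F>. 2 * card (?b F))"
  proof (rule sum_mono)
    fix F
    have "card ((\<lambda>Z. Y - Z) ` ?b F) \<le> card (?b F)" using assms by (intro card_image_le) auto
    then show "card (?b F \<union> (\<lambda>Z. Y - Z) ` ?b F) \<le> 2 * card (?b F)"
      using card_Un_le[of "?b F" "(\<lambda>Z. Y - Z) ` ?b F"] by linarith
  qed
  finally have "real (2 ^ card Y) \<le> real (\<Sum>F\<in>\<F>. 2 * card (?b F))"
    using assms(1) by (simp only: card_Pow of_nat_le_iff)
  also have "\<dots> = (\<Sum>F\<in>\<F>. 2 * real (card (?b F)))" by simp
  also have "\<dots> \<le> (\<Sum>F\<in>\<F>. 2 * (2 ^ card Y * (88/100) ^ f0))"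
  proof (intro sum_mono mult_left_mono)
    fix F assume F: "F \<in> \<F>"
    have "real (card (?b F)) \<le> 2 ^ card Y * (88/100) ^ card F"
      using assms F by (intro card_few_hits_le) auto
    also have "\<dots> \<le> 2 ^ card Y * (88/100) ^ f0"
      using assms(4)[OF F] by (intro mult_left_mono power_decreasing) auto
    finally show "real (card (?b F)) \<le> 2 ^ card Y * (88/100) ^ f0" .
  qed auto
  also have "\<dots> = 2 ^ card Y * (2 * real (card \<F>) * (88/100) ^ f0)" by simp
  also have "\<dots> < 2 ^ card Y * 1" using assms(5) by (intro mult_strict_left_mono) auto
  finally show False by simp
qed

text \<open>For a uniformly random \<open>\<phi>\<close> the summands are independent with mean 0
  and second moment \<open>(C - 1) * (g w)^2\<close>. The offset \<open>a\<close> absorbs the points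
  already drawn in the induction.\<close>

lemma slot_second_moment:
  fixes g :: "'a \<Rightarrow> real" and l :: "'a \<Rightarrow> nat"
  assumes "finite Z" "C \<ge> 1" "\<And>w. w \<in> Z \<Longrightarrow> l w < C"
  shows "(\<Sum>\<phi>\<in>PiE Z (\<lambda>_. {..<C}). (a + (\<Sum>w\<in>Z. g w * (real C * of_bool (\<phi> w = l w) - 1)))\<^sup>2)
     = real C ^ card Z * (a\<^sup>2 + (real C - 1) * (\<Sum>w\<in>Z. (g w)\<^sup>2))"
  using assms(1,3)
proof (induction Z arbitrary: a rule: finite_induct)
  case empty
  then show ?case by simp
next
  case (insert x Z)
  let ?P = "PiE Z (\<lambda>_. {..<C})"
  let ?h = "\<lambda>w y. g w * (real C * of_bool (y = l w) - 1)"
  have inj: "inj_on (\<lambda>(y, \<phi>). \<phi>(x := y)) ({..<C} \<times> ?P)"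
    by (rule inj_combinator) (use insert.hyps in auto)
  have "(\<Sum>\<phi>\<in>PiE (insert x Z) (\<lambda>_. {..<C}). (a + (\<Sum>w\<in>insert x Z. ?h w (\<phi> w)))\<^sup>2)
    = (\<Sum>(y, \<phi>)\<in>{..<C} \<times> ?P. (a + (\<Sum>w\<in>insert x Z. ?h w ((\<phi>(x := y)) w)))\<^sup>2)"
    by (subst PiE_insert_eq, subst sum.reindex[OF inj]) (auto intro!: sum.cong)
  also have "\<dots> = (\<Sum>y<C. \<Sum>\<phi>\<in>?P. (a + (\<Sum>w\<in>insert x Z. ?h w ((\<phi>(x := y)) w)))\<^sup>2)"
    by (simp only: sum.cartesian_product)
  also have "\<dots> = (\<Sum>y<C. \<Sum>\<phi>\<in>?P. ((a + ?h x y) + (\<Sum>w\<in>Z. ?h w (\<phi> w)))\<^sup>2)"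
  proof (intro sum.cong refl)
    fix y \<phi>
    have "(\<Sum>w\<in>Z. ?h w ((\<phi>(x := y)) w)) = (\<Sum>w\<in>Z. ?h w (\<phi> w))"
      using insert.hyps by (intro sum.cong) auto
    then show "(a + (\<Sum>w\<in>insert x Z. ?h w ((\<phi>(x := y)) w)))\<^sup>2 = ((a + ?h x y) + (\<Sum>w\<in>Z. ?h w (\<phi> w)))\<^sup>2"
      using insert.hyps by (simp add: add.assoc)
  qed
  also have "\<dots> = (\<Sum>y<C. real C ^ card Z * ((a + ?h x y)\<^sup>2 + (real C - 1) * (\<Sum>w\<in>Z. (g w)\<^sup>2)))"
    using insert.IH insert.prems by (intro sum.cong) auto
  also have "\<dots> = real C ^ card Z * ((\<Sum>y<C. (a + ?h x y)\<^sup>2) + real C * ((real C - 1) * (\<Sum>w\<in>Z. (g w)\<^sup>2)))"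
    by (simp add: sum_distrib_left[symmetric] sum.distrib)
  also have "(\<Sum>y<C. (a + ?h x y)\<^sup>2) = (a + g x * (real C - 1))\<^sup>2 + (\<Sum>y\<in>{..<C} - {l x}. (a - g x)\<^sup>2)"
    using insert.prems by (subst sum.remove[of _ "l x"]) auto
  also have "(\<Sum>y\<in>{..<C} - {l x}. (a - g x)\<^sup>2) = (real C - 1) * (a - g x)\<^sup>2"
    using insert.prems assms(2) by (simp add: card_Diff_singleton_if of_nat_diff)
  also have "(a + g x * (real C - 1))\<^sup>2 + (real C - 1) * (a - g x)\<^sup>2 = real C * (a\<^sup>2 + (real C - 1) * (g x)\<^sup>2)"
    by (simp add: power2_eq_square algebra_simps)
  finally show ?case using insert.hyps by (simp add: algebra_simps)
qed

section \<open>Disjoint shares and representatives by averaging\<close>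

lemma exists_le_average:
  fixes f :: "'a \<Rightarrow> real"
  assumes "finite A" "A \<noteq> {}" "sum f A \<le> real (card A) * c"
  shows "\<exists>a\<in>A. f a \<le> c"
proof (rule ccontr)
  assume "\<not> ?thesis"
  then have "sum f A > (\<Sum>a\<in>A. c)" using assms by (intro sum_strict_mono) auto
  then show False using assms by simp
qed

text \<open>Every point \<open>w\<close> joins one of the at most \<open>C\<close> sets \<open>P \<tau>\<close> containing it, or none: it draws one of
  \<open>C\<close> slots, of which each of these sets owns at least one.\<close>

lemma disjoint_selection:
  fixes P :: "'i \<Rightarrow> 'a set" and g :: "'p \<Rightarrow> 'a \<Rightarrow> real"
  assumes "finite Z" "finite \<T>" "finite J" "C \<ge> 1" "r > 0"
    and P: "\<And>\<tau>. \<tau> \<in> \<T> \<Longrightarrow> P \<tau> \<subseteq> Z" "\<And>\<tau>. \<tau> \<in> \<T> \<Longrightarrow> real (card (P \<tau>)) \<le> S"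
    and cover: "\<And>w. w \<in> Z \<Longrightarrow> card {\<tau> \<in> \<T>. w \<in> P \<tau>} \<le> C"
    and g: "\<And>p w. p \<in> J \<Longrightarrow> \<bar>g p w\<bar> \<le> 1"
    and \<tau>: "\<And>p. p \<in> J \<Longrightarrow> \<tau> p \<in> \<T>" "\<And>p. p \<in> J \<Longrightarrow> \<bar>\<Sum>w\<in>P (\<tau> p). g p w\<bar> \<ge> 2 * r"
  shows "\<exists>T. (\<forall>\<tau>\<in>\<T>. T \<tau> \<subseteq> P \<tau>) \<and> disjoint_family_on T \<T> \<and>
     (\<Sum>p\<in>J. 1 / (1 + \<bar>\<Sum>w\<in>T (\<tau> p). g p w\<bar>)) \<le> real (card J) * (real C / r + real C * S / r\<^sup>2)"
proof -
  \<comment> \<open>Each set containing \<open>w\<close> gets its own slot of \<open>w\<close>; this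
    injectivity is what makes the shares disjoint.\<close>
  have "\<forall>w\<in>Z. \<exists>l. inj_on l {\<tau> \<in> \<T>. w \<in> P \<tau>} \<and> l ` {\<tau> \<in> \<T>. w \<in> P \<tau>} \<subseteq> {..<C}"
  proof
    fix w assume "w \<in> Z"
    then have "card {\<tau> \<in> \<T>. w \<in> P \<tau>} \<le> card {..<C}" using cover by simp
    then show "\<exists>l. inj_on l {\<tau> \<in> \<T>. w \<in> P \<tau>} \<and> l ` {\<tau> \<in> \<T>. w \<in> P \<tau>} \<subseteq> {..<C}"
      using card_le_inj[of "{\<tau> \<in> \<T>. w \<in> P \<tau>}" "{..<C}"] assms(2) by auto
  qed
  from bchoice[OF this] obtain l where l': "\<forall>w\<in>Z. inj_on (l w) {\<tau> \<in> \<T>. w \<in> P \<tau>} \<and> l w ` {\<tau> \<in> \<T>. w \<in> P \<tau>} \<subseteq> {..<C}"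
    by blast
  have l: "inj_on (l w) {\<tau> \<in> \<T>. w \<in> P \<tau>}" if "w \<in> Z" for w
    using l' that by blast
  have l_less: "l w \<tau> < C" if "w \<in> Z" "\<tau> \<in> \<T>" "w \<in> P \<tau>" for w \<tau>
    using l' that by (auto simp: image_subset_iff)
  define T where "T \<phi> \<tau> = {w \<in> P \<tau>. \<phi> w = l w \<tau>}" for \<phi> \<tau>
  let ?\<Phi> = "PiE Z (\<lambda>_. {..<C})"
  define Y where "Y \<phi> p = (\<Sum>w\<in>T \<phi> (\<tau> p). g p w)" for \<phi> p
  have fin\<Phi>: "finite ?\<Phi>" using assms by (intro finite_PiE) auto
  have card\<Phi>: "real (card ?\<Phi>) = real C ^ card Z" using assms by (simp add: card_PiE)
  have ne: "?\<Phi> \<noteq> {}" using assms(4) by (auto simp: PiE_eq_empty_iff lessThan_empty_iff)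
  have main: "(\<Sum>\<phi>\<in>?\<Phi>. 1 / (1 + \<bar>Y \<phi> p\<bar>)) \<le> real (card ?\<Phi>) * (real C / r + real C * S / r\<^sup>2)" if p: "p \<in> J" for p
  proof -
    have \<tau>p: "\<tau> p \<in> \<T>" "P (\<tau> p) \<subseteq> Z" "finite (P (\<tau> p))"
      using \<tau>(1)[OF p] P(1)[OF \<tau>(1)[OF p]] finite_subset[OF _ assms(1)] by auto
    \<comment> \<open>Outside \<open>P (\<tau> p)\<close> the weight is 0, and the default slot 0
      only has to be below \<open>C\<close>.\<close>
    let ?g = "\<lambda>w. if w \<in> P (\<tau> p) then g p w else 0" and ?l = "\<lambda>w. if w \<in> P (\<tau> p) then l w (\<tau> p) else 0"
    let ?G = "\<Sum>w\<in>P (\<tau> p). g p w"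
    \<comment> \<open>\<open>C\<close> times the sum over the drawn share minus the sum over the
      whole set: a deviation of mean 0.\<close>
    define D where "D \<phi> = (\<Sum>w\<in>Z. ?g w * (real C * of_bool (\<phi> w = ?l w) - 1))" for \<phi>
    have D: "D \<phi> = real C * Y \<phi> p - ?G" for \<phi>
    proof -
      have "D \<phi> = (\<Sum>w\<in>P (\<tau> p). g p w * (real C * of_bool (\<phi> w = l w (\<tau> p)) - 1))"
        unfolding D_def using \<tau>p assms(1) by (intro sum.mono_neutral_cong_right) auto
      also have "\<dots> = real C * (\<Sum>w\<in>P (\<tau> p). if \<phi> w = l w (\<tau> p) then g p w else 0) - ?G"
        unfolding sum_distrib_left sum_subtractf[symmetric] by (intro sum.cong) (auto simp: algebra_simps)
      also have "(\<Sum>w\<in>P (\<tau> p). if \<phi> w = l w (\<tau> p) then g p w else 0) = Y \<phi> p"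
        unfolding Y_def T_def using \<tau>p by (simp add: sum.inter_filter)
      finally show ?thesis .
    qed
    \<comment> \<open>Chebyshev's argument made pointwise. Either the share already has a sum of at
      least \<open>r / C\<close>, or, the full sum being at least \<open>2 * r\<close>,
      \<open>D\<close> deviates by at least \<open>r\<close> and the trivial bound 1 is paid by the
      second term.\<close>
    have pt: "1 / (1 + \<bar>Y \<phi> p\<bar>) \<le> real C / r + (D \<phi>)\<^sup>2 / r\<^sup>2" for \<phi>
    proof (cases "\<bar>Y \<phi> p\<bar> \<ge> r / real C")
      case True
      have "1 / (1 + \<bar>Y \<phi> p\<bar>) \<le> 1 / (r / real C)"
        using True assms(4,5) by (intro divide_left_mono mult_pos_pos) (auto simp: add_pos_nonneg)
      also have "\<dots> = real C / r" by simp
      finally show ?thesis by (rule order_trans) simp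
    next
      case False
      then have "\<bar>real C * Y \<phi> p\<bar> < r" using assms(4,5) by (simp add: abs_mult field_simps)
      then have "\<bar>D \<phi>\<bar> \<ge> r" using \<tau>(2)[OF p] unfolding D by linarith
      then have "r\<^sup>2 \<le> (D \<phi>)\<^sup>2" using assms(5) by (simp add: abs_le_square_iff[symmetric])
      then have "1 \<le> (D \<phi>)\<^sup>2 / r\<^sup>2" using assms(5) by simp
      moreover have "1 / (1 + \<bar>Y \<phi> p\<bar>) \<le> 1" by simp
      moreover have "real C / r \<ge> 0" using assms(5) by simp
      ultimately show ?thesis by linarith
    qed
    have "(\<Sum>\<phi>\<in>?\<Phi>. (D \<phi>)\<^sup>2) = real C ^ card Z * ((real C - 1) * (\<Sum>w\<in>Z. (?g w)\<^sup>2))"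
    proof -
      have "?l w < C" if "w \<in> Z" for w using that \<tau>p(1) l_less assms(4) by auto
      from slot_second_moment[OF assms(1,4) this, where a = 0 and g = ?g] show ?thesis
        unfolding D_def by simp
    qed
    also have "\<dots> \<le> real C ^ card Z * (real C * S)"
    proof (intro mult_left_mono mult_mono)
      have "(\<Sum>w\<in>Z. (?g w)\<^sup>2) = (\<Sum>w\<in>P (\<tau> p). (g p w)\<^sup>2)"
        using \<tau>p assms(1) by (intro sum.mono_neutral_cong_right) auto
      also have "\<dots> \<le> (\<Sum>w\<in>P (\<tau> p). 1)"
        using g[OF p] by (intro sum_mono) (simp add: abs_square_le_1)
      also have "\<dots> \<le> S" using P(2) \<tau>p by simp
      finally show "(\<Sum>w\<in>Z. (?g w)\<^sup>2) \<le> S" .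
    qed (auto intro: sum_nonneg)
    finally have DD: "(\<Sum>\<phi>\<in>?\<Phi>. (D \<phi>)\<^sup>2) \<le> real C ^ card Z * (real C * S)" .
    have "(\<Sum>\<phi>\<in>?\<Phi>. 1 / (1 + \<bar>Y \<phi> p\<bar>)) \<le> (\<Sum>\<phi>\<in>?\<Phi>. real C / r + (D \<phi>)\<^sup>2 / r\<^sup>2)"
      by (intro sum_mono pt)
    also have "\<dots> = real C ^ card Z * (real C / r) + (\<Sum>\<phi>\<in>?\<Phi>. (D \<phi>)\<^sup>2) / r\<^sup>2"
      by (simp add: sum.distrib sum_divide_distrib card\<Phi>)
    also have "\<dots> \<le> real C ^ card Z * (real C / r) + (real C ^ card Z * (real C * S)) / r\<^sup>2"
      by (intro add_left_mono divide_right_mono DD) auto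
    finally show ?thesis by (simp add: card\<Phi> algebra_simps)
  qed
  have "(\<Sum>\<phi>\<in>?\<Phi>. \<Sum>p\<in>J. 1 / (1 + \<bar>Y \<phi> p\<bar>)) = (\<Sum>p\<in>J. \<Sum>\<phi>\<in>?\<Phi>. 1 / (1 + \<bar>Y \<phi> p\<bar>))"
    by (rule sum.swap)
  also have "\<dots> \<le> (\<Sum>p\<in>J. real (card ?\<Phi>) * (real C / r + real C * S / r\<^sup>2))"
    by (intro sum_mono main)
  also have "\<dots> = real (card ?\<Phi>) * (real (card J) * (real C / r + real C * S / r\<^sup>2))"
    by simp
  finally obtain \<phi> where \<phi>: "\<phi> \<in> ?\<Phi>"
    "(\<Sum>p\<in>J. 1 / (1 + \<bar>Y \<phi> p\<bar>)) \<le> real (card J) * (real C / r + real C * S / r\<^sup>2)"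
    using exists_le_average[OF fin\<Phi> ne] by blast
  have "disjoint_family_on (T \<phi>) \<T>"
    unfolding disjoint_family_on_def
  proof (intro ballI impI)
    fix s t assume st: "s \<in> \<T>" "t \<in> \<T>" "s \<noteq> t"
    show "T \<phi> s \<inter> T \<phi> t = {}"
    proof (rule ccontr)
      assume "T \<phi> s \<inter> T \<phi> t \<noteq> {}"
      then obtain w where "w \<in> T \<phi> s" "w \<in> T \<phi> t" by auto
      then have w: "w \<in> P s" "w \<in> P t" "l w s = l w t" by (simp_all add: T_def)
      then have "w \<in> Z" using P(1) st by auto
      from inj_onD[OF l[OF this] w(3)] w st show False by auto
    qed
  qed
  then show ?thesis using \<phi>(2) unfolding Y_def
    by (intro exI[of _ "T \<phi>"]) (auto simp: T_def)
qed

lemma greedy_representatives: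
  fixes x :: "'a \<Rightarrow> 'a set" and Q :: "'e \<Rightarrow> 'a set"
  assumes "finite Z" "finite E0" "\<And>e. e \<in> E0 \<Longrightarrow> finite (Q e)" "disjoint_family_on Q E0"
    and Q: "\<And>e. e \<in> E0 \<Longrightarrow> card (Q e) = \<beta>" "\<beta> > 0" "E0 \<noteq> {}"
    and x: "\<And>e u. e \<in> E0 \<Longrightarrow> u \<in> Q e \<Longrightarrow> real (card (x u \<inter> Z)) \<le> S"
    and cover: "\<And>w. w \<in> Z \<Longrightarrow> real (card {u \<in> (\<Union>e\<in>E0. Q e). w \<in> x u}) \<le> L"
    and "L \<ge> 0" "2 * t \<le> card E0"
  shows "\<exists>E\<subseteq>E0. card E = t \<and> (\<exists>z. (\<forall>e\<in>E. z e \<in> Q e) \<and>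
     (\<Sum>w\<in>Z. (real (card {e \<in> E. w \<in> x (z e)}))\<^sup>2) \<le> real t * S + 4 * L * S * (real t)\<^sup>2 / (real (card E0) * real \<beta>))"
  using assms(11)
proof (induction t)
  case 0
  show ?case by (intro exI[of _ "{}"]) auto
next
  case (Suc t)
  then obtain E z where E: "E \<subseteq> E0" "card E = t" "\<And>e. e \<in> E \<Longrightarrow> z e \<in> Q e"
    and H: "(\<Sum>w\<in>Z. (real (card {e \<in> E. w \<in> x (z e)}))\<^sup>2) \<le> real t * S + 4 * L * S * (real t)\<^sup>2 / (real (card E0) * real \<beta>)"
    by auto
  define cov where "cov w = real (card {e \<in> E. w \<in> x (z e)})" for w
  have fE: "finite E" using E(1) assms(2) finite_subset by blast
  define R where "R = E0 - E"
  have fR: "finite R" using assms by (simp add: R_def)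
  have cR: "2 * card R \<ge> card E0" "card R > 0"
    using Suc.prems E assms(2) fE by (auto simp: R_def card_Diff_subset)
  let ?A = "\<Union>e\<in>R. Q e"
  have fA: "finite ?A" using fR assms by (auto simp: R_def)
  have cA: "card ?A = card R * \<beta>"
  proof -
    have "card ?A = (\<Sum>e\<in>R. card (Q e))"
      using assms(3,4) fR by (intro card_UN_disjoint) (auto simp: R_def disjoint_family_on_def)
    then show ?thesis using Q(1) by (simp add: R_def)
  qed
  have neA: "?A \<noteq> {}" using cA cR Q(2) by (metis card.empty less_numeral_extra(3) mult_is_0 )
  obtain e0 where "e0 \<in> E0" using Q(3) by auto
  then obtain u0 where "u0 \<in> Q e0" using Q(1,2) by (metis card.empty ex_in_conv less_numeral_extra(3))
  have S0: "S \<ge> 0" using x[OF \<open>e0 \<in> E0\<close> \<open>u0 \<in> Q e0\<close>] by linarith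
  have sumcov: "(\<Sum>w\<in>Z. cov w) \<le> real t * S"
  proof -
    have "(\<Sum>w\<in>Z. cov w) = (\<Sum>w\<in>Z. \<Sum>e\<in>E. of_bool (w \<in> x (z e)))"
      unfolding cov_def using fE by (intro sum.cong) (auto simp: of_bool_def sum.If_cases Int_def)
    also have "\<dots> = (\<Sum>e\<in>E. \<Sum>w\<in>Z. of_bool (w \<in> x (z e)))" by (rule sum.swap)
    also have "\<dots> = (\<Sum>e\<in>E. real (card (x (z e) \<inter> Z)))"
      using assms(1) by (intro sum.cong) (auto simp: of_bool_def sum.If_cases Int_def conj_commute)
    also have "\<dots> \<le> (\<Sum>e\<in>E. S)" using E x by (intro sum_mono) auto
    finally show ?thesis using E(2) by simp
  qed
  have "(\<Sum>u\<in>?A. \<Sum>w\<in>x u \<inter> Z. cov w) = (\<Sum>u\<in>?A. \<Sum>w\<in>Z. of_bool (w \<in> x u) * cov w)"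
  proof (rule sum.cong)
    fix u
    show "(\<Sum>w\<in>x u \<inter> Z. cov w) = (\<Sum>w\<in>Z. of_bool (w \<in> x u) * cov w)"
      using assms(1) by (intro sum.mono_neutral_cong_left) auto
  qed simp
  also have "\<dots> = (\<Sum>w\<in>Z. \<Sum>u\<in>?A. of_bool (w \<in> x u) * cov w)" by (rule sum.swap)
  also have "\<dots> = (\<Sum>w\<in>Z. real (card {u \<in> ?A. w \<in> x u}) * cov w)"
    using fA by (intro sum.cong) (auto simp: of_bool_def sum.If_cases Int_def sum_distrib_right[symmetric])
  also have "\<dots> \<le> (\<Sum>w\<in>Z. L * cov w)"
  proof (intro sum_mono mult_right_mono)
    fix w assume w: "w \<in> Z"
    have "card {u \<in> ?A. w \<in> x u} \<le> card {u \<in> (\<Union>e\<in>E0. Q e). w \<in> x u}"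
      using assms by (intro card_mono) (auto simp: R_def)
    then show "real (card {u \<in> ?A. w \<in> x u}) \<le> L" using cover[OF w] by linarith
  qed (simp add: cov_def)
  finally have 1: "(\<Sum>u\<in>?A. \<Sum>w\<in>x u \<inter> Z. cov w) \<le> L * (\<Sum>w\<in>Z. cov w)" by (simp add: sum_distrib_left)
  have Lt: "L * (\<Sum>w\<in>Z. cov w) \<le> real (card ?A) * (2 * L * S * real t / (real (card E0) * real \<beta>))"
  proof -
    have "L * (\<Sum>w\<in>Z. cov w) \<le> L * (real t * S)" using assms(10) sumcov by (rule mult_left_mono[rotated])
    also have "\<dots> \<le> (2 * real (card R) / real (card E0)) * (L * (real t * S))"
    proof -
      have "1 \<le> 2 * real (card R) / real (card E0)" using cR Q(3) assms(2) by (auto simp: field_simps card_gt_0_iff)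
      then have "1 * (L * (real t * S)) \<le> (2 * real (card R) / real (card E0)) * (L * (real t * S))"
        using assms(10) S0 by (intro mult_right_mono) auto
      then show ?thesis by simp
    qed
    also have "\<dots> = real (card ?A) * (2 * L * S * real t / (real (card E0) * real \<beta>))"
      unfolding cA using Q(2) by (simp add: field_simps)
    finally show ?thesis .
  qed
  from exists_le_average[OF fA neA order_trans[OF 1 Lt]] obtain u where u: "u \<in> ?A"
    "(\<Sum>w\<in>x u \<inter> Z. cov w) \<le> 2 * L * S * real t / (real (card E0) * real \<beta>)" by blast
  then obtain e where e: "e \<in> E0" "e \<notin> E" "u \<in> Q e" by (auto simp: R_def)
  define z' where "z' = z(e := u)"
  have cov': "real (card {e' \<in> insert e E. w \<in> x (z' e')}) = cov w + of_bool (w \<in> x u)" for w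
  proof -
    have "{e' \<in> insert e E. w \<in> x (z' e')} = (if w \<in> x u then insert e {e' \<in> E. w \<in> x (z e')} else {e' \<in> E. w \<in> x (z e')})"
      using e by (auto simp: z'_def)
    then show ?thesis using fE e by (auto simp: cov_def)
  qed
  have "(\<Sum>w\<in>Z. (real (card {e' \<in> insert e E. w \<in> x (z' e')}))\<^sup>2)
     = (\<Sum>w\<in>Z. (cov w)\<^sup>2 + 2 * (of_bool (w \<in> x u) * cov w) + of_bool (w \<in> x u))"
    unfolding cov' by (intro sum.cong) (auto simp: power2_eq_square algebra_simps)
  also have "\<dots> = (\<Sum>w\<in>Z. (cov w)\<^sup>2) + 2 * (\<Sum>w\<in>x u \<inter> Z. cov w) + real (card (x u \<inter> Z))"
  proof -
    have "(\<Sum>w\<in>Z. of_bool (w \<in> x u) * cov w) = (\<Sum>w\<in>x u \<inter> Z. cov w)"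
      using assms(1) by (intro sum.mono_neutral_cong_right) auto
    moreover have "(\<Sum>w\<in>Z. of_bool (w \<in> x u)) = real (card (x u \<inter> Z))"
      using assms(1) by (auto simp: of_bool_def sum.If_cases Int_def conj_commute)
    ultimately show ?thesis by (simp add: sum.distrib sum_distrib_left[symmetric])
  qed
  also have "\<dots> \<le> (real t * S + 4 * L * S * (real t)\<^sup>2 / (real (card E0) * real \<beta>))
     + 2 * (2 * L * S * real t / (real (card E0) * real \<beta>)) + S"
    using H u(2) x[OF e(1,3)] unfolding cov_def by (intro add_mono mult_left_mono) auto
  also have "\<dots> \<le> real (Suc t) * S + 4 * L * S * (real (Suc t))\<^sup>2 / (real (card E0) * real \<beta>)"
  proof -
    have "4 * L * S * (real t)\<^sup>2 + 4 * L * S * real t \<le> 4 * L * S * (real (Suc t))\<^sup>2"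
      using S0 assms(10) by (simp add: power2_eq_square algebra_simps)
    then have "(4 * L * S * (real t)\<^sup>2 + 4 * L * S * real t) / (real (card E0) * real \<beta>)
      \<le> 4 * L * S * (real (Suc t))\<^sup>2 / (real (card E0) * real \<beta>)"
      by (intro divide_right_mono) auto
    then show ?thesis by (simp add: add_divide_distrib algebra_simps)
  qed
  finally have "(\<Sum>w\<in>Z. (real (card {e' \<in> insert e E. w \<in> x (z' e')}))\<^sup>2)
      \<le> real (Suc t) * S + 4 * L * S * (real (Suc t))\<^sup>2 / (real (card E0) * real \<beta>)" .
  moreover have "card (insert e E) = Suc t" "insert e E \<subseteq> E0" "\<forall>e'\<in>insert e E. z' e' \<in> Q e'"
    using E e fE by (auto simp: z'_def)
  ultimately show ?case by blast
qed

section \<open>Separated clusters\<close>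

lemma exists_power_bracket:
  fixes a K :: nat
  assumes "1 \<le> a" "a < K ^ I"
  shows "\<exists>j<I. K ^ j \<le> a \<and> a < K ^ Suc j"
  using assms(2)
proof (induction I)
  case (Suc I)
  show ?case
  proof (cases "a < K ^ I")
    case True
    with Suc.IH show ?thesis using less_Suc_eq by blast
  qed (use Suc.prems in \<open>auto simp: not_less\<close>)
qed (use assms(1) in auto)

definition cross_pairs :: "'e set \<Rightarrow> ('e \<Rightarrow> 'a set) \<Rightarrow> ('a \<times> 'a) set" where
  "cross_pairs E U = {(u, v). \<exists>e\<in>E. \<exists>e'\<in>E. e \<noteq> e' \<and> u \<in> U e \<and> v \<in> U e'}"

locale small_homogeneous_sets =
  fixes V :: "'a set" and N :: "'a \<Rightarrow> 'a set" and k :: real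
  assumes finite_V: "finite V"
    and adj_sym: "u \<in> N v \<longleftrightarrow> v \<in> N u"
    and homogeneous_card: "Z \<subseteq> V \<Longrightarrow>
      (\<forall>u\<in>Z. \<forall>v\<in>Z. u \<noteq> v \<longrightarrow> v \<in> N u) \<or> (\<forall>u\<in>Z. \<forall>v\<in>Z. u \<noteq> v \<longrightarrow> v \<notin> N u) \<Longrightarrow> real (card Z) < k"
begin

definition nd :: "'a set \<Rightarrow> 'a \<Rightarrow> 'a \<Rightarrow> nat" where
  "nd X u v = card (sym_diff (N u) (N v) \<inter> X)"

section \<open>The neighbourhood pseudometric and the size of balls\<close>

lemma nd_commute: "nd X u v = nd X v u"
  by (simp add: nd_def Un_commute)

lemma nd_self [simp]: "nd X u u = 0"
  by (simp add: nd_def)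

lemma nd_mono: "finite Y \<Longrightarrow> X \<subseteq> Y \<Longrightarrow> nd X u v \<le> nd Y u v"
  unfolding nd_def by (intro card_mono) auto

lemma nd_triangle: "finite X \<Longrightarrow> nd X u w \<le> nd X u v + nd X v w"
  unfolding nd_def by (rule order_trans[OF card_mono card_Un_le]) auto

lemma k_pos: "k > 0"
  using homogeneous_card[of "{}"] by simp

text \<open>Among the non-neighbours of \<open>c\<close>, every edge at \<open>u\<close> ends in the
  symmetric difference of \<open>N u\<close> and \<open>N c\<close>, so degrees are at most
  \<open>S\<close> and a greedy independent set is large. Among the neighbours of \<open>c\<close>
  the same holds in the complement and yields a clique. Both greedy sets have fewer than
  \<open>k\<close> vertices.\<close>

lemma ball_card_less:
  assumes "B \<subseteq> V" "\<And>u. u \<in> B \<Longrightarrow> nd B u c \<le> S" "S \<ge> 1"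
  shows "real (card B) < 4 * k * real S"
proof -
  have fB: "finite B" using assms(1) finite_V finite_subset by blast
  have part: "real (card Z) < k * real (Suc S)"
    if Z: "Z \<subseteq> B" and R: "\<And>u v. v \<in> R u \<longleftrightarrow> u \<in> R v" "\<And>u. u \<in> Z \<Longrightarrow> R u \<inter> Z \<subseteq> sym_diff (N u) (N c) \<inter> B"
      and hom: "\<And>I. I \<subseteq> V \<Longrightarrow> \<forall>u\<in>I. \<forall>v\<in>I. u \<noteq> v \<longrightarrow> v \<notin> R u \<Longrightarrow> real (card I) < k" for Z R
  proof -
    have fZ: "finite Z" using Z fB finite_subset by blast
    have "card (insert u (R u) \<inter> Z) \<le> Suc S" if "u \<in> Z" for u
    proof -
      have "insert u (R u) \<inter> Z = insert u (R u \<inter> Z)" using that by auto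
      then have "card (insert u (R u) \<inter> Z) \<le> Suc (card (R u \<inter> Z))" using card_insert_le_m1 by (simp add: card_insert_if fZ)
      also have "card (R u \<inter> Z) \<le> nd B u c"
        unfolding nd_def using R(2)[OF that] fB by (intro card_mono) auto
      also have "nd B u c \<le> S" using that Z assms(2) by auto
      finally show ?thesis by simp
    qed
    from greedy_independent_set[of Z R, OF fZ R(1) this] obtain I where
      I: "I \<subseteq> Z" "\<forall>u\<in>I. \<forall>v\<in>I. u \<noteq> v \<longrightarrow> v \<notin> R u" "card Z \<le> card I * Suc S" by blast
    have "real (card Z) \<le> real (card I) * real (Suc S)" using I(3) by (simp only: of_nat_mult[symmetric] of_nat_le_iff)
    also have "\<dots> < k * real (Suc S)"
      using hom[of I] I Z assms(1) by (intro mult_strict_right_mono) auto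
    finally show ?thesis .
  qed
  have 1: "real (card (B - N c)) < k * real (Suc S)"
  proof (rule part[of _ N])
    show "v \<in> N u \<longleftrightarrow> u \<in> N v" for u v by (rule adj_sym)
  qed (use homogeneous_card in auto)
  have 2: "real (card (B \<inter> N c)) < k * real (Suc S)"
  proof (rule part[of _ "\<lambda>u. - N u"])
    show "v \<in> - N u \<longleftrightarrow> u \<in> - N v" for u v using adj_sym by auto
  qed (use homogeneous_card in auto)
  have "card B = card (B - N c) + card (B \<inter> N c)"
    using fB by (subst card_Un_disjoint[symmetric]) (auto intro!: arg_cong[where f = card])
  then have "real (card B) < k * (2 * real (Suc S))" using 1 2 by (simp add: algebra_simps)
  also have "\<dots> \<le> k * (4 * real S)" using k_pos assms(3) by (intro mult_left_mono) auto
  finally show ?thesis by simp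
qed

text \<open>Clusters are taken in \<open>X\<close> and distances are measured in a disjoint
  \<open>Z\<close>, so that \<open>Z\<close> can later supply the random set. In the last bound 6
  pays for passing from \<open>B\<close> to \<open>X\<close>, \<open>I ^ 2\<close> for fixing a
  common scale and size, and \<open>K ^ 2\<close> for the separation.\<close>

lemma exists_separated_clusters:
  fixes K I S \<rho> :: nat
  assumes "B \<subseteq> V" "\<And>u. u \<in> B \<Longrightarrow> nd B u c \<le> S" "S \<ge> 1" "card V < K ^ I" "K \<ge> 2"
    and "8 * K \<le> card B" "K \<le> \<rho>"
    and "2 * (real (card V ^ 2) + 1) * (88/100) ^ (4 * K) < 1"
  obtains X Z E0 Q j i where
    "X \<inter> Z = {}" "X \<subseteq> B" "Z \<subseteq> B"
    "\<And>w. w \<in> Z \<Longrightarrow> card {u \<in> B. w \<in> sym_diff (N u) (N c)} \<le> 4 * S"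
    "i < I" "E0 \<subseteq> X" "disjoint_family_on Q E0"
    "\<And>e. e \<in> E0 \<Longrightarrow> Q e \<subseteq> X" "\<And>e. e \<in> E0 \<Longrightarrow> card (Q e) = K ^ j"
    "\<And>e u. e \<in> E0 \<Longrightarrow> u \<in> Q e \<Longrightarrow> nd Z u e \<le> \<rho> * 16 ^ i"
    "\<And>e u. e \<in> E0 \<Longrightarrow> u \<in> Q e \<Longrightarrow> nd (Q e) u e \<le> 4 * (\<rho> * 16 ^ i)"
    "\<And>e e' u v. e \<in> E0 \<Longrightarrow> e' \<in> E0 \<Longrightarrow> e \<noteq> e' \<Longrightarrow> u \<in> Q e \<Longrightarrow> v \<in> Q e' \<Longrightarrow> 14 * (\<rho> * 16 ^ i) \<le> nd Z u v"
    "card B \<le> 6 * I ^ 2 * (K ^ 2 * K ^ j * card E0)"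
proof -
  have fB: "finite B" using assms(1) finite_V finite_subset by blast
  have cBV: "card B \<le> card V" using assms(1) finite_V by (rule card_mono[rotated])
  let ?cov = "\<lambda>w. card {u \<in> B. w \<in> sym_diff (N u) (N c)}"
  \<comment> \<open>Points lying in too many of the differences are dropped; double counting shows
    that they form at most a quarter of \<open>B\<close>.\<close>
  define Y where "Y = {w \<in> B. ?cov w \<le> 4 * S}"
  have fY: "finite Y" "Y \<subseteq> B" using fB by (auto simp: Y_def)
  have "4 * S * card (B - Y) = (\<Sum>w\<in>B-Y. 4 * S)" by simp
  also have "\<dots> \<le> (\<Sum>w\<in>B-Y. ?cov w)" by (intro sum_mono) (auto simp: Y_def)
  also have "\<dots> \<le> (\<Sum>w\<in>B. ?cov w)" using fB by (intro sum_mono2) auto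
  also have "\<dots> = (\<Sum>w\<in>B. \<Sum>u\<in>B. of_bool (w \<in> sym_diff (N u) (N c)))"
    using fB by (intro sum.cong) (auto simp: of_bool_def sum.If_cases Int_def)
  also have "\<dots> = (\<Sum>u\<in>B. \<Sum>w\<in>B. of_bool (w \<in> sym_diff (N u) (N c)))" by (rule sum.swap)
  also have "\<dots> = (\<Sum>u\<in>B. nd B u c)"
    unfolding nd_def using fB
    by (intro sum.cong) (auto simp: of_bool_def sum.If_cases intro!: arg_cong[where f = card])
  also have "\<dots> \<le> (\<Sum>u\<in>B. S)" using assms(2) by (intro sum_mono)
  finally have "S * (4 * card (B - Y)) \<le> S * card B" by (simp add: algebra_simps)
  then have "4 * card (B - Y) \<le> card B" using assms(3) by simp
  then have Yb: "3 * card B \<le> 4 * card Y" using fY fB by (simp add: card_Diff_subset)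

  \<comment> \<open>The split has to be balanced on \<open>Y\<close>, to keep \<open>X\<close>
    large, and on every difference that is large enough for the union bound.\<close>
  define \<F> where "\<F> = insert Y {F \<in> (\<lambda>(u, v). sym_diff (N u) (N v) \<inter> Y) ` (B \<times> B). 4 * K \<le> card F}"
  have f\<F>: "finite \<F>" using fB by (simp add: \<F>_def)
  have "card \<F> \<le> Suc (card {F \<in> (\<lambda>(u, v). sym_diff (N u) (N v) \<inter> Y) ` (B \<times> B). 4 * K \<le> card F})"
    unfolding \<F>_def using fB by (subst card_insert_if) auto
  also have "card {F \<in> (\<lambda>(u, v). sym_diff (N u) (N v) \<inter> Y) ` (B \<times> B). 4 * K \<le> card F}
      \<le> card ((\<lambda>(u, v). sym_diff (N u) (N v) \<inter> Y) ` (B \<times> B))"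
    using fB by (intro card_mono) auto
  also have "\<dots> \<le> card (B \<times> B)" using fB by (intro card_image_le) auto
  also have "\<dots> \<le> card V ^ 2"
    unfolding card_cartesian_product power2_eq_square using cBV by (intro mult_le_mono)
  finally have c\<F>: "real (card \<F>) \<le> real (card V ^ 2) + 1" by (simp del: of_nat_power)
  have "\<exists>Z\<subseteq>Y. \<forall>F\<in>\<F>. card F \<le> 4 * card (F \<inter> Z) \<and> card F \<le> 4 * card (F - Z)"
  proof (rule balanced_split[OF fY(1) f\<F>])
    show "F \<subseteq> Y" "4 * K \<le> card F" if "F \<in> \<F>" for F
      using that Yb assms(6) by (auto simp: \<F>_def)
    have "2 * real (card \<F>) * (88/100) ^ (4 * K) \<le> 2 * (real (card V ^ 2) + 1) * (88/100) ^ (4 * K)"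
      using c\<F> by (intro mult_right_mono) auto
    then show "2 * real (card \<F>) * (88/100) ^ (4 * K) < 1" using assms(8) by (rule le_less_trans)
  qed
  then obtain Z where Z: "Z \<subseteq> Y" "\<And>F. F \<in> \<F> \<Longrightarrow> card F \<le> 4 * card (F \<inter> Z)"
    "\<And>F. F \<in> \<F> \<Longrightarrow> card F \<le> 4 * card (F - Z)" by blast
  have fZ: "finite Z" using Z(1) fY finite_subset by blast
  define X where "X = Y - Z"
  have fX: "finite X" "X \<subseteq> Y" "X \<inter> Z = {}" using fY by (auto simp: X_def)
  have Xb: "card B \<le> 6 * card X" using Z(3)[of Y] Yb by (simp add: \<F>_def X_def)
  \<comment> \<open>Balance costs a factor 4. Differences too small to be in the family have fewer
    than \<open>4 * K\<close> points, which \<open>K \<le> r\<close> covers.\<close>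
  have dYZ: "nd Y u v \<le> 4 * r" if "u \<in> B" "v \<in> B" "nd Z u v \<le> r" "K \<le> r" for u v r
  proof (cases "4 * K \<le> nd Y u v")
    case True
    then have "sym_diff (N u) (N v) \<inter> Y \<in> \<F>" using that by (auto simp: \<F>_def nd_def)
    from Z(2)[OF this] have "nd Y u v \<le> 4 * nd Z u v"
      using Z(1) by (simp add: nd_def Int_assoc Int_absorb1)
    then show ?thesis using that by linarith
  qed (use that in auto)

  \<comment> \<open>The points are in \<open>X\<close> but the radius is measured in
    \<open>Z\<close>. The factor 16 between scales leaves room to separate balls of the smaller
    scale.\<close>
  define ball where "ball i u = {v \<in> X. nd Z u v \<le> \<rho> * 16 ^ i}" for i :: nat and u
  have fball: "finite (ball i u)" for i u using fX by (simp add: ball_def)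
  have ball1: "card (ball i u) \<ge> 1" if "u \<in> X" for i u
  proof -
    have "u \<in> ball i u" using that by (simp add: ball_def)
    then show ?thesis using fball by (metis One_nat_def Suc_leI card_gt_0_iff empty_iff)
  qed
  have balln: "card (ball i u) < K ^ I" for i u
  proof -
    have "card (ball i u) \<le> card V"
      using assms(1) fX fY finite_V by (intro card_mono) (auto simp: ball_def)
    then show ?thesis using assms(4) by simp
  qed
  \<comment> \<open>Growth by more than \<open>K\<close> at each of \<open>I\<close> scales would
    contradict \<open>card V < K ^ I\<close>.\<close>
  have "\<exists>i<I. card (ball (Suc i) u) \<le> K * card (ball i u)" if u: "u \<in> X" for u
  proof (rule ccontr)
    assume neg: "\<not> ?thesis"
    have "i \<le> I \<Longrightarrow> K ^ i \<le> card (ball i u)" for i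
    proof (induction i)
      case (Suc i)
      then have "K ^ Suc i \<le> K * card (ball i u)" by simp
      also have "\<dots> \<le> card (ball (Suc i) u)" using neg Suc.prems by (auto simp: not_le less_imp_le)
      finally show ?case .
    qed (use ball1[OF u] in simp)
    from this[of I] balln[of I u] show False by simp
  qed
  then obtain i where i: "\<And>u. u \<in> X \<Longrightarrow> i u < I \<and> card (ball (Suc (i u)) u) \<le> K * card (ball (i u) u)"
    by metis
  have "\<exists>j<I. K ^ j \<le> card (ball (i u) u) \<and> card (ball (i u) u) < K ^ Suc j" if "u \<in> X" for u
    using ball1[OF that] balln by (intro exists_power_bracket) auto
  then obtain j where j: "\<And>u. u \<in> X \<Longrightarrow> j u < I \<and> K ^ j u \<le> card (ball (i u) u) \<and> card (ball (i u) u) < K ^ Suc (j u)"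
    by metis
  have I0: "I > 0" using assms(4-6) cBV by (cases I) auto
  \<comment> \<open>Pigeonhole for the most frequent pair of scale and size class.\<close>
  have "\<exists>y\<in>{..<I} \<times> {..<I}. card X \<le> card ((\<lambda>u. (i u, j u)) -` {y} \<inter> X) * card ({..<I} \<times> {..<I})"
    by (rule pigeonhole_card) (use i j fX I0 in auto)
  then obtain i0 j0 where ij: "i0 < I" "j0 < I"
    "card X \<le> card ((\<lambda>u. (i u, j u)) -` {(i0, j0)} \<inter> X) * card ({..<I} \<times> {..<I})" by auto
  define X' where "X' = {u \<in> X. i u = i0 \<and> j u = j0}"
  have X': "finite X'" "X' \<subseteq> X" "card X \<le> card X' * I ^ 2"
  proof -
    have "(\<lambda>u. (i u, j u)) -` {(i0, j0)} \<inter> X = X'" by (auto simp: X'_def)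
    then show "card X \<le> card X' * I ^ 2" using ij(3) by (simp add: power2_eq_square)
  qed (use fX in \<open>auto simp: X'_def\<close>)
  let ?r = "\<rho> * 16 ^ i0"
  have "K \<le> ?r"
  proof -
    have "\<rho> * 1 \<le> ?r" by (intro mult_le_mono2) simp
    then show ?thesis using assms(7) by linarith
  qed
  \<comment> \<open>Centres closer than 16 times the cluster radius conflict. By the slow growth at
    scale \<open>i0\<close>, a centre conflicts with at most \<open>K * K ^ Suc j0\<close> points of
    \<open>X'\<close>.\<close>
  define R where "R u = {v. nd Z u v \<le> \<rho> * 16 ^ Suc i0}" for u
  have "card (insert u (R u) \<inter> X') \<le> K ^ 2 * K ^ j0" if u: "u \<in> X'" for u
  proof -
    have uX: "u \<in> X" "i u = i0" "j u = j0" using u by (auto simp: X'_def)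
    have "card (insert u (R u) \<inter> X') \<le> card (ball (Suc i0) u)"
      using u X'(2) by (intro card_mono fball) (auto simp: R_def ball_def)
    also have "\<dots> \<le> K * card (ball i0 u)" using i[OF uX(1)] uX by simp
    also have "\<dots> \<le> K * K ^ Suc j0" using j[OF uX(1)] uX by (intro mult_le_mono2) auto
    finally show ?thesis by (simp add: power2_eq_square)
  qed
  from greedy_independent_set[OF X'(1) _ this] obtain E0 where
    E0: "E0 \<subseteq> X'" "\<And>u v. u \<in> E0 \<Longrightarrow> v \<in> E0 \<Longrightarrow> u \<noteq> v \<Longrightarrow> v \<notin> R u" "card X' \<le> card E0 * (K ^ 2 * K ^ j0)"
    using nd_commute by (auto simp: R_def)
  have "\<exists>Q. Q \<subseteq> ball i0 e \<and> card Q = K ^ j0" if "e \<in> E0" for e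
  proof -
    have "e \<in> X" "i e = i0" "j e = j0" using that E0(1) by (auto simp: X'_def)
    then have "K ^ j0 \<le> card (ball i0 e)" using j by auto
    then show ?thesis by (metis obtain_subset_with_card_n)
  qed
  then obtain Q where Q: "\<And>e. e \<in> E0 \<Longrightarrow> Q e \<subseteq> ball i0 e" "\<And>e. e \<in> E0 \<Longrightarrow> card (Q e) = K ^ j0"
    by metis
  have near: "nd Z e u \<le> ?r" if "e \<in> E0" "u \<in> Q e" for e u
    using Q(1)[OF that(1)] that(2) by (auto simp: ball_def)
  \<comment> \<open>The triangle inequality gives 16 - 1 - 1 = 14.\<close>
  have far: "14 * ?r \<le> nd Z u v" if "e \<in> E0" "e' \<in> E0" "e \<noteq> e'" "u \<in> Q e" "v \<in> Q e'" for e e' u v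
  proof -
    have "nd Z e e' > 16 * ?r" using E0(2)[of e e'] that by (auto simp: R_def not_le)
    moreover have "nd Z e e' \<le> nd Z e u + nd Z u v + nd Z e' v"
      using nd_triangle[OF fZ, of e e' u] nd_triangle[OF fZ, of u e' v] nd_commute[of Z v e'] by linarith
    ultimately show ?thesis using near[OF that(1,4)] near[OF that(2,5)] by linarith
  qed
  have QX: "Q e \<subseteq> X" if "e \<in> E0" for e using Q(1)[OF that] by (auto simp: ball_def)
  have XB: "X \<subseteq> B" using fX fY by auto
  show thesis
  proof (rule that[of X Z i0 E0 Q j0])
    show "Z \<subseteq> B" using Z fY by auto
    show "card {u \<in> B. w \<in> sym_diff (N u) (N c)} \<le> 4 * S" if "w \<in> Z" for w
      using that Z(1) by (auto simp: Y_def)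
    show "E0 \<subseteq> X" using E0(1) X'(2) by auto
    show "disjoint_family_on Q E0"
      unfolding disjoint_family_on_def
    proof (intro ballI impI)
      fix e e' assume e: "e \<in> E0" "e' \<in> E0" "e \<noteq> e'"
      have "?r > 0" using \<open>K \<le> ?r\<close> assms(5) by linarith
      then show "Q e \<inter> Q e' = {}" using far[OF e] by fastforce
    qed
    show "nd Z u e \<le> ?r" if "e \<in> E0" "u \<in> Q e" for e u
      using near[OF that] by (simp add: nd_commute)
    show "nd (Q e) u e \<le> 4 * ?r" if "e \<in> E0" "u \<in> Q e" for e u
    proof -
      have "e \<in> B" "u \<in> B" using that QX XB E0(1) X'(2) by auto
      then have "nd Y u e \<le> 4 * ?r"
        using near[OF that] \<open>K \<le> ?r\<close> by (intro dYZ) (auto simp: nd_commute)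
      moreover have "nd (Q e) u e \<le> nd Y u e" using QX[OF that(1)] fX fY by (intro nd_mono) auto
      ultimately show ?thesis by linarith
    qed
    show "card B \<le> 6 * I ^ 2 * (K ^ 2 * K ^ j0 * card E0)"
    proof -
      have "card B \<le> 6 * (card X' * I ^ 2)" using Xb X'(3) by linarith
      also have "\<dots> \<le> 6 * (card E0 * (K ^ 2 * K ^ j0) * I ^ 2)"
        using E0(3) by (intro mult_le_mono2 mult_le_mono1)
      finally show ?thesis by (simp add: algebra_simps)
    qed
  qed (use fX XB ij QX Q(2) far in auto)
qed

text \<open>For \<open>u\<close> and \<open>v\<close> in different clusters, the difference of their
  neighbourhoods correlates with that of the two representatives, hence with the difference between
  one representative and \<open>c\<close>. \<open>disjoint_selection\<close> transfers this
  correlation to disjoint shares, each of which is then sampled with its own random density.\<close>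

lemma exists_cross_spread:
  fixes S r M \<beta> :: nat and Q U :: "'a \<Rightarrow> 'a set"
  assumes B: "B \<subseteq> V" "\<And>u. u \<in> B \<Longrightarrow> nd B u c \<le> S" "Z \<subseteq> B"
    and cover: "\<And>w. w \<in> Z \<Longrightarrow> card {u \<in> B. w \<in> sym_diff (N u) (N c)} \<le> 4 * S"
    and Q: "finite E0" "disjoint_family_on Q E0" "\<And>e. e \<in> E0 \<Longrightarrow> Q e \<subseteq> B"
      "\<And>e. e \<in> E0 \<Longrightarrow> card (Q e) = \<beta>"
    and near: "\<And>e u. e \<in> E0 \<Longrightarrow> u \<in> Q e \<Longrightarrow> nd Z u e \<le> r"
    and far: "\<And>e e' u v. e \<in> E0 \<Longrightarrow> e' \<in> E0 \<Longrightarrow> e \<noteq> e' \<Longrightarrow> u \<in> Q e \<Longrightarrow> v \<in> Q e' \<Longrightarrow> 14 * r \<le> nd Z u v"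
    and pos: "0 < r" "r \<le> S" "0 < M" "2 * M \<le> card E0" "0 < \<beta>"
    and U: "\<And>e. e \<in> E0 \<Longrightarrow> U e \<subseteq> Q e"
  shows "\<exists>E\<subseteq>E0. card E \<le> M \<and> M \<le> 2 * card E \<and> (\<exists>\<mu> q. set_pmf \<mu> \<subseteq> Pow Z \<and>
     (\<forall>e\<in>E. \<forall>e'\<in>E. e \<noteq> e' \<longrightarrow> (\<forall>u\<in>U e. \<forall>v\<in>U e'. conc \<mu> (N u) (N v) (q u v))) \<and>
     (\<Sum>(u, v)\<in>cross_pairs E U. q u v) \<le> real (card (cross_pairs E U)) *
       (8 * (real S / real r) ^ 3 * (1 / real S + 16 * real M / (real (card E0) * real \<beta>))))"
proof -
  have fin: "finite B" "finite Z"
    using finite_subset[OF B(1) finite_V] finite_subset[OF B(3)] by auto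
  have fQ: "finite (Q e)" if "e \<in> E0" for e by (rule finite_subset[OF Q(3)[OF that] fin(1)])
  define x where "x u = sym_diff (N u) (N c)" for u
  define m where "m = card E0"
  have m0: "m > 0" using pos(3,4) unfolding m_def by linarith
  have xZ: "real (card (x u \<inter> Z)) \<le> real S" if "u \<in> B" for u
  proof -
    have "card (x u \<inter> Z) \<le> nd B u c"
      unfolding nd_def x_def using fin B(3) by (intro card_mono) auto
    then show ?thesis using B(2)[OF that] by linarith
  qed
  have QB: "(\<Union>e\<in>E0. Q e) \<subseteq> B" using Q(3) by auto
  have "\<exists>E\<subseteq>E0. card E = M \<and> (\<exists>z. (\<forall>e\<in>E. z e \<in> Q e) \<and>
     (\<Sum>w\<in>Z. (real (card {e \<in> E. w \<in> x (z e)}))\<^sup>2) \<le>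
       real M * real S + 4 * (4 * real S) * real S * (real M)\<^sup>2 / (real (card E0) * real \<beta>))"
  proof (rule greedy_representatives[OF fin(2) Q(1) fQ Q(2) Q(4) pos(5)])
    show "E0 \<noteq> {}" using m0 by (auto simp: m_def)
    show "real (card (x u \<inter> Z)) \<le> real S" if "e \<in> E0" "u \<in> Q e" for e u
      using xZ Q(3) that by auto
    show "real (card {u \<in> \<Union> (Q ` E0). w \<in> x u}) \<le> 4 * real S" if "w \<in> Z" for w
    proof -
      have "card {u \<in> \<Union> (Q ` E0). w \<in> x u} \<le> card {u \<in> B. w \<in> x u}"
        using QB fin(1) by (intro card_mono) auto
      then show ?thesis using cover[OF that] unfolding x_def by linarith
    qed
  qed (use pos in auto)
  then obtain E1 z where E1: "E1 \<subseteq> E0" "card E1 = M" and z: "\<And>e. e \<in> E1 \<Longrightarrow> z e \<in> Q e"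
    and H: "(\<Sum>w\<in>Z. (real (card {e \<in> E1. w \<in> x (z e)}))\<^sup>2) \<le>
       real M * real S + 4 * (4 * real S) * real S * (real M)\<^sup>2 / (real (card E0) * real \<beta>)"
    by blast
  have fE1: "finite E1" by (rule finite_subset[OF E1(1) Q(1)])
  define H0 where "H0 = real M * real S + 16 * (real S)\<^sup>2 * (real M)\<^sup>2 / (real m * real \<beta>)"
  \<comment> \<open>This threshold makes Markov's inequality for the squared coverage work: at most
    half of the \<open>M\<close> clusters have more than \<open>r\<close> points of their difference
    covered over \<open>C\<close> times.\<close>
  define h where "h = 2 * H0 / (real r * real M)"
  define C where "C = nat \<lceil>h\<rceil>"
  define cov where "cov w = card {e \<in> E1. w \<in> x (z e)}" for w
  define over where "over = {w \<in> Z. C < cov w}"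
  have H0: "(\<Sum>w\<in>Z. (real (cov w))\<^sup>2) \<le> H0"
    using H unfolding H0_def cov_def m_def by (simp add: power2_eq_square algebra_simps)
  have H0_pos: "H0 > 0" using pos by (auto simp: H0_def intro!: add_pos_nonneg)
  have h_eq: "h = 2 * (real S / real r) * (1 + 16 * real S * real M / (real m * real \<beta>))"
    unfolding h_def H0_def using pos m0 by (simp add: field_simps power2_eq_square)
  have "1 * 1 \<le> (real S / real r) * (1 + 16 * real S * real M / (real m * real \<beta>))"
    using pos by (intro mult_mono) auto
  then have h1: "h \<ge> 1" unfolding h_eq by linarith
  have C: "real C \<ge> h" "real C \<le> 2 * h" "C \<ge> 1" using h1 unfolding C_def by linarith+
  define bad where "bad = {e \<in> E1. r < card (x (z e) \<inter> over)}"
  have fin_over: "finite over" using fin by (simp add: over_def)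
  have "real C * (real r * real (card bad)) = real C * (\<Sum>e\<in>bad. real r)" by simp
  also have "\<dots> \<le> real C * (\<Sum>e\<in>bad. real (card (x (z e) \<inter> over)))"
    by (intro mult_left_mono sum_mono) (auto simp: bad_def)
  also have "\<dots> \<le> real C * (\<Sum>e\<in>E1. real (card (x (z e) \<inter> over)))"
    using fE1 by (intro mult_left_mono sum_mono2) (auto simp: bad_def)
  also have "(\<Sum>e\<in>E1. real (card (x (z e) \<inter> over))) = (\<Sum>e\<in>E1. \<Sum>w\<in>over. of_bool (w \<in> x (z e)))"
    using fin_over by (intro sum.cong) (auto simp: of_bool_def sum.If_cases Int_def conj_commute)
  also have "\<dots> = (\<Sum>w\<in>over. \<Sum>e\<in>E1. of_bool (w \<in> x (z e)))" by (rule sum.swap)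
  also have "\<dots> = (\<Sum>w\<in>over. real (cov w))"
    unfolding cov_def using fE1 by (intro sum.cong) (auto simp: of_bool_def sum.If_cases Int_def)
  also have "real C * \<dots> = (\<Sum>w\<in>over. real C * real (cov w))" by (rule sum_distrib_left)
  also have "\<dots> \<le> (\<Sum>w\<in>over. (real (cov w))\<^sup>2)"
    unfolding power2_eq_square by (intro sum_mono mult_right_mono) (auto simp: over_def)
  also have "\<dots> \<le> (\<Sum>w\<in>Z. (real (cov w))\<^sup>2)"
    using fin by (intro sum_mono2) (auto simp: over_def)
  also note H0
  finally have "real C * (real r * real (card bad)) \<le> H0" .
  moreover have "h * (real r * real (card bad)) \<le> real C * (real r * real (card bad))"
    using C(1) by (intro mult_right_mono) auto
  ultimately have "h * (real r * real (card bad)) \<le> H0" by linarith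
  then have "2 * real (card bad) \<le> real M"
    unfolding h_def using H0_pos pos by (simp add: field_simps)
  then have bad: "2 * card bad \<le> M" by linarith
  define E where "E = E1 - bad"
  have E: "E \<subseteq> E1" "E \<subseteq> E0" "finite E" "card E \<le> M" "M \<le> 2 * card E"
  proof -
    show "card E \<le> M" unfolding E_def E1(2)[symmetric] using fE1 by (intro card_mono) auto
    have "card E = card E1 - card bad"
      unfolding E_def using fE1 by (intro card_Diff_subset) (auto simp: bad_def)
    then show "M \<le> 2 * card E" using bad E1 by linarith
  qed (use E1 fE1 in \<open>auto simp: E_def\<close>)
  have good: "card (x (z e) \<inter> over) \<le> r" if "e \<in> E" for e
    using that by (auto simp: E_def bad_def)
  define Z' where "Z' = Z - over"
  have fZ': "finite Z'" using fin by (simp add: Z'_def)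
  \<comment> \<open>The boolean fixes a sign. On each half the indicator of the representative's
    neighbourhood minus that of \<open>c\<close> is constant, so correlation becomes a plain
    difference of degrees.\<close>
  define P :: "'a \<times> bool \<Rightarrow> 'a set"
    where "P \<tau> = (if snd \<tau> then N (z (fst \<tau>)) - N c else N c - N (z (fst \<tau>))) \<inter> Z'" for \<tau>
  let ?T = "E \<times> (UNIV :: bool set)"
  define J where "J = cross_pairs E U"
  define g :: "'a \<times> 'a \<Rightarrow> 'a \<Rightarrow> real"
    where "g p w = of_bool (w \<in> N (fst p)) - of_bool (w \<in> N (snd p))" for p w
  have fJ: "finite J"
  proof (rule finite_subset)
    have "U e \<subseteq> B" if "e \<in> E" for e using U[of e] Q(3)[of e] E(2) that by auto
    then show "J \<subseteq> B \<times> B" unfolding J_def cross_pairs_def by auto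
  qed (use fin in auto)
  have key: "\<exists>\<tau>\<in>?T. 2 * real r \<le> \<bar>\<Sum>w\<in>P \<tau>. g p w\<bar>" if p: "p \<in> J" for p
  proof -
    obtain u v e e' where uv: "p = (u, v)" "e \<in> E" "e' \<in> E" "e \<noteq> e'" "u \<in> U e" "v \<in> U e'"
      using p unfolding J_def cross_pairs_def by auto
    then have uv': "u \<in> Q e" "v \<in> Q e'" using U E(2) by auto
    \<comment> \<open>The inner product of the difference between \<open>z e\<close> and
      \<open>c\<close> with the difference between \<open>u\<close> and \<open>v\<close>; the centre
      \<open>c\<close> cancels in \<open>G e - G e'\<close>.\<close>
    define G where "G e = (\<Sum>w\<in>Z. (of_bool (w \<in> N (z e)) - of_bool (w \<in> N c)) * g p w)" for e
    define G' where "G' e = (\<Sum>w\<in>Z'. (of_bool (w \<in> N (z e)) - of_bool (w \<in> N c)) * g p w)" for e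
    have nd_sum: "real (nd Z a b) = (\<Sum>w\<in>Z. \<bar>of_bool (w \<in> N a) - of_bool (w \<in> N b)\<bar>)" for a b
    proof -
      have "(\<Sum>w\<in>Z. \<bar>of_bool (w \<in> N a) - of_bool (w \<in> N b)\<bar>) = (\<Sum>w\<in>Z. of_bool (w \<in> sym_diff (N a) (N b)) :: real)"
        by (intro sum.cong) auto
      also have "\<dots> = real (nd Z a b)"
        unfolding nd_def using fin by (auto simp: of_bool_def sum.If_cases Int_def conj_commute intro!: arg_cong[where f = card])
      finally show ?thesis by simp
    qed
    have zd: "nd Z (z e) u \<le> 2 * r" if "e \<in> E" "u \<in> Q e" for e u
    proof -
      have "e \<in> E0" "z e \<in> Q e" using that E(1,2) z by auto
      then have "nd Z (z e) e \<le> r" "nd Z u e \<le> r" using near that by auto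
      then show ?thesis using nd_triangle[OF fin(2), of "z e" u e] nd_commute[of Z u e] by linarith
    qed
    \<comment> \<open>Replacing \<open>z e\<close> by \<open>u\<close> and \<open>z e'\<close> by
      \<open>v\<close> turns the product into the square of a vector with entries in -1, 0, 1, which
      sums to \<open>nd Z u v\<close>. The two replacements cost at most \<open>2 * r\<close> each,
      leaving 14 - 4 = 10.\<close>
    have "real (nd Z u v) - real (nd Z (z e) u) - real (nd Z (z e') v) \<le> G e - G e'"
      unfolding nd_sum G_def sum_subtractf[symmetric]
      by (intro sum_mono) (auto simp: g_def uv(1))
    moreover have "14 * r \<le> nd Z u v" by (rule far[OF _ _ uv(4) uv']) (use uv E(2) in auto)
    moreover note zd[OF uv(2) uv'(1)] zd[OF uv(3) uv'(2)]
    ultimately have "10 * real r \<le> G e - G e'" by linarith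
    \<comment> \<open>One of the two clusters keeps half of the correlation. Removing
      \<open>over\<close> costs \<open>r\<close>, and choosing a sign halves the remaining
      \<open>4 * r\<close>.\<close>
    then have "5 * real r \<le> \<bar>G e\<bar> \<or> 5 * real r \<le> \<bar>G e'\<bar>" by linarith
    then obtain d where d: "d \<in> E" "5 * real r \<le> \<bar>G d\<bar>" using uv by blast
    have "G d = G' d + (\<Sum>w\<in>over. (of_bool (w \<in> N (z d)) - of_bool (w \<in> N c)) * g p w)"
      unfolding G_def G'_def Z'_def using fin
      by (subst sum.subset_diff[of over Z]) (auto simp: over_def)
    moreover have "\<bar>\<Sum>w\<in>over. (of_bool (w \<in> N (z d)) - of_bool (w \<in> N c)) * g p w\<bar> \<le> real r"
    proof -
      have "\<bar>\<Sum>w\<in>over. (of_bool (w \<in> N (z d)) - of_bool (w \<in> N c)) * g p w\<bar>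
          \<le> (\<Sum>w\<in>over. of_bool (w \<in> x (z d)))"
        by (rule order_trans[OF sum_abs], intro sum_mono) (auto simp: g_def x_def)
      also have "\<dots> = real (card (x (z d) \<inter> over))"
        using fin_over by (auto simp: of_bool_def sum.If_cases Int_def conj_commute)
      also have "\<dots> \<le> real r" using good[OF d(1)] by simp
      finally show ?thesis .
    qed
    ultimately have G': "4 * real r \<le> \<bar>G' d\<bar>" using d(2) by linarith
    have "G' d = (\<Sum>w\<in>Z'. of_bool (w \<in> P (d, True)) * g p w) - (\<Sum>w\<in>Z'. of_bool (w \<in> P (d, False)) * g p w)"
      unfolding G'_def sum_subtractf[symmetric] by (intro sum.cong) (auto simp: P_def)
    also have "\<dots> = (\<Sum>w\<in>P (d, True). g p w) - (\<Sum>w\<in>P (d, False). g p w)"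
    proof -
      have "(\<Sum>w\<in>Z'. of_bool (w \<in> P (d, b)) * g p w) = (\<Sum>w\<in>P (d, b). g p w)" for b
        using fZ' by (intro sum.mono_neutral_cong_right) (auto simp: P_def)
      then show ?thesis by simp
    qed
    finally have "2 * real r \<le> \<bar>\<Sum>w\<in>P (d, True). g p w\<bar> \<or> 2 * real r \<le> \<bar>\<Sum>w\<in>P (d, False). g p w\<bar>"
      using G' by linarith
    then show ?thesis using d(1) by blast
  qed
  then have "\<forall>p\<in>J. \<exists>\<tau>. \<tau> \<in> ?T \<and> 2 * real r \<le> \<bar>\<Sum>w\<in>P \<tau>. g p w\<bar>" by blast
  from bchoice[OF this] obtain \<tau> where
    \<tau>: "\<And>p. p \<in> J \<Longrightarrow> \<tau> p \<in> ?T" "\<And>p. p \<in> J \<Longrightarrow> 2 * real r \<le> \<bar>\<Sum>w\<in>P (\<tau> p). g p w\<bar>"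
    by blast
  have cP: "real (card (P t)) \<le> real S" if "t \<in> ?T" for t
  proof -
    have t: "fst t \<in> E" using that by (simp add: mem_Times_iff)
    have "z (fst t) \<in> Q (fst t)" by (rule z[OF subsetD[OF E(1) t]])
    then have "z (fst t) \<in> B" using Q(3)[OF subsetD[OF E(2) t]] by (rule rev_subsetD)
    moreover have "card (P t) \<le> card (x (z (fst t)) \<inter> Z)"
      using fin by (intro card_mono) (auto simp: P_def x_def Z'_def)
    ultimately show ?thesis using xZ[of "z (fst t)"] by linarith
  qed
  have covP: "card {t \<in> ?T. w \<in> P t} \<le> C" if w: "w \<in> Z'" for w
  proof -
    have "card {t \<in> ?T. w \<in> P t} \<le> card {e \<in> E1. w \<in> x (z e)}"
    proof (rule card_inj_on_le)
      show "inj_on fst {t \<in> ?T. w \<in> P t}" by (auto simp: inj_on_def P_def split: if_splits)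
      show "fst ` {t \<in> ?T. w \<in> P t} \<subseteq> {e \<in> E1. w \<in> x (z e)}"
        using E(1) by (auto simp: P_def x_def split: if_splits)
    qed (use fE1 in auto)
    also have "\<dots> \<le> C" using w by (auto simp: Z'_def over_def cov_def)
    finally show ?thesis .
  qed
  have "\<exists>T. (\<forall>t\<in>?T. T t \<subseteq> P t) \<and> disjoint_family_on T ?T \<and>
     (\<Sum>p\<in>J. 1 / (1 + \<bar>\<Sum>w\<in>T (\<tau> p). g p w\<bar>)) \<le> real (card J) * (real C / real r + real C * real S / (real r)\<^sup>2)"
  proof (rule disjoint_selection[OF fZ' _ fJ C(3) _ _ cP covP _ \<tau>])
    show "\<bar>g p w\<bar> \<le> 1" for p w by (simp add: g_def)
    show "finite ?T" using E(3) by simp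
    show "0 < real r" using pos(1) by simp
    show "P t \<subseteq> Z'" for t by (simp add: P_def)
  qed
  then obtain T where T: "\<And>t. t \<in> ?T \<Longrightarrow> T t \<subseteq> P t" "disjoint_family_on T ?T"
    "(\<Sum>p\<in>J. 1 / (1 + \<bar>\<Sum>w\<in>T (\<tau> p). g p w\<bar>)) \<le> real (card J) * (real C / real r + real C * real S / (real r)\<^sup>2)"
    by blast
  have TZ: "T t \<subseteq> Z" if "t \<in> ?T" for t using T(1)[OF that] by (auto simp: P_def Z'_def)
  have fT: "finite (T t)" if "t \<in> ?T" for t by (rule finite_subset[OF TZ[OF that] fin(2)])
  have "\<forall>t\<in>?T. \<exists>\<mu>. set_pmf \<mu> \<subseteq> Pow (T t) \<and>
    (\<forall>A B. conc \<mu> A B (1 / (1 + \<bar>real (card (A \<inter> T t)) - real (card (B \<inter> T t))\<bar>)))"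
  proof
    fix t assume "t \<in> ?T"
    from uniform_density_block[OF fT[OF this]]
    show "\<exists>\<mu>. set_pmf \<mu> \<subseteq> Pow (T t) \<and>
      (\<forall>A B. conc \<mu> A B (1 / (1 + \<bar>real (card (A \<inter> T t)) - real (card (B \<inter> T t))\<bar>)))" .
  qed
  from bchoice[OF this] obtain \<mu> where \<mu>': "\<forall>t\<in>?T. set_pmf (\<mu> t) \<subseteq> Pow (T t) \<and>
    (\<forall>A B. conc (\<mu> t) A B (1 / (1 + \<bar>real (card (A \<inter> T t)) - real (card (B \<inter> T t))\<bar>)))"
    by (rule exE)
  have \<mu>: "set_pmf (\<mu> t) \<subseteq> Pow (T t)"
    "conc (\<mu> t) A B (1 / (1 + \<bar>real (card (A \<inter> T t)) - real (card (B \<inter> T t))\<bar>))"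
    if "t \<in> ?T" for t A B
    using conjunct1[OF bspec[OF \<mu>' that]] conjunct2[OF bspec[OF \<mu>' that], rule_format] .
  have "\<exists>\<nu>. set_pmf \<nu> \<subseteq> Pow (\<Union>t\<in>?T. T t) \<and> (\<forall>t\<in>?T. \<forall>A B q. conc (\<mu> t) A B q \<longrightarrow> conc \<nu> A B q)"
    by (rule conc_independent_union[OF _ fT T(2) \<mu>(1)]) (use E(3) in simp_all)
  then obtain \<nu> where \<nu>': "set_pmf \<nu> \<subseteq> Pow (\<Union>t\<in>?T. T t) \<and>
     (\<forall>t\<in>?T. \<forall>A B q. conc (\<mu> t) A B q \<longrightarrow> conc \<nu> A B q)"
    by (rule exE)
  note \<nu> = conjunct1[OF \<nu>'] conjunct2[OF \<nu>', rule_format]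
  define q where "q u v = 1 / (1 + \<bar>\<Sum>w\<in>T (\<tau> (u, v)). g (u, v) w\<bar>)" for u v
  have q: "conc \<nu> (N u) (N v) (q u v)" if "(u, v) \<in> J" for u v
  proof -
    let ?t = "\<tau> (u, v)"
    have t: "?t \<in> ?T" by (rule \<tau>(1)[OF that])
    have "(\<Sum>w\<in>T ?t. g (u, v) w) = real (card (N u \<inter> T ?t)) - real (card (N v \<inter> T ?t))"
      unfolding g_def sum_subtractf using fT[OF t] by (simp add: of_bool_def sum.If_cases Int_def conj_commute)
    then show ?thesis using \<nu>(2)[OF t \<mu>(2)[OF t]] by (simp add: q_def)
  qed
  \<comment> \<open>Uses \<open>r \<le> S\<close> and \<open>C \<le> 2 * h\<close>; the rest is the
    closed form of \<open>h\<close>.\<close>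
  have "real C / real r + real C * real S / (real r)\<^sup>2 \<le> 2 * real C * real S / (real r)\<^sup>2"
    using pos by (simp add: field_simps power2_eq_square mult_left_mono)
  also have "\<dots> \<le> 2 * (2 * h) * real S / (real r)\<^sup>2"
    using C(2) by (intro divide_right_mono mult_right_mono mult_left_mono) auto
  also have "\<dots> = 8 * (real S / real r) ^ 3 * (1 / real S + 16 * real M / (real m * real \<beta>))"
    unfolding h_eq using pos m0 by (simp add: field_simps power2_eq_square power3_eq_cube)
  finally have C': "real C / real r + real C * real S / (real r)\<^sup>2
    \<le> 8 * (real S / real r) ^ 3 * (1 / real S + 16 * real M / (real m * real \<beta>))" .
  have "(\<Sum>(u, v)\<in>J. q u v) = (\<Sum>p\<in>J. 1 / (1 + \<bar>\<Sum>w\<in>T (\<tau> p). g p w\<bar>))"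
    unfolding q_def by (intro sum.cong) auto
  also note T(3)
  also have "real (card J) * (real C / real r + real C * real S / (real r)\<^sup>2)
     \<le> real (card J) * (8 * (real S / real r) ^ 3 * (1 / real S + 16 * real M / (real m * real \<beta>)))"
    by (intro mult_left_mono C') simp
  finally have qsum: "(\<Sum>(u, v)\<in>J. q u v) \<le> real (card J) * (8 * (real S / real r) ^ 3 * (1 / real S + 16 * real M / (real m * real \<beta>)))" .
  have "(\<Union>t\<in>?T. T t) \<subseteq> Z" by (rule UN_least) (rule TZ)
  then have \<nu>Z: "set_pmf \<nu> \<subseteq> Pow Z" using \<nu>(1) by (meson Pow_mono order_trans)
  have qJ: "\<forall>e\<in>E. \<forall>e'\<in>E. e \<noteq> e' \<longrightarrow> (\<forall>u\<in>U e. \<forall>v\<in>U e'. conc \<nu> (N u) (N v) (q u v))"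
  proof (intro ballI impI)
    fix e e' u v assume "e \<in> E" "e' \<in> E" "e \<noteq> e'" "u \<in> U e" "v \<in> U e'"
    then have "(u, v) \<in> J" unfolding J_def cross_pairs_def by blast
    then show "conc \<nu> (N u) (N v) (q u v)" by (rule q)
  qed
  show ?thesis
    by (rule exI[of _ E], intro conjI E(2,4,5), rule exI[of _ \<nu>], rule exI[of _ q], intro conjI \<nu>Z qJ)
      (rule qsum[unfolded J_def m_def])
qed

section \<open>Spread sets\<close>

text \<open>On average a vertex of \<open>U\<close> collides with at most \<open>L\<close> others.
  The random set avoids \<open>U\<close>, so it can be joined to \<open>U\<close>: degrees inside
  \<open>U\<close> then only shift the target value, to which \<open>conc\<close> is
  insensitive.\<close>

definition spread_set :: "'a set \<Rightarrow> 'a set \<Rightarrow> real \<Rightarrow> bool" where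
  "spread_set B U L \<longleftrightarrow> U \<subseteq> B \<and> (\<exists>\<mu> q. set_pmf \<mu> \<subseteq> Pow (B - U) \<and>
     (\<forall>u\<in>U. \<forall>v\<in>U. u \<noteq> v \<longrightarrow> conc \<mu> (N u) (N v) (q u v)) \<and>
     (\<Sum>(u, v)\<in>U \<times> U - Id. q u v) \<le> L * real (card U))"

lemma spread_set_mono:
  assumes "spread_set B U L" "B \<subseteq> B'" "L \<le> L'"
  shows "spread_set B' U L'"
proof -
  obtain \<mu> q where *: "U \<subseteq> B" "set_pmf \<mu> \<subseteq> Pow (B - U)"
    "\<forall>u\<in>U. \<forall>v\<in>U. u \<noteq> v \<longrightarrow> conc \<mu> (N u) (N v) (q u v)"
    "(\<Sum>(u, v)\<in>U \<times> U - Id. q u v) \<le> L * real (card U)"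
    using assms(1) unfolding spread_set_def by blast
  have "L * real (card U) \<le> L' * real (card U)" using assms(3) by (intro mult_right_mono) auto
  then have "(\<Sum>(u, v)\<in>U \<times> U - Id. q u v) \<le> L' * real (card U)" using *(4) by linarith
  moreover have "set_pmf \<mu> \<subseteq> Pow (B' - U)" using *(2) assms(2) by blast
  ultimately show ?thesis
    using *(1,3) assms(2) unfolding spread_set_def by (intro conjI exI[of _ \<mu>] exI[of _ q]) auto
qed

lemma spread_set_singleton: "u \<in> B \<Longrightarrow> 0 \<le> L \<Longrightarrow> spread_set B {u} L"
  unfolding spread_set_def by (intro conjI exI[of _ "return_pmf {}"] exI[of _ "\<lambda>_ _. 0"]) auto

text \<open>The random sets of the clusters and the one inside \<open>Z\<close> have disjoint
  supports and are united independently. Pairs within a cluster keep their old bounds and cross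
  pairs use those of \<open>\<mu>0\<close>, so the losses add.\<close>

lemma spread_set_UN:
  assumes "finite B" "Z \<subseteq> B" "finite E" "disjoint_family_on Q E"
    and Q: "\<And>e. e \<in> E \<Longrightarrow> Q e \<subseteq> B" "\<And>e. e \<in> E \<Longrightarrow> Q e \<inter> Z = {}"
    and U: "\<And>e. e \<in> E \<Longrightarrow> spread_set (Q e) (U e) L"
    and \<mu>0: "set_pmf \<mu>0 \<subseteq> Pow Z"
      "\<forall>e\<in>E. \<forall>e'\<in>E. e \<noteq> e' \<longrightarrow> (\<forall>u\<in>U e. \<forall>v\<in>U e'. conc \<mu>0 (N u) (N v) (q0 u v))"
      "(\<Sum>(u, v)\<in>cross_pairs E U. q0 u v) \<le> real (card (cross_pairs E U)) * R"
    and R: "0 \<le> R" "R * real (card (\<Union>e\<in>E. U e)) \<le> L'"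
  shows "spread_set B (\<Union>e\<in>E. U e) (L + L')"
proof -
  let ?W = "\<Union>e\<in>E. U e"
  have "\<forall>e\<in>E. \<exists>\<mu>q. U e \<subseteq> Q e \<and> set_pmf (fst \<mu>q) \<subseteq> Pow (Q e - U e) \<and>
     (\<forall>u\<in>U e. \<forall>v\<in>U e. u \<noteq> v \<longrightarrow> conc (fst \<mu>q) (N u) (N v) (snd \<mu>q u v)) \<and>
     (\<Sum>(u, v)\<in>U e \<times> U e - Id. snd \<mu>q u v) \<le> L * real (card (U e))"
  proof
    fix e assume "e \<in> E"
    from U[OF this] obtain \<mu> q where "U e \<subseteq> Q e" "set_pmf \<mu> \<subseteq> Pow (Q e - U e)"
      "\<forall>u\<in>U e. \<forall>v\<in>U e. u \<noteq> v \<longrightarrow> conc \<mu> (N u) (N v) (q u v)"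
      "(\<Sum>(u, v)\<in>U e \<times> U e - Id. q u v) \<le> L * real (card (U e))"
      unfolding spread_set_def by (elim conjE exE)
    then show "\<exists>\<mu>q. U e \<subseteq> Q e \<and> set_pmf (fst \<mu>q) \<subseteq> Pow (Q e - U e) \<and>
     (\<forall>u\<in>U e. \<forall>v\<in>U e. u \<noteq> v \<longrightarrow> conc (fst \<mu>q) (N u) (N v) (snd \<mu>q u v)) \<and>
     (\<Sum>(u, v)\<in>U e \<times> U e - Id. snd \<mu>q u v) \<le> L * real (card (U e))"
      by (intro exI[of _ "(\<mu>, q)"]) simp
  qed
  from bchoice[OF this] obtain \<mu>q where \<mu>q: "\<forall>e\<in>E. U e \<subseteq> Q e \<and> set_pmf (fst (\<mu>q e)) \<subseteq> Pow (Q e - U e) \<and>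
     (\<forall>u\<in>U e. \<forall>v\<in>U e. u \<noteq> v \<longrightarrow> conc (fst (\<mu>q e)) (N u) (N v) (snd (\<mu>q e) u v)) \<and>
     (\<Sum>(u, v)\<in>U e \<times> U e - Id. snd (\<mu>q e) u v) \<le> L * real (card (U e))"
    by (rule exE)
  define \<mu> where "\<mu> e = fst (\<mu>q e)" for e
  define q1 where "q1 e = snd (\<mu>q e)" for e
  have UQ: "U e \<subseteq> Q e" and \<mu>: "set_pmf (\<mu> e) \<subseteq> Pow (Q e - U e)"
    and q1: "\<And>u v. u \<in> U e \<Longrightarrow> v \<in> U e \<Longrightarrow> u \<noteq> v \<Longrightarrow> conc (\<mu> e) (N u) (N v) (q1 e u v)"
    and q1sum: "(\<Sum>(u, v)\<in>U e \<times> U e - Id. q1 e u v) \<le> L * real (card (U e))" if "e \<in> E" for e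
    using bspec[OF \<mu>q that] unfolding \<mu>_def q1_def by simp_all
  have disjU: "e = e'" if "e \<in> E" "e' \<in> E" "u \<in> U e" "u \<in> U e'" for e e' u
    using disjoint_family_onD[OF assms(4) that(1,2)] UQ[OF that(1)] UQ[OF that(2)] that(3,4) by auto
  have WB: "?W \<subseteq> B" using UQ Q(1) by auto
  have fW: "finite ?W" by (rule finite_subset[OF WB assms(1)])
  have fU: "finite (U e)" if "e \<in> E" for e by (rule finite_subset[OF _ fW]) (use that in auto)

  \<comment> \<open>The index \<open>None\<close> stands for the part in \<open>Z\<close>, and
    \<open>Some e\<close> for the part inside the cluster \<open>e\<close>.\<close>
  define A where "A i = (case i of None \<Rightarrow> Z | Some e \<Rightarrow> Q e - U e)" for i
  define \<mu>' where "\<mu>' i = (case i of None \<Rightarrow> \<mu>0 | Some e \<Rightarrow> \<mu> e)" for i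
  let ?I = "insert None (Some ` E)"
  have "\<exists>\<nu>. set_pmf \<nu> \<subseteq> Pow (\<Union>i\<in>?I. A i) \<and> (\<forall>i\<in>?I. \<forall>A B q. conc (\<mu>' i) A B q \<longrightarrow> conc \<nu> A B q)"
  proof (rule conc_independent_union)
    show "finite (A i)" if "i \<in> ?I" for i
      using that finite_subset[OF assms(2,1)] finite_subset[OF Q(1) assms(1)] by (auto simp: A_def)
    show "disjoint_family_on A ?I"
      unfolding disjoint_family_on_def
    proof (intro ballI impI)
      fix i j assume ij: "i \<in> ?I" "j \<in> ?I" "i \<noteq> j"
      show "A i \<inter> A j = {}"
      proof (cases "i = None \<or> j = None")
        case True
        moreover have "x \<notin> Z" if "e \<in> E" "x \<in> Q e" for e x using Q(2)[OF that(1)] that(2) by auto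
        ultimately show ?thesis using ij by (auto simp: A_def)
      next
        case False
        then obtain e e' where e: "i = Some e" "j = Some e'" "e \<in> E" "e' \<in> E" "e \<noteq> e'" using ij by auto
        show ?thesis using disjoint_family_onD[OF assms(4) e(3-5)] e by (auto simp: A_def)
      qed
    qed
    show "set_pmf (\<mu>' i) \<subseteq> Pow (A i)" if "i \<in> ?I" for i
    proof (cases i)
      case (Some e)
      then have "e \<in> E" using that by auto
      then show ?thesis using \<mu>[of e] Some by (simp add: A_def \<mu>'_def)
    qed (use \<mu>0(1) in \<open>simp add: A_def \<mu>'_def\<close>)
  qed (use assms(3) in simp)
  then obtain \<nu> where \<nu>': "set_pmf \<nu> \<subseteq> Pow (\<Union>i\<in>?I. A i) \<and> (\<forall>i\<in>?I. \<forall>A B q. conc (\<mu>' i) A B q \<longrightarrow> conc \<nu> A B q)"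
    by (rule exE)
  note \<nu> = conjunct1[OF \<nu>'] conjunct2[OF \<nu>', rule_format]
  have \<nu>0: "conc \<nu> A B q" if "conc \<mu>0 A B q" for A B q
    using \<nu>(2)[of None A B q] that by (simp add: \<mu>'_def)
  have \<nu>1: "conc \<nu> A B q" if "e \<in> E" "conc (\<mu> e) A B q" for e A B q
    using \<nu>(2)[of "Some e" A B q] that by (simp add: \<mu>'_def)
  have A_sub: "A i \<subseteq> B - ?W" if "i \<in> ?I" for i
  proof (cases i)
    case None
    have "Z \<inter> U e = {}" if "e \<in> E" for e using Q(2)[OF that] UQ[OF that] by auto
    then show ?thesis using None assms(2) by (auto simp: A_def)
  next
    case (Some e)
    then have e: "e \<in> E" using that by auto
    have "x \<notin> U e'" if "x \<in> Q e - U e" "e' \<in> E" for x e'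
      using disjoint_family_onD[OF assms(4) e that(2)] UQ[OF that(2)] that(1) by auto
    then show ?thesis using Q(1)[OF e] Some by (auto simp: A_def)
  qed
  then have "(\<Union>i\<in>?I. A i) \<subseteq> B - ?W" by (rule UN_least)
  then have \<nu>W: "set_pmf \<nu> \<subseteq> Pow (B - ?W)" using \<nu>(1) by (meson Pow_mono order_trans)

  have "\<forall>u\<in>?W. \<exists>e. e \<in> E \<and> u \<in> U e" by auto
  from bchoice[OF this] obtain cl where cl: "\<forall>u\<in>?W. cl u \<in> E \<and> u \<in> U (cl u)" by (rule exE)
  have cl_eq: "cl u = e" if "e \<in> E" "u \<in> U e" for u e
  proof -
    have "u \<in> ?W" using that by auto
    then show ?thesis using cl disjU[OF _ that(1) _ that(2)] by auto
  qed
  \<comment> \<open>The clusters of the two vertices decide which random set separates them.\<close>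
  define q where "q u v = (if cl u = cl v then q1 (cl u) u v else q0 u v)" for u v
  have qconc: "conc \<nu> (N u) (N v) (q u v)" if "u \<in> ?W" "v \<in> ?W" "u \<noteq> v" for u v
  proof -
    have c: "cl u \<in> E" "u \<in> U (cl u)" "cl v \<in> E" "v \<in> U (cl v)"
      using bspec[OF cl that(1)] bspec[OF cl that(2)] by simp_all
    show ?thesis
    proof (cases "cl u = cl v")
      case True
      then have "conc (\<mu> (cl u)) (N u) (N v) (q1 (cl u) u v)"
        using c that(3) by (intro q1) simp_all
      then show ?thesis using True \<nu>1[OF c(1)] by (simp add: q_def)
    next
      case False
      have "conc \<mu>0 (N u) (N v) (q0 u v)"
        using \<mu>0(2)[rule_format, OF c(1,3) False c(2,4)] .
      then show ?thesis using False \<nu>0 by (simp add: q_def)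
    qed
  qed
  have cross: "cross_pairs E U \<subseteq> ?W \<times> ?W" by (auto simp: cross_pairs_def)
  have fcross: "finite (cross_pairs E U)" by (rule finite_subset[OF cross]) (use fW in simp)
  have split: "?W \<times> ?W - Id = (\<Union>e\<in>E. U e \<times> U e - Id) \<union> cross_pairs E U"
  proof (rule set_eqI)
    fix p :: "'a \<times> 'a"
    obtain u v where p: "p = (u, v)" by (cases p)
    have "(u, v) \<in> cross_pairs E U \<longleftrightarrow> u \<in> ?W \<and> v \<in> ?W \<and> cl u \<noteq> cl v"
    proof
      assume "(u, v) \<in> cross_pairs E U"
      then obtain e e' where "e \<in> E" "e' \<in> E" "e \<noteq> e'" "u \<in> U e" "v \<in> U e'"
        unfolding cross_pairs_def by auto
      then show "u \<in> ?W \<and> v \<in> ?W \<and> cl u \<noteq> cl v" using cl_eq[of e u] cl_eq[of e' v] by auto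
    next
      assume *: "u \<in> ?W \<and> v \<in> ?W \<and> cl u \<noteq> cl v"
      then have "cl u \<in> E" "u \<in> U (cl u)" "cl v \<in> E" "v \<in> U (cl v)" using cl by auto
      then show "(u, v) \<in> cross_pairs E U" using * unfolding cross_pairs_def by auto
    qed
    moreover have "(u, v) \<in> (\<Union>e\<in>E. U e \<times> U e - Id) \<longleftrightarrow> u \<in> ?W \<and> v \<in> ?W \<and> cl u = cl v \<and> u \<noteq> v"
    proof
      assume "(u, v) \<in> (\<Union>e\<in>E. U e \<times> U e - Id)"
      then obtain e where "e \<in> E" "u \<in> U e" "v \<in> U e" "u \<noteq> v" by auto
      then show "u \<in> ?W \<and> v \<in> ?W \<and> cl u = cl v \<and> u \<noteq> v" using cl_eq[of e u] cl_eq[of e v] by auto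
    next
      assume *: "u \<in> ?W \<and> v \<in> ?W \<and> cl u = cl v \<and> u \<noteq> v"
      then have "cl u \<in> E" "u \<in> U (cl u)" "v \<in> U (cl v)"
        using bspec[OF cl, of u] bspec[OF cl, of v] by simp_all
      then show "(u, v) \<in> (\<Union>e\<in>E. U e \<times> U e - Id)" using * by auto
    qed
    ultimately show "p \<in> ?W \<times> ?W - Id \<longleftrightarrow> p \<in> (\<Union>e\<in>E. U e \<times> U e - Id) \<union> cross_pairs E U"
      unfolding p by auto
  qed
  have "(\<Sum>(u, v)\<in>?W \<times> ?W - Id. q u v) = (\<Sum>(u, v)\<in>(\<Union>e\<in>E. U e \<times> U e - Id). q u v) + (\<Sum>(u, v)\<in>cross_pairs E U. q u v)"
    unfolding split
  proof (rule sum.union_disjoint)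
    show "(\<Union>e\<in>E. U e \<times> U e - Id) \<inter> cross_pairs E U = {}"
    proof (rule equals0I)
      fix p assume p: "p \<in> (\<Union>e\<in>E. U e \<times> U e - Id) \<inter> cross_pairs E U"
      obtain u v where uv: "p = (u, v)" by (cases p)
      obtain e where "e \<in> E" "u \<in> U e" "v \<in> U e" using p uv by auto
      moreover obtain d d' where "d \<in> E" "d' \<in> E" "d \<noteq> d'" "u \<in> U d" "v \<in> U d'"
        using p uv unfolding cross_pairs_def by auto
      ultimately show False using disjU[of e d u] disjU[of e d' v] by simp
    qed
  qed (use fcross fU assms(3) in auto)
  also have "(\<Sum>(u, v)\<in>(\<Union>e\<in>E. U e \<times> U e - Id). q u v) = (\<Sum>e\<in>E. \<Sum>(u, v)\<in>U e \<times> U e - Id. q u v)"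
  proof (rule sum.UNION_disjoint)
    show "\<forall>e\<in>E. \<forall>e'\<in>E. e \<noteq> e' \<longrightarrow> (U e \<times> U e - Id) \<inter> (U e' \<times> U e' - Id) = {}"
    proof (intro ballI impI)
      fix e e' assume "e \<in> E" "e' \<in> E" "e \<noteq> e'"
      then show "(U e \<times> U e - Id) \<inter> (U e' \<times> U e' - Id) = {}" using disjU[of e e'] by auto
    qed
  qed (use fU assms(3) in auto)
  also have "\<dots> = (\<Sum>e\<in>E. \<Sum>(u, v)\<in>U e \<times> U e - Id. q1 e u v)"
  proof (intro sum.cong refl)
    fix e p assume "e \<in> E" "p \<in> U e \<times> U e - Id"
    then show "(case p of (u, v) \<Rightarrow> q u v) = (case p of (u, v) \<Rightarrow> q1 e u v)"
      using cl_eq[of e "fst p"] cl_eq[of e "snd p"] by (cases p) (simp add: q_def)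
  qed
  also have "\<dots> \<le> (\<Sum>e\<in>E. L * real (card (U e)))" by (rule sum_mono) (rule q1sum)
  also have "\<dots> = L * real (card ?W)"
  proof -
    have "card ?W = (\<Sum>e\<in>E. card (U e))"
    proof (rule card_UN_disjoint)
      show "\<forall>e\<in>E. \<forall>e'\<in>E. e \<noteq> e' \<longrightarrow> U e \<inter> U e' = {}"
      proof (intro ballI impI)
        fix e e' assume "e \<in> E" "e' \<in> E" "e \<noteq> e'"
        then show "U e \<inter> U e' = {}" using disjU[of e e'] by auto
      qed
    qed (use fU assms(3) in auto)
    then show ?thesis by (simp add: sum_distrib_left)
  qed
  also have "(\<Sum>(u, v)\<in>cross_pairs E U. q u v) = (\<Sum>(u, v)\<in>cross_pairs E U. q0 u v)"
  proof (intro sum.cong refl)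
    fix p assume "p \<in> cross_pairs E U"
    then obtain u v e e' where "p = (u, v)" "e \<in> E" "e' \<in> E" "e \<noteq> e'" "u \<in> U e" "v \<in> U e'"
      unfolding cross_pairs_def by auto
    then show "(case p of (u, v) \<Rightarrow> q u v) = (case p of (u, v) \<Rightarrow> q0 u v)"
      using cl_eq[of e u] cl_eq[of e' v] by (simp add: q_def)
  qed
  also have "\<dots> \<le> real (card (cross_pairs E U)) * R" by (rule \<mu>0(3))
  \<comment> \<open>The cross pairs are bounded by all pairs; one factor \<open>card ?W\<close> is
    absorbed by \<open>R\<close> through the last assumption.\<close>
  also have "\<dots> \<le> real (card ?W * card ?W) * R"
    using cross fW R(1) card_mono[OF _ cross] by (intro mult_right_mono) (auto simp: card_cartesian_product simp del: of_nat_mult)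
  also have "\<dots> = real (card ?W) * (R * real (card ?W))" by simp
  also have "\<dots> \<le> real (card ?W) * L'" by (intro mult_left_mono R(2)) simp
  finally have "(\<Sum>(u, v)\<in>?W \<times> ?W - Id. q u v) \<le> (L + L') * real (card ?W)" by (simp add: algebra_simps)
  then show ?thesis
    unfolding spread_set_def using qconc
    by (intro conjI WB exI[of _ \<nu>] exI[of _ q] \<nu>W ballI impI)
qed

text \<open>By Cauchy--Schwarz, few coinciding pairs of degrees force many distinct degrees.\<close>

lemma spread_set_imp_distinct_degrees:
  assumes "spread_set V U L" "U \<noteq> {}"
  shows "\<exists>S\<subseteq>V. real (card U) \<le> (1 + L) * real (card ((\<lambda>v. card (N v \<inter> S)) ` S))"
proof -
  obtain \<mu> q where U: "U \<subseteq> V" and \<mu>: "set_pmf \<mu> \<subseteq> Pow (V - U)"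
    and q: "\<forall>u\<in>U. \<forall>v\<in>U. u \<noteq> v \<longrightarrow> conc \<mu> (N u) (N v) (q u v)"
    and qsum: "(\<Sum>(u, v)\<in>U \<times> U - Id. q u v) \<le> L * real (card U)"
    using assms(1) unfolding spread_set_def by (elim conjE exE)
  have fU: "finite U" by (rule finite_subset[OF U finite_V])
  define \<W> where "\<W> = set_pmf \<mu>"
  have f\<W>: "finite \<W>" unfolding \<W>_def by (rule finite_subset[OF \<mu>]) (use finite_V in simp)
  have fW: "finite W" "U \<inter> W = {}" if "W \<in> \<W>" for W
  proof -
    have "W \<subseteq> V - U" using that \<mu> by (auto simp: \<W>_def)
    then show "finite W" "U \<inter> W = {}" using finite_subset[OF _ finite_V, of W] by auto
  qed
  define d where "d W u = card (N u \<inter> (U \<union> W))" for W u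
  define coll where "coll W = (\<Sum>(u, v)\<in>U \<times> U - Id. of_bool (d W u = d W v) :: real)" for W
  have "(\<Sum>W\<in>\<W>. pmf \<mu> W * coll W) = (\<Sum>(u, v)\<in>U \<times> U - Id. \<Sum>W\<in>\<W>. pmf \<mu> W * of_bool (d W u = d W v))"
    unfolding coll_def sum_distrib_left
    by (subst sum.swap) (intro sum.cong refl, auto)
  also have "\<dots> \<le> (\<Sum>(u, v)\<in>U \<times> U - Id. q u v)"
  proof (rule sum_mono)
    fix p assume p: "p \<in> U \<times> U - Id"
    obtain u v where uv: "p = (u, v)" by (cases p)
    then have uv': "u \<in> U" "v \<in> U" "u \<noteq> v" using p by auto
    \<comment> \<open>Degrees into \<open>U\<close> are fixed, so equal total degrees mean one
      specific difference of the degrees into \<open>W\<close>.\<close>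
    define c where "c = int (card (N v \<inter> U)) - int (card (N u \<inter> U))"
    let ?A = "{W. int (card (N u \<inter> W)) - int (card (N v \<inter> W)) = c}"
    have eq: "d W u = d W v \<longleftrightarrow> W \<in> ?A" if "W \<in> \<W>" for W
    proof -
      have "d W x = card (N x \<inter> U) + card (N x \<inter> W)" for x
        unfolding d_def Int_Un_distrib using fU fW[OF that] by (intro card_Un_disjoint) auto
      then show ?thesis unfolding c_def by auto
    qed
    have "(\<Sum>W\<in>\<W>. pmf \<mu> W * of_bool (d W u = d W v)) = (\<Sum>W\<in>\<W> \<inter> ?A. pmf \<mu> W)"
      using f\<W> eq by (intro sum.mono_neutral_cong_right) auto
    also have "\<dots> = measure_pmf.prob \<mu> (\<W> \<inter> ?A)"
      using f\<W> by (intro measure_measure_pmf_finite[symmetric]) auto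
    also have "\<dots> \<le> measure_pmf.prob \<mu> ?A" by (intro measure_pmf.finite_measure_mono) auto
    also have "\<dots> \<le> q u v" using q uv' unfolding conc_def by blast
    finally show "(case p of (u, v) \<Rightarrow> \<Sum>W\<in>\<W>. pmf \<mu> W * of_bool (d W u = d W v)) \<le> (case p of (u, v) \<Rightarrow> q u v)"
      unfolding uv by simp
  qed
  also note qsum
  finally have avg: "(\<Sum>W\<in>\<W>. pmf \<mu> W * coll W) \<le> L * real (card U)" .
  have one: "(\<Sum>W\<in>\<W>. pmf \<mu> W) = 1" using f\<W> by (intro sum_pmf_eq_1) (auto simp: \<W>_def)
  have "\<exists>W\<in>\<W>. coll W \<le> L * real (card U)"
  proof (rule ccontr)
    assume "\<not> ?thesis"
    then have "(\<Sum>W\<in>\<W>. pmf \<mu> W * (L * real (card U))) < (\<Sum>W\<in>\<W>. pmf \<mu> W * coll W)"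
      using f\<W> set_pmf_not_empty[of \<mu>]
      by (intro sum_strict_mono mult_strict_left_mono) (auto simp: \<W>_def pmf_positive)
    then show False using avg one by (simp add: sum_distrib_right[symmetric])
  qed
  then obtain W where W: "W \<in> \<W>" "coll W \<le> L * real (card U)" by blast
  define S where "S = U \<union> W"
  have SV: "S \<subseteq> V" using W(1) U \<mu> by (auto simp: S_def \<W>_def)
  have fS: "finite S" by (rule finite_subset[OF SV finite_V])
  let ?D = "d W ` U"
  let ?f = "\<lambda>t. real (card {u \<in> U. d W u = t})"
  have "real (card U) = (\<Sum>t\<in>?D. ?f t)"
    using sum.image_gen[OF fU, of "\<lambda>_. 1::real" "d W"] by simp
  \<comment> \<open>Cauchy-Schwarz over the degree classes. The sum of their squared sizes counts
    ordered pairs of equal degree, namely the diagonal and \<open>coll W\<close>.\<close>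
  then have "(real (card U))\<^sup>2 \<le> real (card ?D) * (\<Sum>t\<in>?D. (?f t)\<^sup>2)"
    using sum_squared_le_sum_of_squares[of ?f ?D] fU by (simp add: mult.commute)
  also have "(\<Sum>t\<in>?D. (?f t)\<^sup>2) = real (card U) + coll W"
  proof -
    have "(\<Sum>t\<in>?D. (?f t)\<^sup>2) = (\<Sum>t\<in>?D. \<Sum>u\<in>{u \<in> U. d W u = t}. ?f (d W u))"
      by (intro sum.cong) (auto simp: power2_eq_square)
    also have "\<dots> = (\<Sum>u\<in>U. ?f (d W u))"
      by (rule sum.image_gen[OF fU, symmetric])
    also have "\<dots> = (\<Sum>u\<in>U. \<Sum>v\<in>U. of_bool (d W u = d W v))"
      using fU by (intro sum.cong) (auto simp: of_bool_def sum.If_cases Int_def eq_commute)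
    also have "\<dots> = (\<Sum>(u, v)\<in>U \<times> U. of_bool (d W u = d W v))"
      by (rule sum.cartesian_product)
    also have "U \<times> U = (U \<times> U - Id) \<union> (\<lambda>u. (u, u)) ` U" by auto
    also have "(\<Sum>(u, v)\<in>(U \<times> U - Id) \<union> (\<lambda>u. (u, u)) ` U. of_bool (d W u = d W v)) =
       coll W + (\<Sum>(u, v)\<in>(\<lambda>u. (u, u)) ` U. of_bool (d W u = d W v))"
      unfolding coll_def using fU by (intro sum.union_disjoint) auto
    also have "(\<Sum>(u, v)\<in>(\<lambda>u. (u, u)) ` U. of_bool (d W u = d W v)) = real (card U)"
      by (subst sum.reindex) (auto simp: inj_on_def)
    finally show ?thesis by simp
  qed
  also have "real (card ?D) * (real (card U) + coll W) \<le> real (card ?D) * ((1 + L) * real (card U))"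
    using W(2) by (intro mult_left_mono) (auto simp: algebra_simps)
  finally have main: "real (card U) * real (card U) \<le> ((1 + L) * real (card ?D)) * real (card U)"
    by (simp add: power2_eq_square algebra_simps)
  have coll0: "0 \<le> coll W" unfolding coll_def by (intro sum_nonneg) auto
  have "real (card U) \<le> (1 + L) * real (card ((\<lambda>v. card (N v \<inter> S)) ` S))"
  proof -
    have cU: "0 < real (card U)" using fU assms(2) by (simp add: card_gt_0_iff)
    have "0 \<le> L * real (card U)" using coll0 W(2) by linarith
    then have L0: "0 \<le> L" using cU by (simp add: zero_le_mult_iff)
    have "real (card U) \<le> (1 + L) * real (card ?D)" using main cU by (rule mult_right_le_imp_le)
    also have "?D = (\<lambda>v. card (N v \<inter> S)) ` U" by (auto simp: d_def S_def)
    also have "(1 + L) * real (card \<dots>) \<le> (1 + L) * real (card ((\<lambda>v. card (N v \<inter> S)) ` S))"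
      using L0 fS by (intro mult_left_mono of_nat_mono card_mono) (auto simp: S_def)
    finally show ?thesis .
  qed
  then show ?thesis using SV by blast
qed

end

section \<open>The recursion\<close>

text \<open>In the application \<open>K\<close> is about \<open>n\<^bsup>1/I\<^esup>\<close> for a large constant \<open>I\<close>, so that fixed powers of \<open>K\<close> are negligible.
  Clusters have radius about \<open>S / K\<^bsup>P\<^esup>\<close>, and \<open>P\<close> is so large that passing from a set to its clusters
  gains a factor \<open>K\<^sup>3\<close> in \<open>|B|\<^bsup>-\<zeta>\<^esup>\<close>, which pays for the losses of the step.\<close>

locale scaled_graph = small_homogeneous_sets V N k for V :: "'a set" and N k +
  fixes \<zeta> y :: real and K I P :: nat
  assumes \<zeta>: "0 < \<zeta>" "\<zeta> < 1" and y: "0 < y" and Py: "3 \<le> real P * y * \<zeta>"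
    and card_V_less: "card V < K ^ I" and K_ge: "4 * 16 ^ I \<le> K" "48 * I ^ 2 \<le> K"
    and card_V_le: "real (card V) \<le> k\<^sup>2"
    and k_ge: "4 * real K ^ (P + 2) \<le> k powr \<zeta>"
    and union_bound: "2 * (real (card V ^ 2) + 1) * (88/100) ^ (4 * K) < 1"
begin

text \<open>The size that the recursion guarantees for a spread set in a set of \<open>b\<close>
  vertices and radius \<open>s\<close>; up to the factor \<open>1 / k\<close> it is the quantity
  being maximized.\<close>

definition \<Psi> :: "real \<Rightarrow> real \<Rightarrow> real" where
  "\<Psi> b s = b powr (1 - \<zeta>) * s powr (- y) / k"

text \<open>Every level of the recursion adds one power of \<open>K\<close> to the collision loss,
  and sizes at least halve from level to level, so the logarithm bounds the number of
  levels.\<close>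

definition \<Lambda> :: "real \<Rightarrow> real" where
  "\<Lambda> b = real K ^ (3 * P + 8) * log 2 (2 * b)"

section \<open>Numerical estimates for one step\<close>

lemma K_ge_4: "4 \<le> K"
proof -
  have "4 * 1 \<le> 4 * (16::nat) ^ I" by (intro mult_le_mono2) simp
  then show ?thesis using K_ge by linarith
qed

lemma k_ge_1: "1 \<le> k"
proof -
  have "4 * 1 \<le> 4 * real K ^ (P + 2)" using K_ge_4 by (intro mult_left_mono one_le_power) auto
  then have 1: "1 \<le> k powr \<zeta>" using k_ge by simp
  show ?thesis
  proof (rule ccontr)
    assume "\<not> 1 \<le> k"
    then have "k powr \<zeta> < 1 powr \<zeta>" using k_pos \<zeta> by (intro powr_less_mono2) auto
    then show False using 1 by simp
  qed
qed

text \<open>As \<open>s\<close> is at least 1, the assumption forces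
  \<open>k < b powr (1 - \<zeta>)\<close>. Hence \<open>b\<close> exceeds \<open>k\<close>, so
  \<open>k_ge\<close> passes to \<open>b\<close>, and \<open>b / k\<close> exceeds
  \<open>b powr \<zeta>\<close>.\<close>

lemma \<Psi>_gt_1_bounds:
  assumes "1 < \<Psi> b s" "1 \<le> b" "1 \<le> s"
  shows "4 * real K ^ (P + 2) < b / k" "4 * real K ^ (P + 2) \<le> b powr \<zeta>"
proof -
  have "s powr (- y) \<le> s powr 0" using assms y by (intro powr_mono) auto
  then have "b powr (1 - \<zeta>) * s powr (- y) \<le> b powr (1 - \<zeta>) * 1"
    using assms by (intro mult_left_mono) auto
  moreover have "k < b powr (1 - \<zeta>) * s powr (- y)" using assms(1) k_pos by (simp add: \<Psi>_def field_simps)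
  ultimately have 1: "k < b powr (1 - \<zeta>)" by simp
  also have "\<dots> \<le> b powr 1" using assms \<zeta> by (intro powr_mono) auto
  finally have "k < b" using assms by simp
  then have "k powr \<zeta> \<le> b powr \<zeta>" using \<zeta> k_pos by (intro powr_mono2) auto
  then show 2: "4 * real K ^ (P + 2) \<le> b powr \<zeta>" using k_ge by linarith
  have "(4 * real K ^ (P + 2)) * k \<le> b powr \<zeta> * k" using 2 k_pos by (intro mult_right_mono) auto
  also have "\<dots> < b powr \<zeta> * b powr (1 - \<zeta>)" using 1 assms by (intro mult_strict_left_mono) auto
  also have "\<dots> = b" using assms by (simp add: powr_add[symmetric])
  finally show "4 * real K ^ (P + 2) < b / k" using k_pos by (simp add: field_simps)
qed

text \<open>The first assumption expresses maximality of \<open>(b, s)\<close>. A radius smaller by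
  \<open>K ^ P\<close> must be paid for by size: the ratio \<open>b / \<beta>\<close> is at least
  \<open>K powr (P * y)\<close>, and \<open>Py\<close> makes its power \<open>\<zeta>\<close> at
  least \<open>K ^ 3\<close>.\<close>

lemma cluster_small:
  assumes "\<Psi> \<beta> (4 * r) \<le> \<Psi> b s" "1 \<le> \<beta>" "\<beta> \<le> b" "1 \<le> r" "4 * r * real K ^ P \<le> s"
  shows "real K ^ 3 \<le> (b / \<beta>) powr \<zeta>" "real K ^ 3 * \<beta> \<le> b"
proof -
  have K1: "real K \<ge> 1" using K_ge_4 by simp
  have "0 < 4 * r * real K ^ P" using assms(4) K1 by (intro mult_pos_pos) auto
  then have s0: "s > 0" using assms(5) by linarith
  have bb: "b / \<beta> \<ge> 1" using assms by simp
  have "\<beta> powr (1 - \<zeta>) * (4 * r) powr (- y) \<le> b powr (1 - \<zeta>) * s powr (- y)"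
    using assms(1) k_pos by (simp add: \<Psi>_def divide_le_cancel)
  then have "s powr y * \<beta> powr (1 - \<zeta>) \<le> b powr (1 - \<zeta>) * (4 * r) powr y"
    using s0 assms(4) by (simp add: powr_minus field_simps)
  then have "(s / (4 * r)) powr y \<le> (b / \<beta>) powr (1 - \<zeta>)"
    using s0 assms by (simp add: powr_divide divide_simps)
  also have "\<dots> \<le> (b / \<beta>) powr 1" using bb \<zeta> by (intro powr_mono) auto
  finally have 1: "(s / (4 * r)) powr y \<le> b / \<beta>" using bb by simp
  have "real K powr (real P * y) = (real K ^ P) powr y"
    using K1 by (simp add: powr_realpow[symmetric] powr_powr)
  also have "\<dots> \<le> (s / (4 * r)) powr y"
    using assms(4,5) y K1 by (intro powr_mono2) (auto simp: field_simps)
  finally have 2: "real K powr (real P * y) \<le> b / \<beta>" using 1 by linarith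
  have "real K ^ 3 = real K powr 3" using K1 by simp
  also have "\<dots> \<le> real K powr (real P * y * \<zeta>)" using K1 Py by (intro powr_mono) auto
  also have "\<dots> = (real K powr (real P * y)) powr \<zeta>" by (simp add: powr_powr)
  also have "\<dots> \<le> (b / \<beta>) powr \<zeta>" using 2 \<zeta> by (intro powr_mono2) auto
  finally show 3: "real K ^ 3 \<le> (b / \<beta>) powr \<zeta>" .
  also have "\<dots> \<le> (b / \<beta>) powr 1" using bb \<zeta> by (intro powr_mono) auto
  finally show "real K ^ 3 * \<beta> \<le> b" using assms by (simp add: field_simps)
qed

text \<open>Because of the exponent \<open>1 - \<zeta>\<close>, splitting \<open>b\<close> into
  pieces of size \<open>\<beta>\<close> gains \<open>(b / \<beta>) powr \<zeta>\<close>, at least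
  \<open>K ^ 3\<close>. This pays for the part of \<open>b\<close> not covered by clusters and for
  the factor 6.\<close>

lemma many_clusters_bound:
  assumes "real K ^ 3 \<le> (b / \<beta>) powr \<zeta>" "1 \<le> \<beta>" "\<beta> \<le> b" "0 < r" "4 * r \<le> s" "0 < I"
    and "b \<le> 6 * real I ^ 2 * real K ^ 2 * \<beta> * m"
  shows "\<Psi> b s \<le> m / 6 * \<Psi> \<beta> (4 * r)"
proof -
  have K1: "real K \<ge> 4" using K_ge_4 by simp
  have m0: "m > 0"
  proof (rule ccontr)
    assume "\<not> m > 0"
    then have "6 * real I ^ 2 * real K ^ 2 * \<beta> * m \<le> 0"
      using assms(2) by (intro mult_nonneg_nonpos) auto
    then show False using assms by linarith
  qed
  have "36 * real I ^ 2 \<le> real K"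
  proof -
    have "real (48 * I ^ 2) \<le> real K" using K_ge(2) by (simp only: of_nat_le_iff)
    then show ?thesis by simp
  qed
  then have "6 * (6 * real I ^ 2 * real K ^ 2) \<le> real K * real K ^ 2"
    using K1 by (simp add: mult_right_mono)
  also have "\<dots> = real K ^ 3" by (simp add: power3_eq_cube power2_eq_square)
  finally have K3: "6 * (6 * real I ^ 2 * real K ^ 2) \<le> real K ^ 3" .
  have "6 * b \<le> 6 * (6 * real I ^ 2 * real K ^ 2) * (\<beta> * m)" using assms(7) by (simp add: algebra_simps)
  also have "\<dots> \<le> real K ^ 3 * (\<beta> * m)" using K3 assms(2) m0 by (intro mult_right_mono) auto
  also have "\<dots> \<le> (b / \<beta>) powr \<zeta> * (\<beta> * m)" using assms(1,2) m0 by (intro mult_right_mono) auto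
  finally have "1 \<le> m / 6 * (\<beta> / b * (b / \<beta>) powr \<zeta>)" using assms(2,3) by (simp add: field_simps)
  also have "\<beta> / b * (b / \<beta>) powr \<zeta> = (\<beta> / b) powr (1 - \<zeta>)"
    using assms(2,3) by (simp add: powr_diff powr_divide field_simps)
  finally have 1: "1 \<le> m / 6 * (\<beta> / b) powr (1 - \<zeta>)" .
  have \<Psi>0: "0 \<le> \<Psi> b s" using k_pos by (simp add: \<Psi>_def)
  have "\<Psi> b s = 1 * \<Psi> b s" by simp
  also have "\<dots> \<le> m / 6 * (\<beta> / b) powr (1 - \<zeta>) * \<Psi> b s"
    using 1 \<Psi>0 by (rule mult_right_mono)
  also have "\<dots> = m / 6 * \<Psi> \<beta> s"
    using assms(2,3) by (simp add: \<Psi>_def powr_divide)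
  also have "\<Psi> \<beta> s \<le> \<Psi> \<beta> (4 * r)"
    unfolding \<Psi>_def using assms(4,5) y k_pos
    by (intro divide_right_mono mult_left_mono powr_mono2') auto
  finally show ?thesis using m0 by (simp add: mult_left_mono)
qed

text \<open>The first summand is controlled by the Turan bound on \<open>b\<close>, the second by
  \<open>M \<le> b / k\<close> and \<open>b \<le> k\<^sup>2\<close>. The ratio \<open>s / r\<close>
  contributes \<open>K ^ (3 * P + 3)\<close> up to a constant, and the remaining powers absorb
  \<open>I\<close> and the constants.\<close>

lemma cross_bound:
  assumes "0 < r" "s \<le> 2 * real K ^ (P + 1) * r" "0 < s" "b < 4 * k * s" "M \<le> b / k" "0 \<le> M" "1 \<le> b" "b \<le> k\<^sup>2"
    and "b \<le> 6 * real I ^ 2 * real K ^ 2 * (m * \<beta>)" "0 < m * \<beta>" "0 < I"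
  shows "8 * (s / r) ^ 3 * (1 / s + 16 * M / (m * \<beta>)) * (b / k) \<le> real K ^ (3 * P + 8)"
proof -
  have K1: "real K \<ge> 4" using K_ge_4 by simp
  have I1: "real I ^ 2 \<ge> 1" using assms(11) by simp
  have "s / r \<le> 2 * real K ^ (P + 1)" using assms(1,2) by (simp add: field_simps)
  then have "(s / r) ^ 3 \<le> (2 * real K ^ (P + 1)) ^ 3" using assms(1,3) by (intro power_mono) auto
  also have "\<dots> = 8 * real K ^ (3 * P + 3)" by (simp add: power_mult_distrib power_mult[symmetric] power_add[symmetric] algebra_simps)
  finally have 1: "8 * (s / r) ^ 3 \<le> 64 * real K ^ (3 * P + 3)" by simp
  have mb: "0 \<le> 16 * M / (m * \<beta>)" using assms(6,10) by (intro divide_nonneg_pos) auto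
  have 2: "1 / s * (b / k) \<le> 4" using assms(3,4) k_pos by (simp add: field_simps)
  have "16 * M / (m * \<beta>) * (b / k) \<le> 16 * (b / k) / (m * \<beta>) * (b / k)"
    using assms k_pos by (intro mult_right_mono divide_right_mono) auto
  also have "\<dots> = 16 * (b / (m * \<beta>)) * (b / k\<^sup>2)" by (simp add: power2_eq_square)
  also have "\<dots> \<le> 16 * (6 * real I ^ 2 * real K ^ 2) * 1"
    using assms k_pos by (intro mult_mono) (auto simp: field_simps)
  finally have 3: "16 * M / (m * \<beta>) * (b / k) \<le> 96 * real I ^ 2 * real K ^ 2" by simp
  have 4: "4 \<le> 4 * (real I ^ 2 * real K ^ 2)"
    using I1 K1 mult_mono[of 1 "real I ^ 2" 1 "real K ^ 2"] by (simp add: one_le_power)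
  have "8 * (s / r) ^ 3 * (1 / s + 16 * M / (m * \<beta>)) * (b / k)
      = 8 * (s / r) ^ 3 * (1 / s * (b / k) + 16 * M / (m * \<beta>) * (b / k))" by (simp add: algebra_simps)
  also have "\<dots> \<le> (64 * real K ^ (3 * P + 3)) * (100 * (real I ^ 2 * real K ^ 2))"
  proof (rule mult_mono[OF 1])
    show "1 / s * (b / k) + 16 * M / (m * \<beta>) * (b / k) \<le> 100 * (real I ^ 2 * real K ^ 2)"
      using 2 3 4 by linarith
    show "0 \<le> 1 / s * (b / k) + 16 * M / (m * \<beta>) * (b / k)"
      using assms(3,7) mb k_pos by (intro add_nonneg_nonneg mult_nonneg_nonneg) auto
  qed auto
  also have "\<dots> = real K ^ (3 * P + 5) * (6400 * real I ^ 2)"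
    by (simp add: power_add power2_eq_square power3_eq_cube algebra_simps numeral_eq_Suc)
  also have "\<dots> \<le> real K ^ (3 * P + 5) * real K ^ 3"
  proof (intro mult_left_mono)
    have "(4::nat) * 16 ^ 1 \<le> 4 * 16 ^ I" using assms(11) by (intro mult_le_mono2 power_increasing) auto
    then have "64 \<le> K" using K_ge(1) by simp
    then have K64: "64 \<le> real K" by simp
    have "real (48 * I ^ 2) \<le> real K" using K_ge(2) by (simp only: of_nat_le_iff)
    then have "6400 * real I ^ 2 \<le> 64 * 64 * real K" by simp
    also have "\<dots> \<le> real K * real K * real K" using K64 by (intro mult_mono) auto
    finally show "6400 * real I ^ 2 \<le> real K ^ 3" by (simp add: power3_eq_cube)
  qed auto
  also have "\<dots> = real K ^ (3 * P + 8)" by (simp add: power_add[symmetric] add.commute)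
  finally show ?thesis .
qed

text \<open>The upper bound on \<open>card U\<close> is carried along because the cross collisions
  grow like the square of the size.\<close>

definition has_spread :: "'a set \<Rightarrow> nat \<Rightarrow> bool" where
  "has_spread B S \<longleftrightarrow> (\<exists>U. U \<noteq> {} \<and> \<Psi> (real (card B)) (real S) \<le> real (card U) \<and>
     real (card U) \<le> max 1 (real (card B) / k) \<and> spread_set B U (\<Lambda> (real (card B))))"

lemma \<Lambda>_mono: "1 \<le> a \<Longrightarrow> a \<le> b \<Longrightarrow> \<Lambda> a \<le> \<Lambda> b"
  unfolding \<Lambda>_def by (intro mult_left_mono) auto

lemma \<Lambda>_nonneg: "1 \<le> b \<Longrightarrow> 0 \<le> \<Lambda> b"
  unfolding \<Lambda>_def by (intro mult_nonneg_nonneg) auto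

text \<open>Doubling the size raises the logarithm by 1, exactly the loss of one level.\<close>

lemma \<Lambda>_double:
  assumes "1 \<le> a" "2 * a \<le> b"
  shows "\<Lambda> a + real K ^ (3 * P + 8) \<le> \<Lambda> b"
proof -
  have "log 2 (2 powr 2 :: real) = 2" by (rule log_powr_cancel) auto
  then have "log 2 (2 * a) + 1 = log 2 (2 * (2 * a))" using assms by (simp add: log_mult)
  also have "\<dots> \<le> log 2 (2 * b)" using assms by simp
  finally have "real K ^ (3 * P + 8) * (log 2 (2 * a) + 1) \<le> real K ^ (3 * P + 8) * log 2 (2 * b)"
    by (intro mult_left_mono) auto
  then show ?thesis by (simp add: \<Lambda>_def algebra_simps)
qed

text \<open>Assumption \<open>stable\<close> says that \<open>(B, S)\<close> maximizes
  \<open>\<Psi>\<close> among smaller pairs. The clusters inherit spread sets from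
  \<open>IH\<close>, and the sets of about \<open>M\<close> clusters are united, with cross pairs
  separated inside \<open>Z\<close>.\<close>

lemma has_spread_step:
  assumes B: "B \<subseteq> V" "\<And>u. u \<in> B \<Longrightarrow> nd B u c \<le> S" "1 \<le> S" "B \<noteq> {}"
    and gt: "1 < \<Psi> (real (card B)) (real S)"
    and stable: "\<And>B' S' c'. B' \<subseteq> B \<Longrightarrow> B' \<noteq> {} \<Longrightarrow> 1 \<le> S' \<Longrightarrow> S' \<le> S \<Longrightarrow>
      (\<And>u. u \<in> B' \<Longrightarrow> nd B' u c' \<le> S') \<Longrightarrow> \<Psi> (real (card B')) (real S') \<le> \<Psi> (real (card B)) (real S)"
    and IH: "\<And>B' S' c'. B' \<subseteq> B \<Longrightarrow> card B' < card B \<Longrightarrow> B' \<noteq> {} \<Longrightarrow> 1 \<le> S' \<Longrightarrow>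
      (\<And>u. u \<in> B' \<Longrightarrow> nd B' u c' \<le> S') \<Longrightarrow> has_spread B' S'"
  shows "has_spread B S"
proof -
  define b s where "b = real (card B)" and "s = real S"
  have fB: "finite B" by (rule finite_subset[OF B(1) finite_V])
  have cB: "1 \<le> card B" using fB B(4) by (simp add: Suc_le_eq card_gt_0_iff)
  then have b1: "1 \<le> b" by (simp add: b_def)
  have s1: "1 \<le> s" using B(3) by (simp add: s_def)
  have cBV: "card B \<le> card V" by (rule card_mono[OF finite_V B(1)])
  have I0: "0 < I" using card_V_less cB cBV by (cases I) auto
  have K1: "1 \<le> real K" using K_ge_4 by simp
  note bk = \<Psi>_gt_1_bounds[OF gt[folded b_def s_def] b1 s1]
  have ball: "b < 4 * k * s" unfolding b_def s_def by (rule ball_card_less[OF B(1-3)])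
  have "b / k < 4 * s" using ball k_pos by (simp add: field_simps)
  with bk(1) have "real K ^ (P + 2) < s" by linarith
  then have "real (K ^ (P + 2)) < real S" by (simp only: of_nat_power s_def)
  then have KS: "K ^ (P + 2) \<le> S" by (simp only: of_nat_less_iff less_imp_le)
  \<comment> \<open>With this base radius all cluster radii are at most
    \<open>S / (4 * K ^ P)\<close>, since \<open>4 * 16 ^ I \<le> K\<close>, and at least
    \<open>S / (2 * K ^ (P + 1))\<close>.\<close>
  define \<rho> where "\<rho> = S div K ^ (P + 1)"
  have Kpos: "0 < K ^ (P + 1)" using K_ge_4 by simp
  have \<rho>K: "K \<le> \<rho>"
    unfolding \<rho>_def using KS Kpos by (simp add: less_eq_div_iff_mult_less_eq mult.assoc)
  have \<rho>S: "\<rho> * K ^ (P + 1) \<le> S" unfolding \<rho>_def by (rule div_times_less_eq_dividend)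
  have S\<rho>: "S \<le> 2 * K ^ (P + 1) * \<rho>"
  proof -
    have "S = \<rho> * K ^ (P + 1) + S mod K ^ (P + 1)"
      unfolding \<rho>_def by (rule div_mult_mod_eq[symmetric])
    also have "\<dots> \<le> \<rho> * K ^ (P + 1) + K ^ (P + 1)" using Kpos by (simp add: less_imp_le)
    also have "\<dots> \<le> \<rho> * K ^ (P + 1) + \<rho> * K ^ (P + 1)" using \<rho>K K_ge_4 by simp
    finally show ?thesis by (simp add: algebra_simps)
  qed
  have "b / k \<le> b" using k_ge_1 b1 by (simp add: field_simps)
  with bk(1) have "4 * real K ^ (P + 2) < b" by linarith
  then have "real (4 * K ^ (P + 2)) < real (card B)" by (simp only: of_nat_power of_nat_mult of_nat_numeral b_def)
  then have "4 * K ^ (P + 2) < card B" by (simp only: of_nat_less_iff)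
  moreover have "8 * K \<le> 4 * K ^ (P + 2)"
  proof -
    have "2 * K \<le> K * K" using K_ge_4 by simp
    also have "\<dots> \<le> K * K * K ^ P" using K_ge_4 by simp
    finally show ?thesis by (simp add: mult.assoc)
  qed
  ultimately have B8: "8 * K \<le> card B" by linarith
  have K2: "2 \<le> K" using K_ge_4 by simp
  obtain X Z E0 Q j i where
    XZ: "X \<inter> Z = {}" "X \<subseteq> B" "Z \<subseteq> B"
    and cover: "\<And>w. w \<in> Z \<Longrightarrow> card {u \<in> B. w \<in> sym_diff (N u) (N c)} \<le> 4 * S"
    and i: "i < I" and E0: "E0 \<subseteq> X" "disjoint_family_on Q E0"
    and Q: "\<And>e. e \<in> E0 \<Longrightarrow> Q e \<subseteq> X" "\<And>e. e \<in> E0 \<Longrightarrow> card (Q e) = K ^ j"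
    and near: "\<And>e u. e \<in> E0 \<Longrightarrow> u \<in> Q e \<Longrightarrow> nd Z u e \<le> \<rho> * 16 ^ i"
    and self: "\<And>e u. e \<in> E0 \<Longrightarrow> u \<in> Q e \<Longrightarrow> nd (Q e) u e \<le> 4 * (\<rho> * 16 ^ i)"
    and far: "\<And>e e' u v. e \<in> E0 \<Longrightarrow> e' \<in> E0 \<Longrightarrow> e \<noteq> e' \<Longrightarrow> u \<in> Q e \<Longrightarrow> v \<in> Q e' \<Longrightarrow> 14 * (\<rho> * 16 ^ i) \<le> nd Z u v"
    and many: "card B \<le> 6 * I ^ 2 * (K ^ 2 * K ^ j * card E0)"
    by (rule exists_separated_clusters[OF B(1-3) card_V_less K2 B8 \<rho>K union_bound];
      (assumption | (rule that; assumption)))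
  define r \<beta> m where "r = \<rho> * 16 ^ i" and "\<beta> = K ^ j" and "m = card E0"
  note near = near[folded r_def] and self = self[folded r_def] and far = far[folded r_def]
  have \<beta>1: "1 \<le> \<beta>" using K_ge_4 by (simp add: \<beta>_def)
  have r1: "1 \<le> r" using \<rho>K K_ge_4 by (simp add: r_def)
  have rS: "4 * r * K ^ P \<le> S"
  proof -
    have "4 * (16::nat) ^ i \<le> 4 * 16 ^ I" using i by (intro mult_le_mono2 power_increasing) auto
    then have "4 * 16 ^ i \<le> K" using K_ge(1) by linarith
    then have "4 * 16 ^ i * (\<rho> * K ^ P) \<le> K * (\<rho> * K ^ P)" by (rule mult_le_mono1)
    also have "\<dots> = \<rho> * K ^ (P + 1)" by simp
    also note \<rho>S
    finally show ?thesis by (simp add: r_def algebra_simps)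
  qed
  have "4 * r * 1 \<le> 4 * r * K ^ P" using K_ge_4 by (intro mult_le_mono2) auto
  then have rS': "4 * r \<le> S" using rS by linarith
  have Sr: "s \<le> 2 * real K ^ (P + 1) * real r"
  proof -
    have "\<rho> * 1 \<le> \<rho> * 16 ^ i" by (intro mult_le_mono2) simp
    then have "2 * K ^ (P + 1) * \<rho> \<le> 2 * K ^ (P + 1) * r" unfolding r_def by (intro mult_le_mono2) simp
    then have "S \<le> 2 * K ^ (P + 1) * r" using S\<rho> by linarith
    then have "real S \<le> real (2 * K ^ (P + 1) * r)" by (simp only: of_nat_le_iff)
    then show ?thesis by (simp add: s_def)
  qed
  have QB: "Q e \<subseteq> B" if "e \<in> E0" for e using Q(1)[OF that] XZ(2) by (rule order_trans)
  have Qne: "Q e \<noteq> {}" if "e \<in> E0" for e using Q(2)[OF that] K_ge_4 by auto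
  have fE0: "finite E0" by (rule finite_subset[OF order_trans[OF E0(1) XZ(2)] fB])
  have "m \<noteq> 0"
  proof
    assume "m = 0"
    then have "card B \<le> 0" using many by (simp only: m_def mult_0_right)
    then show False using cB by simp
  qed
  then have "E0 \<noteq> {}" by (auto simp: m_def)
  then obtain e0 where e0: "e0 \<in> E0" by auto
  have \<beta>B: "\<beta> \<le> card B" using card_mono[OF fB QB[OF e0]] Q(2)[OF e0] by (simp add: \<beta>_def)
  \<comment> \<open>Maximality is applied to a single cluster with its own radius; the common size
    makes the outcome valid for all.\<close>
  have "\<Psi> (real (card (Q e0))) (real (4 * r)) \<le> \<Psi> b s"
    unfolding b_def s_def
  proof (rule stable[OF QB[OF e0] Qne[OF e0] _ rS'])
    show "1 \<le> 4 * r" using r1 by simp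
    show "nd (Q e0) u e0 \<le> 4 * r" if "u \<in> Q e0" for u by (rule self[OF e0 that])
  qed
  then have st: "\<Psi> (real \<beta>) (4 * real r) \<le> \<Psi> b s" using Q(2)[OF e0] by (simp add: \<beta>_def)
  have rs: "4 * real r * real K ^ P \<le> s"
  proof -
    have "real (4 * r * K ^ P) \<le> real S" using rS by (simp only: of_nat_le_iff)
    then show ?thesis by (simp add: s_def)
  qed
  have \<beta>b: "1 \<le> real \<beta>" "real \<beta> \<le> b" "1 \<le> real r" using \<beta>1 \<beta>B r1 by (simp_all add: b_def)
  note small = cluster_small[OF st \<beta>b rs]
  have many': "b \<le> 6 * real I ^ 2 * real K ^ 2 * real \<beta> * real m"
  proof -
    have "real (card B) \<le> real (6 * I ^ 2 * (K ^ 2 * K ^ j * card E0))" using many by (simp only: of_nat_le_iff)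
    then show ?thesis by (simp add: b_def \<beta>_def m_def mult.assoc)
  qed
  have K3: "64 \<le> real K ^ 3"
  proof -
    have "(4::real) ^ 3 \<le> real K ^ 3" using K_ge_4 by (intro power_mono) auto
    then show ?thesis by simp
  qed
  have two_\<beta>: "2 * real \<beta> \<le> b"
  proof -
    have "2 * real \<beta> \<le> real K ^ 3 * real \<beta>" using K3 by (intro mult_right_mono) auto
    then show ?thesis using small(2) by linarith
  qed
  have \<beta>less: "\<beta> < card B" using two_\<beta> \<beta>1 by (simp add: b_def)
  \<comment> \<open>A single cluster would have to cover a fraction
    \<open>1 / (6 * I ^ 2 * K ^ 2)\<close> of \<open>B\<close>, but clusters are smaller than
    \<open>B\<close> by \<open>K ^ 3\<close>.\<close>
  have m2: "2 \<le> m"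
  proof (rule ccontr)
    assume "\<not> 2 \<le> m"
    then have "m = 1" using \<open>m \<noteq> 0\<close> by simp
    then have "real K ^ 3 * real \<beta> \<le> 6 * real I ^ 2 * real K ^ 2 * real \<beta>"
      using many' small(2) by simp
    then have "real K * (real K ^ 2 * real \<beta>) \<le> 6 * real I ^ 2 * (real K ^ 2 * real \<beta>)"
      by (simp add: power3_eq_cube power2_eq_square algebra_simps)
    then have "real K \<le> 6 * real I ^ 2"
      using \<beta>1 K1 by (subst (asm) mult_le_cancel_right_pos) auto
    moreover have "48 * real I ^ 2 \<le> real K"
    proof -
      have "real (48 * I ^ 2) \<le> real K" using K_ge(2) by (simp only: of_nat_le_iff)
      then show ?thesis by simp
    qed
    moreover have "real I ^ 2 > 0" using I0 by simp
    ultimately show False by linarith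
  qed
  have "\<forall>e\<in>E0. \<exists>U. U \<noteq> {} \<and> \<Psi> (real \<beta>) (4 * real r) \<le> real (card U) \<and>
     real (card U) \<le> max 1 (real \<beta> / k) \<and> spread_set (Q e) U (\<Lambda> (real \<beta>))"
  proof
    fix e assume e: "e \<in> E0"
    have "has_spread (Q e) (4 * r)"
    proof (rule IH[OF QB[OF e] _ Qne[OF e]])
      show "card (Q e) < card B" using \<beta>less Q(2)[OF e] by (simp add: \<beta>_def)
      show "1 \<le> 4 * r" using r1 by simp
      show "nd (Q e) u e \<le> 4 * r" if "u \<in> Q e" for u by (rule self[OF e that])
    qed
    then show "\<exists>U. U \<noteq> {} \<and> \<Psi> (real \<beta>) (4 * real r) \<le> real (card U) \<and>
     real (card U) \<le> max 1 (real \<beta> / k) \<and> spread_set (Q e) U (\<Lambda> (real \<beta>))"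
      unfolding has_spread_def using Q(2)[OF e] by (simp add: \<beta>_def)
  qed
  from bchoice[OF this] obtain U where U': "\<forall>e\<in>E0. U e \<noteq> {} \<and> \<Psi> (real \<beta>) (4 * real r) \<le> real (card (U e)) \<and>
     real (card (U e)) \<le> max 1 (real \<beta> / k) \<and> spread_set (Q e) (U e) (\<Lambda> (real \<beta>))" by (rule exE)
  have U: "U e \<noteq> {}" "\<Psi> (real \<beta>) (4 * real r) \<le> real (card (U e))"
    "real (card (U e)) \<le> max 1 (real \<beta> / k)" "spread_set (Q e) (U e) (\<Lambda> (real \<beta>))" "U e \<subseteq> Q e"
    if "e \<in> E0" for e
    using bspec[OF U' that] by (simp_all add: spread_set_def)
  \<comment> \<open>The first cap is required for choosing representatives; the second keeps the
    union below \<open>b / k\<close> when every cluster contributes a single vertex.\<close>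
  define M where "M = min (m div 2) (nat \<lfloor>b / k\<rfloor>)"
  have bk1: "1 < b / k"
  proof -
    have "4 * 1 \<le> 4 * real K ^ (P + 2)" using K1 by (intro mult_left_mono one_le_power) auto
    then show ?thesis using bk(1) by linarith
  qed
  have M: "0 < M" "2 * M \<le> card E0" "real M \<le> b / k"
  proof -
    show "0 < M" using m2 bk1 by (auto simp: M_def)
    show "2 * M \<le> card E0" by (auto simp: M_def m_def)
    have "real M \<le> real (nat \<lfloor>b / k\<rfloor>)" by (simp add: M_def)
    also have "\<dots> \<le> b / k" using bk1 by simp
    finally show "real M \<le> b / k" .
  qed
  have rS1: "r \<le> S" using rS' by simp
  have r0: "0 < r" and \<beta>0: "0 < \<beta>" using r1 \<beta>1 by simp_all
  have "\<exists>E\<subseteq>E0. card E \<le> M \<and> M \<le> 2 * card E \<and> (\<exists>\<mu> q. set_pmf \<mu> \<subseteq> Pow Z \<and>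
     (\<forall>e\<in>E. \<forall>e'\<in>E. e \<noteq> e' \<longrightarrow> (\<forall>u\<in>U e. \<forall>v\<in>U e'. conc \<mu> (N u) (N v) (q u v))) \<and>
     (\<Sum>(u, v)\<in>cross_pairs E U. q u v) \<le> real (card (cross_pairs E U)) *
       (8 * (real S / real r) ^ 3 * (1 / real S + 16 * real M / (real (card E0) * real \<beta>))))"
    by (rule exists_cross_spread[OF B(1,2) XZ(3) cover fE0 E0(2) QB Q(2)[folded \<beta>_def] near far r0 rS1 M(1,2) \<beta>0 U(5)])
  then obtain E \<mu> q where E: "E \<subseteq> E0" "card E \<le> M" "M \<le> 2 * card E" and \<mu>: "set_pmf \<mu> \<subseteq> Pow Z"
    "\<forall>e\<in>E. \<forall>e'\<in>E. e \<noteq> e' \<longrightarrow> (\<forall>u\<in>U e. \<forall>v\<in>U e'. conc \<mu> (N u) (N v) (q u v))"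
    "(\<Sum>(u, v)\<in>cross_pairs E U. q u v) \<le> real (card (cross_pairs E U)) *
       (8 * (real S / real r) ^ 3 * (1 / real S + 16 * real M / (real (card E0) * real \<beta>)))"
    by (elim exE conjE)
  define R where "R = 8 * (s / real r) ^ 3 * (1 / s + 16 * real M / (real m * real \<beta>))"
  define W where "W = (\<Union>e\<in>E. U e)"
  have fE: "finite E" by (rule finite_subset[OF E(1) fE0])
  have R0: "0 \<le> R" using s1 by (simp add: R_def)
  have fU: "finite (U e)" if "e \<in> E0" for e
    by (rule finite_subset[OF order_trans[OF U(5)[OF that] QB[OF that]] fB])
  have cW: "card W = (\<Sum>e\<in>E. card (U e))"
    unfolding W_def
  proof (rule card_UN_disjoint[OF fE])
    show "\<forall>e\<in>E. finite (U e)" using fU E(1) by auto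
    show "\<forall>e\<in>E. \<forall>e'\<in>E. e \<noteq> e' \<longrightarrow> U e \<inter> U e' = {}"
    proof (intro ballI impI)
      fix e e' assume "e \<in> E" "e' \<in> E" and ne: "e \<noteq> e'"
      then have e: "e \<in> E0" "e' \<in> E0" using E(1) by auto
      show "U e \<inter> U e' = {}"
        using disjoint_family_onD[OF E0(2) e ne] U(5)[OF e(1)] U(5)[OF e(2)] by auto
    qed
  qed
  have m\<beta>: "real m * real \<beta> \<le> b"
  proof -
    have "card (\<Union>e\<in>E0. Q e) = (\<Sum>e\<in>E0. card (Q e))"
      using E0(2) finite_subset[OF QB fB] fE0 by (intro card_UN_disjoint) (auto simp: disjoint_family_on_def)
    also have "\<dots> = m * \<beta>" using Q(2) by (simp add: m_def \<beta>_def)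
    finally have "m * \<beta> = card (\<Union>e\<in>E0. Q e)" by simp
    also have "\<dots> \<le> card B" using QB by (intro card_mono fB) auto
    finally have "real (m * \<beta>) \<le> real (card B)" by (simp only: of_nat_le_iff)
    then show ?thesis by (simp add: b_def)
  qed
  \<comment> \<open>If \<open>\<beta> \<ge> k\<close>, the total is at most
    \<open>m * \<beta> / k\<close>; otherwise each cluster contributes at most one vertex.\<close>
  have W_upper: "real (card W) \<le> b / k"
  proof -
    have "real (card W) = (\<Sum>e\<in>E. real (card (U e)))" by (simp add: cW)
    also have "\<dots> \<le> (\<Sum>e\<in>E. max 1 (real \<beta> / k))" using U(3) E(1) by (intro sum_mono) auto
    also have "\<dots> = real (card E) * max 1 (real \<beta> / k)" by simp
    also have "\<dots> \<le> real M * max 1 (real \<beta> / k)" using E(2) by (intro mult_right_mono) auto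
    also have "\<dots> \<le> b / k"
    proof (cases "1 \<le> real \<beta> / k")
      case True
      have "real M * (real \<beta> / k) \<le> real m * (real \<beta> / k)"
        using True by (intro mult_right_mono) (auto simp: M_def)
      also have "\<dots> = (real m * real \<beta>) / k" by simp
      also have "\<dots> \<le> b / k" using m\<beta> k_pos by (intro divide_right_mono) auto
      finally show ?thesis using True by (simp add: max_absorb2)
    qed (use M(3) in \<open>simp add: max_absorb1\<close>)
    finally show ?thesis .
  qed
  have E_half: "real M / 2 \<le> real (card E)" using E(3) by linarith
  \<comment> \<open>If the first cap is active, \<open>card E\<close> is at least
    \<open>m / 6\<close> and the gain from splitting applies. If the second is, nonempty pieces
    suffice: \<open>\<Psi> b s\<close> is at most a quarter of \<open>b / k\<close>.\<close>
  have W_lower: "\<Psi> b s \<le> real (card W)"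
  proof (cases "m div 2 \<le> nat \<lfloor>b / k\<rfloor>")
    case True
    then have "M = m div 2" by (simp add: M_def)
    then have "m \<le> 3 * M" using m2 by linarith
    then have "real m \<le> 3 * real M" by linarith
    then have mE: "real m / 6 \<le> real (card E)" using E_half by linarith
    have \<Psi>0: "0 \<le> \<Psi> (real \<beta>) (4 * real r)" using k_pos by (simp add: \<Psi>_def)
    have "\<Psi> b s \<le> real m / 6 * \<Psi> (real \<beta>) (4 * real r)"
    proof (rule many_clusters_bound[OF small(1) \<beta>b(1,2) _ _ I0 many'])
      show "0 < real r" using r1 by simp
      have "real (4 * r) \<le> real S" using rS' by (simp only: of_nat_le_iff)
      then show "4 * real r \<le> s" by (simp add: s_def)
    qed
    also have "\<dots> \<le> real (card E) * \<Psi> (real \<beta>) (4 * real r)" using mE \<Psi>0 by (rule mult_right_mono)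
    also have "\<dots> = (\<Sum>e\<in>E. \<Psi> (real \<beta>) (4 * real r))" by simp
    also have "\<dots> \<le> (\<Sum>e\<in>E. real (card (U e)))" using U(2) E(1) by (intro sum_mono) auto
    finally show ?thesis by (simp add: cW)
  next
    case False
    then have "M = nat \<lfloor>b / k\<rfloor>" by (simp add: M_def)
    then have "real M = of_int \<lfloor>b / k\<rfloor>" using bk1 by simp
    moreover have "1 \<le> \<lfloor>b / k\<rfloor>" using bk1 by simp
    moreover have "b / k < of_int \<lfloor>b / k\<rfloor> + 1" by linarith
    ultimately have "b / k \<le> 2 * real M" by linarith
    then have bE: "b / k \<le> 4 * real (card E)" using E_half by linarith
    have b\<zeta>: "4 \<le> b powr \<zeta>"
    proof -
      have "4 * 1 \<le> 4 * real K ^ (P + 2)" using K1 by (intro mult_left_mono one_le_power) auto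
      then show ?thesis using bk(2) by linarith
    qed
    have "s powr (- y) \<le> s powr 0" using s1 y by (intro powr_mono) auto
    then have "b powr (1 - \<zeta>) * s powr (- y) \<le> b powr (1 - \<zeta>) * 1"
      using s1 by (intro mult_left_mono) auto
    also have "\<dots> = b / b powr \<zeta>" using b1 by (simp add: powr_diff)
    also have "\<dots> \<le> b / 4" using b\<zeta> b1 by (intro divide_left_mono) auto
    finally have "\<Psi> b s \<le> b / 4 / k" unfolding \<Psi>_def using k_pos by (intro divide_right_mono) auto
    also have "\<dots> = 1 / 4 * (b / k)" by simp
    also have "\<dots> \<le> 1 / 4 * (4 * real (card E))" using bE by (rule mult_left_mono) simp
    also have "\<dots> = real (card E)" by simp
    also have "\<dots> = (\<Sum>e\<in>E. 1)" by simp
    also have "\<dots> \<le> (\<Sum>e\<in>E. real (card (U e)))"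
    proof (intro sum_mono)
      fix e assume "e \<in> E"
      then have "e \<in> E0" using E(1) by auto
      then show "1 \<le> real (card (U e))" using U(1) fU by (simp add: Suc_le_eq card_gt_0_iff)
    qed
    finally show ?thesis by (simp add: cW)
  qed
  have "R * (b / k) \<le> real K ^ (3 * P + 8)"
    unfolding R_def
  proof (rule cross_bound[OF _ Sr _ ball M(3) _ b1 _ _ _ I0])
    show "b \<le> k\<^sup>2" using cBV card_V_le by (simp add: b_def)
    show "b \<le> 6 * real I ^ 2 * real K ^ 2 * (real m * real \<beta>)" using many' by (simp add: algebra_simps)
    show "0 < real m * real \<beta>" using \<beta>1 m2 by simp
  qed (use r1 s1 in auto)
  moreover have "R * real (card W) \<le> R * (b / k)" using W_upper R0 by (rule mult_left_mono)
  ultimately have RW: "R * real (card (\<Union>e\<in>E. U e)) \<le> real K ^ (3 * P + 8)" unfolding W_def by linarith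
  have "spread_set B (\<Union>e\<in>E. U e) (\<Lambda> (real \<beta>) + real K ^ (3 * P + 8))"
  proof (rule spread_set_UN[OF fB XZ(3) fE _ _ _ _ \<mu>(1,2) \<mu>(3)[folded s_def m_def, folded R_def] R0 RW])
    show "disjoint_family_on Q E" by (rule disjoint_family_on_mono[OF E(1) E0(2)])
    show "Q e \<subseteq> B" if "e \<in> E" for e using QB that E(1) by auto
    show "Q e \<inter> Z = {}" if "e \<in> E" for e using Q(1)[of e] that E(1) XZ(1) by auto
    show "spread_set (Q e) (U e) (\<Lambda> (real \<beta>))" if "e \<in> E" for e using U(4) that E(1) by auto
  qed
  then have "spread_set B W (\<Lambda> b)"
    unfolding W_def by (rule spread_set_mono[OF _ order_refl \<Lambda>_double[OF \<beta>b(1) two_\<beta>]])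
  moreover have "W \<noteq> {}" using W_lower gt by (auto simp: b_def s_def)
  ultimately show ?thesis
    unfolding has_spread_def using W_lower W_upper
    by (intro exI[of _ W]) (auto simp: b_def s_def)
qed

text \<open>The pair is replaced by a maximizer of \<open>\<Psi>\<close> below it, which can only
  raise the required size and tighten the other conditions. If the maximum is at most 1 a single
  vertex is enough; otherwise the step applies, with the induction on \<open>card B\<close> for the
  clusters.\<close>

lemma has_spread:
  assumes "B \<subseteq> V" "B \<noteq> {}" "1 \<le> S" "\<And>u. u \<in> B \<Longrightarrow> nd B u c \<le> S"
  shows "has_spread B S"
  using assms
proof (induction "card B" arbitrary: B S c rule: less_induct)
  case less
  have fB: "finite B" by (rule finite_subset[OF less.prems(1) finite_V])
  define \<C> where "\<C> = {(B', S'). B' \<subseteq> B \<and> B' \<noteq> {} \<and> 1 \<le> S' \<and> S' \<le> S \<and> (\<exists>c. \<forall>u\<in>B'. nd B' u c \<le> S')}"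
  have "\<C> \<subseteq> Pow B \<times> {..S}" by (auto simp: \<C>_def)
  then have f\<C>: "finite \<C>" by (rule finite_subset) (use fB in simp)
  have "\<exists>c. \<forall>u\<in>B. nd B u c \<le> S" by (intro exI[of _ c] ballI less.prems(4))
  then have "(B, S) \<in> \<C>" using less.prems(2,3) by (simp add: \<C>_def)
  then have ne: "\<C> \<noteq> {}" by auto
  define F where "F p = \<Psi> (real (card (fst p))) (real (snd p))" for p :: "'a set \<times> nat"
  obtain p where p: "p \<in> \<C>" "\<And>p'. p' \<in> \<C> \<Longrightarrow> F p' \<le> F p"
  proof -
    have "Max (F ` \<C>) \<in> F ` \<C>" using f\<C> ne by (intro Max_in) auto
    then obtain p where "p \<in> \<C>" "F p = Max (F ` \<C>)" by auto
    then show ?thesis using that[of p] f\<C> by (simp add: Max_ge)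
  qed
  obtain B1 S1 where p_eq: "p = (B1, S1)" by (cases p)
  obtain c1 where B1: "B1 \<subseteq> B" "B1 \<noteq> {}" "1 \<le> S1" "S1 \<le> S" "\<And>u. u \<in> B1 \<Longrightarrow> nd B1 u c1 \<le> S1"
    using p(1) unfolding p_eq \<C>_def by auto
  have fB1: "finite B1" by (rule finite_subset[OF B1(1) fB])
  have c1: "1 \<le> card B1" "card B1 \<le> card B"
    using fB1 B1(2) card_mono[OF fB B1(1)] by (simp_all add: Suc_le_eq card_gt_0_iff)
  have max: "\<Psi> (real (card B')) (real S') \<le> \<Psi> (real (card B1)) (real S1)"
    if "B' \<subseteq> B" "B' \<noteq> {}" "1 \<le> S'" "S' \<le> S" "\<And>u. u \<in> B' \<Longrightarrow> nd B' u c' \<le> S'" for B' S' c'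
  proof -
    have "\<exists>c. \<forall>u\<in>B'. nd B' u c \<le> S'" by (intro exI[of _ c'] ballI that(5))
    then have "(B', S') \<in> \<C>" using that(1-4) by (simp add: \<C>_def)
    from p(2)[OF this] show ?thesis by (simp add: F_def p_eq)
  qed
  have "has_spread B1 S1"
  proof (cases "1 < \<Psi> (real (card B1)) (real S1)")
    case True
    show ?thesis
    proof (rule has_spread_step[OF order_trans[OF B1(1) less.prems(1)] B1(5,3,2) True])
      fix B' S' c' assume "B' \<subseteq> B1" "B' \<noteq> {}" "1 \<le> S'" "S' \<le> S1" "\<And>u. u \<in> B' \<Longrightarrow> nd B' u c' \<le> S'"
      then show "\<Psi> (real (card B')) (real S') \<le> \<Psi> (real (card B1)) (real S1)"
        using B1(1,4) by (intro max[of _ _ c']) auto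
    next
      fix B' S' c' assume *: "B' \<subseteq> B1" "card B' < card B1" "B' \<noteq> {}" "1 \<le> S'" "\<And>u. u \<in> B' \<Longrightarrow> nd B' u c' \<le> S'"
      show "has_spread B' S'"
        by (rule less.hyps[OF _ _ *(3,4,5)]) (use * c1 B1(1) less.prems(1) in auto)
    qed
  next
    case False
    obtain u where u: "u \<in> B1" using B1(2) by auto
    have "spread_set B1 {u} (\<Lambda> (real (card B1)))"
      using c1 by (intro spread_set_singleton[OF u] \<Lambda>_nonneg) auto
    then show ?thesis
      unfolding has_spread_def using False by (intro exI[of _ "{u}"]) auto
  qed
  then obtain U where U: "U \<noteq> {}" "\<Psi> (real (card B1)) (real S1) \<le> real (card U)"
    "real (card U) \<le> max 1 (real (card B1) / k)" "spread_set B1 U (\<Lambda> (real (card B1)))"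
    unfolding has_spread_def by auto
  have "\<Psi> (real (card B)) (real S) \<le> real (card U)"
    using max[of B S c] less.prems U(2) by auto
  moreover have "real (card U) \<le> max 1 (real (card B) / k)"
  proof -
    have "real (card B1) / k \<le> real (card B) / k" using c1 k_pos by (intro divide_right_mono) auto
    then show ?thesis using U(3) by (auto simp: max_def split: if_splits)
  qed
  moreover have "spread_set B U (\<Lambda> (real (card B)))"
    by (rule spread_set_mono[OF U(4) B1(1) \<Lambda>_mono]) (use c1 in auto)
  ultimately show ?case unfolding has_spread_def using U(1) by auto
qed

end

section \<open>Choice of the parameters\<close>

lemma eventually_powr_le:
  fixes C c d :: real
  assumes "c < d"
  shows "\<forall>\<^sub>F n in sequentially. C * real n powr c \<le> real n powr d"
proof -
  have "filterlim (\<lambda>n. real n powr (d - c)) at_top sequentially"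
    using assms by real_asymp
  then have "\<forall>\<^sub>F n in sequentially. C \<le> real n powr (d - c)"
    by (simp add: filterlim_at_top)
  then show ?thesis using eventually_gt_at_top[of 0]
  proof eventually_elim
    case (elim n)
    have "C * real n powr c \<le> real n powr (d - c) * real n powr c"
      using elim by (intro mult_right_mono) auto
    also have "\<dots> = real n powr d" using elim by (simp add: powr_add[symmetric])
    finally show ?case .
  qed
qed

lemma eventually_union_bound:
  fixes a :: real
  assumes "0 < a"
  shows "\<forall>\<^sub>F n in sequentially. 2 * (real n ^ 2 + 1) * (88/100) powr (4 * real n powr a) < (1 :: real)"
proof -
  have "(\<lambda>n. 2 * (real n ^ 2 + 1) * (88/100) powr (4 * real n powr a)) \<longlonglongrightarrow> (0 :: real)"
    using assms by real_asymp
  then show ?thesis by (rule order_tendstoD(2)) simp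
qed

lemma eventually_loss_le:
  fixes C c d :: real
  assumes "c < d" "0 < d"
  shows "\<forall>\<^sub>F n in sequentially. 1 + C * real n powr c * log 2 (2 * real n) \<le> real n powr d"
proof -
  have 1: "\<forall>\<^sub>F n in sequentially. 2 * \<bar>C\<bar> * real n powr ((c + d) / 2) \<le> real n powr d"
    by (rule eventually_powr_le) (use assms in simp)
  have 2: "\<forall>\<^sub>F n in sequentially. 2 * real n powr 0 \<le> real n powr d"
    by (rule eventually_powr_le) (use assms in simp)
  have 3: "\<forall>\<^sub>F n in sequentially. log 2 (2 * real n) \<le> real n powr ((d - c) / 2)"
    using assms by real_asymp
  show ?thesis using 1 2 3 eventually_gt_at_top[of 0]
  proof eventually_elim
    case (elim n)
    have "C * real n powr c * log 2 (2 * real n) \<le> \<bar>C\<bar> * real n powr c * real n powr ((d - c) / 2)"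
      using elim by (intro mult_mono mult_right_mono) auto
    also have "\<dots> = \<bar>C\<bar> * real n powr ((c + d) / 2)"
      using elim by (simp add: powr_add[symmetric] field_simps)
    finally show ?case using elim by simp
  qed
qed

lemma eventually_distinct_degrees:
  fixes \<epsilon> :: real
  assumes "0 < \<epsilon>" "\<epsilon> \<le> 1"
  shows "\<forall>\<^sub>F n in sequentially. \<forall>V (N :: 'a \<Rightarrow> 'a set).
    small_homogeneous_sets V N (sqrt (real n)) \<longrightarrow> card V = n \<longrightarrow>
    (\<exists>S\<subseteq>V. real n powr (1/2 - \<epsilon>) \<le> real (card ((\<lambda>v. card (N v \<inter> S)) ` S)))"
proof -
  \<comment> \<open>The value serves as \<open>y\<close> too. Together they cost half of
    \<open>\<epsilon>\<close> in the exponent of \<open>\<Psi>\<close>; the other half pays for the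
    collisions.\<close>
  define \<zeta> where "\<zeta> = \<epsilon> / 4"
  have \<zeta>: "0 < \<zeta>" "\<zeta> < 1" using assms by (simp_all add: \<zeta>_def)
  define P where "P = nat \<lceil>3 / (\<zeta> * \<zeta>)\<rceil>"
  have P: "3 \<le> real P * \<zeta> * \<zeta>"
  proof -
    have "3 / (\<zeta> * \<zeta>) \<le> real P" unfolding P_def by linarith
    then show ?thesis using \<zeta> by (simp add: field_simps)
  qed
  \<comment> \<open>Chosen so that \<open>K ^ (3 * P + 8)\<close>, with \<open>K\<close> about
    \<open>n powr (1 / I)\<close>, stays below \<open>n powr (\<zeta> / 2)\<close> up to a constant
    factor.\<close>
  define I where "I = Suc (nat \<lceil>2 * real (3 * P + 8) / \<zeta>\<rceil>)"
  define a where "a = 1 / real I"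
  have a0: "0 < a" by (simp add: a_def I_def)
  have aI: "2 * real (3 * P + 8) * a < \<zeta>"
  proof -
    have "2 * real (3 * P + 8) / \<zeta> < real I" unfolding I_def by linarith
    then have "2 * real (3 * P + 8) < \<zeta> * real I" using \<zeta> by (simp add: field_simps)
    then show ?thesis unfolding a_def by (simp add: field_simps I_def)
  qed
  have aP: "real (P + 2) * a < \<zeta> / 2"
  proof -
    have "2 * real (P + 2) * a \<le> 2 * real (3 * P + 8) * a" using a0 by (intro mult_right_mono) auto
    then have "2 * real (P + 2) * a < \<zeta>" using aI by linarith
    then show ?thesis by (simp add: algebra_simps)
  qed
  have aL: "real (3 * P + 8) * a < \<epsilon> / 2" "0 < \<epsilon> / 2" using aI a0 assms by (simp_all add: \<zeta>_def algebra_simps)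
  have e1: "\<forall>\<^sub>F n in sequentially. real (4 * 16 ^ I + 48 * I ^ 2) * real n powr 0 \<le> real n powr a"
    by (rule eventually_powr_le[OF a0])
  have e2: "\<forall>\<^sub>F n in sequentially. 4 * 2 ^ (P + 2) * real n powr (real (P + 2) * a) \<le> real n powr (\<zeta> / 2)"
    by (rule eventually_powr_le[OF aP])
  note e3 = eventually_union_bound[OF a0]
  have e4: "\<forall>\<^sub>F n in sequentially. 1 + 2 ^ (3 * P + 8) * real n powr (real (3 * P + 8) * a) * log 2 (2 * real n) \<le> real n powr (\<epsilon> / 2)"
    by (rule eventually_loss_le[OF aL])
  show ?thesis using e1 e2 e3 e4 eventually_gt_at_top[of 0]
  proof eventually_elim
    case (elim n)
    define x where "x = real n powr a"
    \<comment> \<open>Rounding strictly up gives \<open>x < K\<close>, hence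
      \<open>n < K ^ I\<close>, and still \<open>K \<le> 2 * x\<close>.\<close>
    define K where "K = Suc (nat \<lfloor>x\<rfloor>)"
    have n1: "1 \<le> real n" using elim(5) by simp
    have x1: "1 \<le> x" unfolding x_def using n1 a0 by (intro ge_one_powr_ge_zero) auto
    have xK: "x < real K" "real K \<le> 2 * x" using x1 unfolding K_def by linarith+
    have K_pow: "real K ^ j \<le> 2 ^ j * real n powr (real j * a)" for j
    proof -
      have "real K ^ j \<le> (2 * x) ^ j" using xK by (intro power_mono) auto
      also have "real n powr (real j * a) = x powr real j" by (simp add: x_def powr_powr mult.commute)
      then have "x ^ j = real n powr (real j * a)" using x1 by (simp add: powr_realpow)
      then have "(2 * x) ^ j = 2 ^ j * real n powr (real j * a)" by (simp add: power_mult_distrib)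
      finally show ?thesis .
    qed
    have log0: "0 \<le> log 2 (2 * real n)" using n1 by simp
    show ?case
    proof (intro allI impI)
      fix V :: "'a set" and N
      assume G: "small_homogeneous_sets V N (sqrt (real n))" and cV: "card V = n"
      interpret small_homogeneous_sets V N "sqrt (real n)" by (rule G)
      interpret scaled_graph V N "sqrt (real n)" \<zeta> \<zeta> K I P
      proof
        show "card V < K ^ I"
        proof -
          have "a * real I = 1" by (simp add: a_def I_def)
          then have "real n = x powr real I" using n1 by (simp add: x_def powr_powr)
          also have "\<dots> = x ^ I" using x1 by (simp add: powr_realpow)
          also have "\<dots> < real K ^ I" using xK x1 by (intro power_strict_mono) (auto simp: I_def)
          finally have "real n < real (K ^ I)" by simp
          then show ?thesis unfolding cV by (simp only: of_nat_less_iff)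
        qed
        have "real (4 * 16 ^ I + 48 * I ^ 2) \<le> real K" using elim(1) xK(1) n1 by (simp add: x_def)
        then have "4 * 16 ^ I + 48 * I ^ 2 \<le> K" by (simp only: of_nat_le_iff)
        then show "4 * 16 ^ I \<le> K" "48 * I ^ 2 \<le> K" by simp_all
        show "4 * real K ^ (P + 2) \<le> sqrt (real n) powr \<zeta>"
        proof -
          have "4 * real K ^ (P + 2) \<le> 4 * (2 ^ (P + 2) * real n powr (real (P + 2) * a))"
            using K_pow[of "P + 2"] by (intro mult_left_mono) auto
          also have "\<dots> \<le> real n powr (\<zeta> / 2)" using elim(2) by simp
          also have "\<dots> = sqrt (real n) powr \<zeta>" by (simp add: powr_half_sqrt[symmetric] powr_powr)
          finally show ?thesis .
        qed
        show "2 * (real (card V ^ 2) + 1) * (88/100) ^ (4 * K) < (1 :: real)"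
        proof -
          have "(88/100 :: real) ^ (4 * K) = (88/100) powr real (4 * K)" by (rule powr_realpow[symmetric]) simp
          also have "\<dots> \<le> (88/100) powr (4 * x)" using xK by (intro powr_mono') auto
          finally have "2 * (real n ^ 2 + 1) * (88/100) ^ (4 * K) \<le> 2 * (real n ^ 2 + 1) * (88/100) powr (4 * x)"
            by (intro mult_left_mono) auto
          then show ?thesis using elim(3) unfolding cV x_def by simp
        qed
      qed (use \<zeta> P n1 cV in auto)
      have Vne: "V \<noteq> {}" using cV elim(5) by auto
      have "has_spread V n"
      proof (rule has_spread[OF order_refl Vne])
        show "1 \<le> n" using elim(5) by simp
        \<comment> \<open>Distances in \<open>V\<close> never exceed \<open>n\<close>, so any centre
          will do.\<close>
        show "nd V u undefined \<le> n" for u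
          unfolding nd_def cV[symmetric] by (intro card_mono finite_V) auto
      qed
      then obtain U where U: "U \<noteq> {}" "\<Psi> (real n) (real n) \<le> real (card U)" "spread_set V U (\<Lambda> (real n))"
        unfolding has_spread_def cV by auto
      \<comment> \<open>The exponent is \<open>(1 - \<zeta>) - \<zeta> - 1/2\<close>.\<close>
      have \<Psi>: "\<Psi> (real n) (real n) = real n powr (1/2 - \<epsilon> / 2)"
        using n1 unfolding \<Psi>_def
        by (simp add: powr_add[symmetric] powr_half_sqrt[symmetric] powr_diff[symmetric] \<zeta>_def)
      have loss: "1 + \<Lambda> (real n) \<le> real n powr (\<epsilon> / 2)"
      proof -
        have "\<Lambda> (real n) \<le> 2 ^ (3 * P + 8) * real n powr (real (3 * P + 8) * a) * log 2 (2 * real n)"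
          unfolding \<Lambda>_def by (intro mult_right_mono K_pow log0)
        then show ?thesis using elim(4) by linarith
      qed
      obtain S where S: "S \<subseteq> V" "real (card U) \<le> (1 + \<Lambda> (real n)) * real (card ((\<lambda>v. card (N v \<inter> S)) ` S))"
        using spread_set_imp_distinct_degrees[OF U(3,1)] by blast
      let ?D = "real (card ((\<lambda>v. card (N v \<inter> S)) ` S))"
      have "real n powr (1/2 - \<epsilon>) * real n powr (\<epsilon> / 2) = real n powr (1/2 - \<epsilon> / 2)"
        using n1 by (simp add: powr_add[symmetric])
      also have "\<dots> \<le> (1 + \<Lambda> (real n)) * ?D" using U(2) S(2) unfolding \<Psi> by linarith
      also have "\<dots> \<le> real n powr (\<epsilon> / 2) * ?D" using loss by (intro mult_right_mono) auto
      finally have "real n powr (1/2 - \<epsilon>) * real n powr (\<epsilon> / 2) \<le> ?D * real n powr (\<epsilon> / 2)"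
        by (simp add: mult.commute)
      then have "real n powr (1/2 - \<epsilon>) \<le> ?D"
        by (rule mult_right_le_imp_le) (use n1 in simp)
      then show "\<exists>S\<subseteq>V. real n powr (1/2 - \<epsilon>) \<le> real (card ((\<lambda>v. card (N v \<inter> S)) ` S))"
        using S(1) by blast
    qed
  qed
qed

section \<open>Graphs\<close>

text \<open>Presents the induced subgraph as a pair graph, the form to which
  \<open>complete_digraph_pair_def\<close> applies.\<close>

lemma restrict_with_proj:
  "with_proj G \<restriction> S = with_proj \<lparr>pverts = S, parcs = {e \<in> parcs G. fst e \<in> S \<and> snd e \<in> S}\<rparr>"
  by (simp add: induce_subgraph_def with_proj_def)

context pair_graph
begin

lemma homogeneous_card_le_hom_num:
  assumes "Z \<subseteq> pverts G"
    and "(\<forall>u\<in>Z. \<forall>v\<in>Z. u \<noteq> v \<longrightarrow> (u, v) \<in> parcs G) \<or> (\<forall>u\<in>Z. \<forall>v\<in>Z. u \<noteq> v \<longrightarrow> (u, v) \<notin> parcs G)"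
  shows "card Z \<le> hom_num (with_proj G)"
proof -
  have fZ: "finite Z" using assms(1) pair_finite_verts by (rule finite_subset)
  have loopfree: "u \<noteq> v" if "(u, v) \<in> parcs G" for u v using pair_no_loops[OF that] by simp
  have "is_complete (with_proj G \<restriction> Z) \<or> edgeless (with_proj G \<restriction> Z)"
    using assms(2)
  proof
    assume "\<forall>u\<in>Z. \<forall>v\<in>Z. u \<noteq> v \<longrightarrow> (u, v) \<in> parcs G"
    then have "is_complete (with_proj G \<restriction> Z)"
      unfolding is_complete_def restrict_with_proj complete_digraph_pair_def
      using fZ loopfree by auto
    then show ?thesis ..
  next
    assume "\<forall>u\<in>Z. \<forall>v\<in>Z. u \<noteq> v \<longrightarrow> (u, v) \<notin> parcs G"
    then have "edgeless (with_proj G \<restriction> Z)" unfolding edgeless_def using loopfree by auto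
    then show ?thesis ..
  qed
  then have "card Z \<in> {card U |U. U \<subseteq> verts (with_proj G) \<and> (is_complete (with_proj G \<restriction> U) \<or> edgeless (with_proj G \<restriction> U))}"
    using assms(1) by auto
  moreover have "finite {card U |U. U \<subseteq> verts (with_proj G) \<and> (is_complete (with_proj G \<restriction> U) \<or> edgeless (with_proj G \<restriction> U))}"
    by (rule finite_subset[of _ "card ` Pow (pverts G)"]) (auto simp: pair_finite_verts)
  ultimately show ?thesis
    unfolding hom_num_def by (rule Max_ge[rotated])
qed

lemma num_distinct_degrees_restrict:
  "num_distinct_degrees (with_proj G \<restriction> S) = card ((\<lambda>v. card ({w. (v, w) \<in> parcs G} \<inter> S)) ` S)"
proof -
  have "out_degree (with_proj G \<restriction> S) v = card ({w. (v, w) \<in> parcs G} \<inter> S)" if "v \<in> S" for v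
  proof -
    have "out_arcs (with_proj G \<restriction> S) v = Pair v ` ({w. (v, w) \<in> parcs G} \<inter> S)"
      using that by (auto simp: out_arcs_def)
    then show ?thesis by (simp add: out_degree_def card_image inj_on_def)
  qed
  then show ?thesis by (simp add: num_distinct_degrees_def cong: image_cong)
qed

lemma distinct_degrees_le_max:
  assumes "S \<subseteq> pverts G"
  shows "card ((\<lambda>v. card ({w. (v, w) \<in> parcs G} \<inter> S)) ` S) \<le> max_distinct_degrees (with_proj G)"
proof -
  have "finite {num_distinct_degrees (with_proj G \<restriction> S) |S. S \<subseteq> verts (with_proj G)}"
    by (rule finite_subset[of _ "(\<lambda>S. num_distinct_degrees (with_proj G \<restriction> S)) ` Pow (pverts G)"])
      (auto simp: pair_finite_verts)
  moreover have "num_distinct_degrees (with_proj G \<restriction> S) \<in> {num_distinct_degrees (with_proj G \<restriction> S) |S. S \<subseteq> verts (with_proj G)}"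
    using assms by auto
  ultimately show ?thesis
    unfolding max_distinct_degrees_def num_distinct_degrees_restrict[symmetric] by (rule Max_ge)
qed

end

theorem corollary1p2:
  fixes \<epsilon> :: real
  assumes "\<epsilon> > 0"
  shows "\<exists>n\<^sub>0 :: nat. \<forall>n \<ge> n\<^sub>0. \<forall>G :: 'a pair_pre_digraph.
           pair_graph G \<and> card (pverts G) = n \<longrightarrow>
             real (max (hom_num (with_proj G)) (max_distinct_degrees (with_proj G)))
               \<ge> real n powr (1/2 - \<epsilon>)"
proof -
  \<comment> \<open>The asymptotic lemma is stated for exponents at most 1; for
    \<open>n \<ge> 1\<close> a smaller loss implies the claim for \<open>\<epsilon>\<close>.\<close>
  define \<delta> where "\<delta> = min \<epsilon> 1"
  have \<delta>: "0 < \<delta>" "\<delta> \<le> 1" "\<delta> \<le> \<epsilon>" using assms by (simp_all add: \<delta>_def)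
  obtain n0 where n0: "\<And>n V (N :: 'a \<Rightarrow> 'a set). n0 \<le> n \<Longrightarrow> small_homogeneous_sets V N (sqrt (real n)) \<Longrightarrow>
    card V = n \<Longrightarrow> \<exists>S\<subseteq>V. real n powr (1/2 - \<delta>) \<le> real (card ((\<lambda>v. card (N v \<inter> S)) ` S))"
    using eventually_distinct_degrees[OF \<delta>(1,2)] unfolding eventually_sequentially by blast
  show ?thesis
  proof (intro exI[of _ "max n0 1"] allI impI)
    fix n and G :: "'a pair_pre_digraph"
    assume n: "max n0 1 \<le> n" and "pair_graph G \<and> card (pverts G) = n"
    then have G: "pair_graph G" and cV: "card (pverts G) = n" by simp_all
    interpret pair_graph G by (rule G)
    let ?h = "hom_num (with_proj G)" and ?f = "max_distinct_degrees (with_proj G)"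
    have n1: "1 \<le> real n" using n by simp
    show "real n powr (1/2 - \<epsilon>) \<le> real (max ?h ?f)"
    proof (cases "sqrt (real n) \<le> real ?h")
      case True
      have "real n powr (1/2 - \<epsilon>) \<le> real n powr (1/2)" using n1 assms by (intro powr_mono) auto
      also have "\<dots> = sqrt (real n)" by (simp add: powr_half_sqrt)
      finally show ?thesis using True by simp
    next
      case False
      \<comment> \<open>Below the threshold \<open>sqrt n\<close> for \<open>?h\<close>, every
        homogeneous set is smaller than \<open>sqrt n\<close>, so distinct degrees must be
        plentiful.\<close>
      have "small_homogeneous_sets (pverts G) (\<lambda>v. {w. (v, w) \<in> parcs G}) (sqrt (real n))"
      proof
        show "finite (pverts G)" by (rule pair_finite_verts)
        show "u \<in> {w. (v, w) \<in> parcs G} \<longleftrightarrow> v \<in> {w. (u, w) \<in> parcs G}" for u v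
          using pair_sym_arcs by (auto simp: symmetric_def dest: symD)
        show "real (card Z) < sqrt (real n)" if "Z \<subseteq> pverts G"
          "(\<forall>u\<in>Z. \<forall>v\<in>Z. u \<noteq> v \<longrightarrow> v \<in> {w. (u, w) \<in> parcs G}) \<or>
           (\<forall>u\<in>Z. \<forall>v\<in>Z. u \<noteq> v \<longrightarrow> v \<notin> {w. (u, w) \<in> parcs G})" for Z
          using homogeneous_card_le_hom_num[of Z] that False by fastforce
      qed
      then obtain S where S: "S \<subseteq> pverts G"
        "real n powr (1/2 - \<delta>) \<le> real (card ((\<lambda>v. card ({w. (v, w) \<in> parcs G} \<inter> S)) ` S))"
        using n0[of n "pverts G" "\<lambda>v. {w. (v, w) \<in> parcs G}"] n cV by auto
      have "real n powr (1/2 - \<epsilon>) \<le> real n powr (1/2 - \<delta>)" using n1 \<delta>(3) by (intro powr_mono) auto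
      also note S(2)
      also have "real (card ((\<lambda>v. card ({w. (v, w) \<in> parcs G} \<inter> S)) ` S)) \<le> real ?f"
        using distinct_degrees_le_max[OF S(1)] by simp
      finally show ?thesis by simp
    qed
  qed
qed

end
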